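(* For all $a,b\in\{1,\dots,D\}$ and all $k$, the quasi-tau matrices $H_{[k]}$ satisfy the 2D Toda lattice type equations $$\frac{\partial}{\partial t_b}\Big(\frac{\partial H_{[k]}}{\partial t_a}H_{[k]}^{-1}\Big)=(\Lambda_a)_{[k],[k+1]}H_{[k+1]}\big[(\Lambda_b)_{[k],[k+1]}\big]^\top H_{[k]}^{-1}-H_{[k]}\big[(\Lambda_b)_{[k-1],[k]}\big]^\top H_{[k-1]}^{-1}(\Lambda_a)_{[k-1],[k]},$$ which can be rewritten for the rectangular matrices $\beta_{[k]}$ as $$\frac{\partial^2\beta_{[k]}}{\partial t_a\partial t_b}=-\frac{\partial}{\partial t_a}\Big(\beta_{[k]}(\Lambda_b)_{[k-1],[k]}\beta_{[k]}\Big)+\frac{\partial\beta_{[k]}}{\partial t_a}\beta_{[k-1]}(\Lambda_b)_{[k-2],[k-1]}+(\Lambda_b)_{[k],[k+1]}\beta_{[k+1]}\frac{\partial\beta_{[k]}}{\partial t_a}.$$ Moreover the following partial differential-difference equations hold: $$\begin{aligned}\Delta_b\Big(\frac{\partial H_{[k]}}{\partial t_a}H_{[k]}^{-1}\Big)=\;&(\Lambda_a)_{[k],[k+1]}H_{[k+1]}\big[(n_b\cdot\Lambda)_{[k],[k+1]}\big]^\top(T_bH_{[k]})^{-1}\\&-H_{[k]}\big[(n_b\cdot\Lambda)_{[k-1],[k]}\big]^\top(T_bH_{[k-1]})^{-1}(\Lambda_a)_{[k-1],[k]},\\ \frac{\partial}{\partial t_a}\big((\Delta_bH_{[k]})H_{[k]}^{-1}\big)=\;&(n_b\cdot\Lambda)_{[k],[k+1]}H_{[k+1]}\big[(\Lambda_a)_{[k],[k+1]}\big]^\top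 H_{[k]}^{-1}\\&-(T_bH_{[k]})\big[(\Lambda_a)_{[k-1],[k]}\big]^\top(T_bH_{[k-1]})^{-1}(n_b\cdot\Lambda)_{[k-1],[k]}.\end{aligned}$$
   Context: Let $D\ge 1$. For $k\in\mathbb Z_+$ let $[k]=\{\alpha\in\mathbb Z_+^D:|\alpha|=k\}$, ordered so that $\alpha>\alpha'$ iff at the first coordinate where they differ the entry of $\alpha$ is smaller. $\chi_{[k]}(x)$ is the column vector of monomials $x^\alpha$, $\alpha\in[k]$, and $\chi$ stacks $\chi_{[0]},\chi_{[1]},\dots$. Semi-infinite matrices are partitioned in blocks $A_{[k],[\ell]}\in\mathbb R^{|[k]|\times|[\ell]|}$; terms containing a block with a negative index, or $\beta_{[0]}$, are understood to be absent. Shift matrices: $\Lambda_a$ has as only nonzero blocks $(\Lambda_a)_{[k],[k+1]}$, with entries $\delta_{\alpha+e_a,\alpha'}$, $\alpha\in[k]$, $\alpha'\in[k+1]$; $n\cdot\Lambda=\sum_an_a\Lambda_a$. Flows: fix an invertible $N=(n_{a,b})\in GL(\mathbb R^D)$ with rows $n_a$, and $q\in\mathbb R^D$ with all $q_a\ne0$. Let $\mu$ be a Borel measure with finite moments, supported in $\{x:|n_a\cdot x|<|q_a|\ \forall a\}$. For real times $t=(t_\alpha)_{\alpha\in\mathbb Z_+^D}$ and $m\in\mathbb Z^D$ put $t(x)=\sum_\alpha t_\alpha x^\alpha$ and let $G(t,m)=\int\chi\,d\mu_{t,m}\,\chi^\top$ be the moment matrix of $d\mu_{t,m}(x)=e^{t(x)}\prod_a(n_a\cdot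 x-q_a)^{m_a}d\mu(x)$. It is assumed that $G(t,m)=S^{-1}H(S^{-1})^\top$ with $S=S(t,m)$ block lower triangular with identity diagonal blocks and $H(t,m)=\operatorname{diag}(H_{[0]},H_{[1]},\dots)$ with invertible blocks (the quasi-tau matrices). $\beta_{[k]}=S_{[k],[k-1]}$, $k\ge1$. The first level times are $t_a:=t_{e_a}$, $a=1,\dots,D$. $(T_bf)(m)=f(m+e_b)$, $\Delta_b=T_b-1$.
   Formalization: The right-hand side of the second-order equation for β_[k] is multiplied by −1: with β_[k]=S_[k],[k−1] the printed sign fails (D=1, k=1: left side −κ₃, right side +κ₃, κ₃ the third cumulant of the normalized measure). *)

theory Defs
  imports
    "HOL-Analysis.Analysis"
    "Jordan_Normal_Form.Gauss_Jordan_Elimination"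
begin

no_notation vec_index (infixl \<open>$\<close> 100)

text \<open>
  The coordinates of \<open>\<real>\<^sup>D\<close> are indexed by a type \<open>'d\<close> of class finite and linorder; the order is
  only used to order the multi-indices of a given length. Finite blocks are matrices of the type
  \<open>real mat\<close>, a semi-infinite matrix is the family \<open>A k l\<close> of its blocks.
\<close>

section \<open>Multi-indices and monomials\<close>

type_synonym 'd mindex = "nat ^ 'd"
type_synonym 'd point = "real ^ 'd"
type_synonym 'd coeffs = "real ^ 'd ^ 'd"
type_synonym 'd ishift = "int ^ 'd"
type_synonym 'd times = "nat ^ 'd \<Rightarrow> real"

definition mlength :: "'d::finite mindex \<Rightarrow> nat" where
  "mlength \<alpha> = (\<Sum>i\<in>UNIV. \<alpha> $ i)"

definition level :: "nat \<Rightarrow> 'd::finite mindex set" where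
  "level k = {\<alpha>. mlength \<alpha> = k}"

text \<open>The larger multi-index is the one with the smaller entry at the first difference. This is a
  strict linear order, so the list \<open>mlist k\<close> below exists and is unique; it starts with
  \<open>axis i k\<close>, where \<open>i\<close> is the first coordinate.\<close>

definition mless :: "'d::{finite,linorder} mindex \<Rightarrow> 'd mindex \<Rightarrow> bool" where
  "mless \<alpha> \<beta> \<longleftrightarrow> (\<exists>i. \<beta> $ i < \<alpha> $ i \<and> (\<forall>j<i. \<alpha> $ j = \<beta> $ j))"

definition mlist :: "nat \<Rightarrow> 'd::{finite,linorder} mindex list" where
  "mlist k = (THE xs. set xs = level k \<and> sorted_wrt mless xs)"

definition monomial :: "'d::finite mindex \<Rightarrow> 'd point \<Rightarrow> real" where
  "monomial \<alpha> x = (\<Prod>i\<in>UNIV. (x $ i) ^ (\<alpha> $ i))"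

text \<open>The number of multi-indices depends on \<open>'d\<close>, hence the type argument.\<close>

definition bsize :: "'d::{finite,linorder} itself \<Rightarrow> nat \<Rightarrow> nat" where
  "bsize _ k = card (level k :: 'd mindex set)"

section \<open>Semi-infinite block matrices\<close>

type_synonym bmat = "nat \<Rightarrow> nat \<Rightarrow> real mat"

text \<open>The product \<open>A B\<close> for block lower triangular \<open>A\<close>, whose block rows are finite:
  the blocks \<open>A k p\<close> with \<open>p > k\<close> vanish and do not contribute.\<close>

definition bmult :: "'d::{finite,linorder} itself \<Rightarrow> bmat \<Rightarrow> bmat \<Rightarrow> bmat" where
  "bmult D A B k l = Matrix.mat (bsize D k) (bsize D l)
     (\<lambda>(i, j). \<Sum>p\<le>k. (A k p * B p l) $$ (i, j))"

definition btranspose :: "bmat \<Rightarrow> bmat" where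
  "btranspose A k l = transpose_mat (A l k)"

definition bdiag :: "'d::{finite,linorder} itself \<Rightarrow> (nat \<Rightarrow> real mat) \<Rightarrow> bmat" where
  "bdiag D H k l = (if k = l then H k else 0\<^sub>m (bsize D k) (bsize D l))"

definition bone :: "'d::{finite,linorder} itself \<Rightarrow> bmat" where
  "bone D = bdiag D (\<lambda>k. 1\<^sub>m (bsize D k))"

definition blower :: "'d::{finite,linorder} itself \<Rightarrow> bmat \<Rightarrow> bool" where
  "blower D A \<longleftrightarrow> (\<forall>k l. A k l \<in> carrier_mat (bsize D k) (bsize D l)) \<and>
     (\<forall>k l. k < l \<longrightarrow> A k l = 0\<^sub>m (bsize D k) (bsize D l))"

definition bunitri :: "'d::{finite,linorder} itself \<Rightarrow> bmat \<Rightarrow> bool" where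
  "bunitri D A \<longleftrightarrow> blower D A \<and> (\<forall>k. A k k = 1\<^sub>m (bsize D k))"

text \<open>\<open>G = S\<^sup>-\<^sup>1 H (S\<^sup>-\<^sup>1)\<^sup>T\<close>, where \<open>R\<close> plays the role of \<open>S\<^sup>-\<^sup>1\<close>.
  With this normalization the blocks \<open>\<beta> k = S k (k - 1)\<close> satisfy
  \<open>\<partial>\<^sub>a (\<beta> k) = - H k (Lam a (k - 1) k)\<^sup>T (H (k - 1))\<^sup>-\<^sup>1\<close> along the flows below, which determines
  the signs in the second order equation for \<open>\<beta>\<close>.\<close>

definition block_factorization ::
    "'d::{finite,linorder} itself \<Rightarrow> bmat \<Rightarrow> bmat \<Rightarrow> (nat \<Rightarrow> real mat) \<Rightarrow> bool" where
  "block_factorization D G S H \<longleftrightarrow>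
     bunitri D S \<and>
     (\<forall>k. H k \<in> carrier_mat (bsize D k) (bsize D k) \<and> invertible_mat (H k)) \<and>
     (\<exists>R. blower D R \<and> bmult D S R = bone D \<and> bmult D R S = bone D \<and>
          G = bmult D (bmult D R (bdiag D H)) (btranspose R))"

section \<open>Shift matrices\<close>

text \<open>The entries vanish automatically unless \<open>l = k + 1\<close>.\<close>

definition Lam :: "'d::{finite,linorder} \<Rightarrow> bmat" where
  "Lam a k l = Matrix.mat (bsize TYPE('d) k) (bsize TYPE('d) l)
     (\<lambda>(i, j). if (mlist k ! i :: 'd mindex) + axis a 1 = mlist l ! j then 1 else 0)"

definition Lam_dir :: "'d::{finite,linorder} point \<Rightarrow> bmat" where
  "Lam_dir n k l = Matrix.mat (bsize TYPE('d) k) (bsize TYPE('d) l)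
     (\<lambda>(i, j). \<Sum>a\<in>UNIV. n $ a * Lam a k l $$ (i, j))"

section \<open>Flows and moment matrices\<close>

definition tpoly :: "'d::finite times \<Rightarrow> 'd point \<Rightarrow> real" where
  "tpoly t x = (\<Sum>\<^sub>\<infinity>\<alpha>. t \<alpha> * monomial \<alpha> x)"

definition weight ::
    "'d::finite coeffs \<Rightarrow> 'd point \<Rightarrow> 'd times \<Rightarrow> 'd ishift \<Rightarrow> 'd point \<Rightarrow> real" where
  "weight N q t m x = exp (tpoly t x) * (\<Prod>a\<in>UNIV. (N $ a \<bullet> x - q $ a) powi (m $ a))"

text \<open>The pairs \<open>(t, m)\<close> at which the deformed measure makes sense and has finite moments; since
  it is a signed measure in general, it is represented by its density \<open>weight N q t m\<close> with
  respect to \<open>\<mu>\<close>. If \<open>\<mu>\<close> has compact topological support inside the open polytope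
  \<open>\<forall>a. \<bar>N $ a \<bullet> x\<bar> < \<bar>q $ a\<bar>\<close>, every finitely supported \<open>t\<close> and every \<open>m\<close> are admissible.\<close>

definition admissible ::
    "'d::finite point measure \<Rightarrow> 'd coeffs \<Rightarrow> 'd point \<Rightarrow> 'd times \<Rightarrow> 'd ishift \<Rightarrow> bool" where
  "admissible \<mu> N q t m \<longleftrightarrow>
     (AE x in \<mu>. (\<lambda>\<alpha>. t \<alpha> * monomial \<alpha> x) summable_on UNIV) \<and>
     (\<forall>\<gamma>. integrable \<mu> (\<lambda>x. monomial \<gamma> x * weight N q t m x))"

definition moment_matrix ::
    "'d::{finite,linorder} point measure \<Rightarrow> 'd coeffs \<Rightarrow> 'd point \<Rightarrow>
     'd times \<Rightarrow> 'd ishift \<Rightarrow> bmat" where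
  "moment_matrix \<mu> N q t m k l = Matrix.mat (bsize TYPE('d) k) (bsize TYPE('d) l)
     (\<lambda>(i, j). \<integral>x. monomial (mlist k ! i) x * monomial (mlist l ! j) x * weight N q t m x \<partial>\<mu>)"

section \<open>Derivatives, differences and inverses\<close>

text \<open>The first level time \<open>t\<^sub>a\<close> is the value of \<open>t\<close> at \<open>axis a 1\<close>. Derivatives of
  matrix-valued functions are taken entrywise; the existence of the derivative is the separate
  predicate \<open>tdifferentiable\<close>.\<close>

definition tdifferentiable :: "'d::finite \<Rightarrow> ('d times \<Rightarrow> real mat) \<Rightarrow> 'd times \<Rightarrow> bool" where
  "tdifferentiable a F t \<longleftrightarrow>
     (\<forall>s. F (t(axis a 1 := s)) \<in> carrier_mat (dim_row (F t)) (dim_col (F t))) \<and>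
     (\<forall>i<dim_row (F t). \<forall>j<dim_col (F t).
        (\<lambda>s. F (t(axis a 1 := s)) $$ (i, j)) field_differentiable at (t (axis a 1)))"

definition tderiv :: "'d::finite \<Rightarrow> ('d times \<Rightarrow> real mat) \<Rightarrow> 'd times \<Rightarrow> real mat" where
  "tderiv a F t = Matrix.mat (dim_row (F t)) (dim_col (F t))
     (\<lambda>(i, j). deriv (\<lambda>s. F (t(axis a 1 := s)) $$ (i, j)) (t (axis a 1)))"

definition Tshift :: "'d::finite \<Rightarrow> ('d ishift \<Rightarrow> real mat) \<Rightarrow> 'd ishift \<Rightarrow> real mat" where
  "Tshift b f m = f (m + axis b 1)"

definition Tdiff :: "'d::finite \<Rightarrow> ('d ishift \<Rightarrow> real mat) \<Rightarrow> 'd ishift \<Rightarrow> real mat" where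
  "Tdiff b f m = Tshift b f m - f m"

text \<open>Only meaningful for an invertible matrix.\<close>

definition minv :: "real mat \<Rightarrow> real mat" where
  "minv A = the (mat_inverse A)"

end

theory Submission
  imports Defs
begin

text \<open>
  The rows of \<open>S\<close> are the coefficients of monic polynomials \<open>P\<^sub>k = S\<^sub>[\<^sub>k\<^sub>] \<chi>\<close> that are orthogonal for the
  deformed measure, with squared norms \<open>H\<^sub>[\<^sub>k\<^sub>]\<close>. Everything follows from one observation: a
  polynomial of degree less than \<open>k\<close> that is orthogonal to all polynomials of degree less than
  \<open>k - 1\<close> is a multiple of \<open>P\<^sub>k\<^sub>-\<^sub>1\<close>, and the factor is read off from the pairing with degree \<open>k - 1\<close>.
  Since a first level time multiplies the weight by an exponential of \<open>x\<^sub>a\<close>, and a shift of \<open>m\<^sub>b\<close>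
  multiplies it by \<open>n\<^sub>b \<bullet> x - q\<^sub>b\<close>, the observation applies to the derivative of \<open>P\<^sub>k\<close>, to the difference of
  \<open>P\<^sub>k\<close> and its shift, and to \<open>x\<^sub>a P\<^sub>k\<close> minus its components along \<open>P\<^sub>k\<^sub>+\<^sub>1\<close> and \<open>P\<^sub>k\<close>. This yields
  \<open>\<partial>\<^sub>a \<beta>\<^sub>k = - H\<^sub>k \<Lambda>\<^sub>a\<^sup>T H\<^sub>k\<^sub>-\<^sub>1\<^sup>-\<^sup>1\<close>, \<open>(\<partial>\<^sub>a H\<^sub>k) H\<^sub>k\<^sup>-\<^sup>1 = \<beta>\<^sub>k \<Lambda>\<^sub>a - \<Lambda>\<^sub>a \<beta>\<^sub>k\<^sub>+\<^sub>1\<close> and their discrete analogues,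
  and the Toda equations result from differentiating or shifting these once more.
\<close>

section \<open>Orthogonal polynomials in several variables\<close>

text \<open>The factorization is given pair by pair, with no regularity of \<open>S\<close> and
  \<open>H\<close> in the times, so every derivative has to be shown to exist. The source of
  differentiability is the moments, which are differentiable because invertibility of
  \<open>N\<close> makes the support bounded. It passes to \<open>S\<close> through the linear
  system that orthogonality imposes on the lower coefficients of one polynomial, and from there to
  \<open>H\<close>. Second derivatives never touch \<open>minv (H t m k)\<close>: the logarithmic
  derivative of \<open>H\<close> and, by the three-term recurrence, the derivative of \<beta> are
  polynomial in blocks of \<open>S\<close> and shift matrices, so differentiating again needs only
  first derivatives of \<open>S\<close>. Times and shifts act on the moments through the same
  operator \<open>dshift n\<close>, with n a coordinate vector \<open>axis a 1\<close> or a row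
  \<open>N $ b\<close>; one set of algebraic lemmas serves both. These lemmas concern functions of
  multi-indices, where sums need neither an ordering nor dimension conditions.\<close>

definition below :: "nat \<Rightarrow> 'd::finite mindex set" where
  "below k = {\<gamma>. mlength \<gamma> < k}"

text \<open>The level k - 1, and the empty set for k = 0: sums over it implement the convention that
  blocks with a negative index are absent, without truncated subtraction.\<close>

definition plevel :: "nat \<Rightarrow> 'd::finite mindex set" where
  "plevel k = {\<gamma>. Suc (mlength \<gamma>) = k}"

text \<open>Action of n \<cdot> \<Lambda> on a function of multi-indices. On moments it is
  multiplication of the measure by the linear form n \<bullet> x.\<close>

definition dshift :: "real ^ 'd \<Rightarrow> ('d::finite mindex \<Rightarrow> real) \<Rightarrow> 'd mindex \<Rightarrow> real" where
  "dshift n f \<gamma> = (\<Sum>c\<in>UNIV. n $ c * f (\<gamma> + axis c 1))"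

lemma mem_level [simp]: "\<gamma> \<in> level k \<longleftrightarrow> mlength \<gamma> = k"
  and mem_below [simp]: "\<gamma> \<in> below k \<longleftrightarrow> mlength \<gamma> < k"
  and mem_plevel [simp]: "\<gamma> \<in> plevel k \<longleftrightarrow> Suc (mlength \<gamma>) = k"
  by (simp_all add: level_def below_def plevel_def)

lemma mlength_add_axis [simp]: "mlength (\<gamma> + axis c (Suc 0)) = Suc (mlength \<gamma>)"
  by (simp add: mlength_def axis_def sum.distrib)

lemma finite_below [simp]: "finite (below k :: 'd::finite mindex set)"
proof (rule finite_imageD)
  have "vec_nth ` (below k :: 'd mindex set) \<subseteq> PiE UNIV (\<lambda>_. {..<k})"
  proof safe
    fix \<gamma> :: "'d mindex" and i assume "\<gamma> \<in> below k"
    moreover have "\<gamma> $ i \<le> mlength \<gamma>"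
      unfolding mlength_def by (rule member_le_sum) auto
    ultimately show "\<gamma> $ i < k" by simp
  qed auto
  then show "finite (vec_nth ` (below k :: 'd mindex set))"
    by (rule finite_subset) (auto intro: finite_PiE)
  show "inj_on vec_nth (below k :: 'd mindex set)"
    by (simp add: inj_on_def vec_nth_inject)
qed

lemma finite_level [simp]: "finite (level k)"
  by (rule finite_subset[OF _ finite_below[of "Suc k"]]) auto

lemma finite_plevel [simp]: "finite (plevel k)"
  by (rule finite_subset[OF _ finite_below[of k]]) auto

lemma plevel_0 [simp]: "plevel 0 = {}" and plevel_Suc [simp]: "plevel (Suc k) = level k"
  by auto

lemma below_0 [simp]: "below 0 = {}"
  by auto

lemma sum_below_Suc:
  fixes f :: "'d::finite mindex \<Rightarrow> real"
  shows "sum f (below (Suc k)) = sum f (below k) + sum f (level k)"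
proof -
  have "below (Suc k) = (below k \<union> level k :: 'd mindex set)"
    by auto
  then show ?thesis
    by (simp only:) (rule sum.union_disjoint, auto)
qed

lemma sum_below_le:
  fixes f :: "'d::finite mindex \<Rightarrow> real"
  assumes "k \<le> K" "\<And>\<gamma>. k \<le> mlength \<gamma> \<Longrightarrow> mlength \<gamma> < K \<Longrightarrow> f \<gamma> = 0"
  shows "sum f (below K) = sum f (below k)"
  by (rule sum.mono_neutral_right) (use assms in auto)

lemma dshift_sum: "dshift n (\<lambda>\<gamma>. \<Sum>\<delta>\<in>A. f \<delta> \<gamma>) \<gamma> = (\<Sum>\<delta>\<in>A. dshift n (f \<delta>) \<gamma>)"
  unfolding dshift_def by (subst sum.swap) (simp add: sum_distrib_left)

lemma dshift_cmult: "dshift n (\<lambda>\<gamma>. a * f \<gamma>) \<gamma> = a * dshift n f \<gamma>"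
  by (simp add: dshift_def sum_distrib_left mult_ac)

lemma dshift_minus: "dshift n (\<lambda>\<gamma>. - f \<gamma>) \<gamma> = - dshift n f \<gamma>"
  by (simp add: dshift_def sum_negf)

lemma dshift_translate: "dshift n (\<lambda>\<gamma>. f (\<delta> + \<gamma>)) \<gamma> = dshift n f (\<delta> + \<gamma>)"
  by (simp add: dshift_def add_ac)

lemma dshift_cong:
  "(\<And>c. f (\<gamma> + axis c 1) = h (\<gamma> + axis c 1)) \<Longrightarrow> dshift n f \<gamma> = dshift n h \<gamma>"
  by (simp add: dshift_def)

text \<open>\<open>g\<close> is a moment functional, given by its values on monomials, and \<open>S \<alpha>\<close> is the coefficient
  vector of the monic orthogonal polynomial with leading monomial \<open>\<alpha>\<close>. Only the blocks of \<open>H\<close> and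
  \<open>Hi\<close> with both indices of the same length are meaningful.\<close>

locale orth_system =
  fixes g :: "'d::finite mindex \<Rightarrow> real"
    and S H Hi :: "'d mindex \<Rightarrow> 'd mindex \<Rightarrow> real"
  assumes S_unit: "mlength \<alpha> \<le> mlength \<gamma> \<Longrightarrow> S \<alpha> \<gamma> = of_bool (\<alpha> = \<gamma>)"
    and orth: "mlength \<gamma> < mlength \<alpha> \<Longrightarrow>
      (\<Sum>\<delta>\<in>below (Suc (mlength \<alpha>)). S \<alpha> \<delta> * g (\<delta> + \<gamma>)) = 0"
    and orth_diag: "mlength \<gamma> = mlength \<alpha> \<Longrightarrow>
      (\<Sum>\<delta>\<in>below (Suc (mlength \<alpha>)). S \<alpha> \<delta> * g (\<delta> + \<gamma>)) = H \<alpha> \<gamma>"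
    and Hi_left: "mlength \<delta> = mlength \<zeta> \<Longrightarrow>
      (\<Sum>\<epsilon>\<in>level (mlength \<delta>). Hi \<delta> \<epsilon> * H \<epsilon> \<zeta>) = of_bool (\<delta> = \<zeta>)"
begin

text \<open>The pairing of P_\<alpha> with the monomial x^\<gamma>, that is, an entry of S G. The
  locale assumptions make this matrix block upper triangular with diagonal blocks
  \<open>H\<close>.\<close>

definition U :: "'d mindex \<Rightarrow> 'd mindex \<Rightarrow> real" where
  "U \<alpha> \<gamma> = (\<Sum>\<delta>\<in>below (Suc (mlength \<alpha>)). S \<alpha> \<delta> * g (\<delta> + \<gamma>))"

section \<open>Triangularity and symmetry of the pairing, and expansions\<close>

lemma S_zero: "mlength \<alpha> < mlength \<gamma> \<Longrightarrow> S \<alpha> \<gamma> = 0"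
  using S_unit[of \<alpha> \<gamma>] by auto

lemma U_low: "mlength \<gamma> < mlength \<alpha> \<Longrightarrow> U \<alpha> \<gamma> = 0"
  by (simp add: U_def orth)

lemma U_diag: "mlength \<gamma> = mlength \<alpha> \<Longrightarrow> U \<alpha> \<gamma> = H \<alpha> \<gamma>"
  by (simp add: U_def orth_diag)

lemma U_below: "mlength \<alpha> < K \<Longrightarrow> U \<alpha> \<gamma> = (\<Sum>\<delta>\<in>below K. S \<alpha> \<delta> * g (\<delta> + \<gamma>))"
  unfolding U_def by (rule sum_below_le[symmetric]) (auto simp: S_zero)

text \<open>The unknown lower coefficients are separated from the leading one: where the left side
  vanishes, this is a linear system whose matrix and right-hand side consist of moments.\<close>

lemma U_split: "U \<alpha> \<gamma> = (\<Sum>\<delta>\<in>below (mlength \<alpha>). S \<alpha> \<delta> * g (\<delta> + \<gamma>)) + g (\<alpha> + \<gamma>)"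
proof -
  have "(\<Sum>\<delta>\<in>level (mlength \<alpha>). S \<alpha> \<delta> * g (\<delta> + \<gamma>)) =
      (\<Sum>\<delta>\<in>level (mlength \<alpha>). if \<delta> = \<alpha> then g (\<delta> + \<gamma>) else 0)"
    by (rule sum.cong) (auto simp: S_unit)
  also have "\<dots> = g (\<alpha> + \<gamma>)" by simp
  finally show ?thesis by (simp add: U_def sum_below_Suc)
qed

text \<open>Both sides are the double sum that pairs P_\<alpha> with P_\<gamma>; \<open>g\<close>
  sees only the sum of two multi-indices, so the form is symmetric.\<close>

lemma pairing_sym:
  assumes "mlength \<alpha> < K" "mlength \<gamma> < K"
  shows "(\<Sum>\<delta>\<in>below K. S \<gamma> \<delta> * U \<alpha> \<delta>) = (\<Sum>\<delta>\<in>below K. S \<alpha> \<delta> * U \<gamma> \<delta>)"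
  unfolding U_below[OF assms(1)] U_below[OF assms(2)] sum_distrib_left
  by (subst sum.swap) (simp add: mult_ac add_ac)

lemma pairing_low:
  assumes "mlength \<gamma> < mlength \<alpha>"
  shows "(\<Sum>\<delta>\<in>below K. S \<gamma> \<delta> * U \<alpha> \<delta>) = 0"
proof (rule sum.neutral, rule ballI)
  fix \<delta> show "S \<gamma> \<delta> * U \<alpha> \<delta> = 0"
    using assms S_zero[of \<gamma> \<delta>] U_low[of \<delta> \<alpha>] by (cases "mlength \<gamma> < mlength \<delta>") auto
qed

lemma pairing_diag:
  assumes "mlength \<gamma> = mlength \<alpha>" "mlength \<alpha> < K"
  shows "(\<Sum>\<delta>\<in>below K. S \<gamma> \<delta> * U \<alpha> \<delta>) = H \<alpha> \<gamma>"
proof -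
  have "S \<gamma> \<delta> * U \<alpha> \<delta> = (if \<delta> = \<gamma> then H \<alpha> \<gamma> else 0)" for \<delta>
    using assms(1) S_unit[of \<gamma> \<delta>] U_low[of \<delta> \<alpha>] U_diag[of \<gamma> \<alpha>]
    by (cases "mlength \<gamma> \<le> mlength \<delta>") auto
  then have "(\<Sum>\<delta>\<in>below K. S \<gamma> \<delta> * U \<alpha> \<delta>) = (if \<gamma> \<in> below K then H \<alpha> \<gamma> else 0)" by simp
  then show ?thesis using assms by simp
qed

lemma H_sym: "mlength \<alpha> = mlength \<gamma> \<Longrightarrow> H \<alpha> \<gamma> = H \<gamma> \<alpha>"
  using pairing_sym[of \<alpha> "Suc (mlength \<alpha>)" \<gamma>] by (simp add: pairing_diag)

text \<open>P_\<gamma> is orthogonal to P_\<alpha>, and below its leading monomial x^\<gamma> only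
  its coefficients of degree |\<alpha>| meet a nonzero pairing. Thus the first superdiagonal of
  \<open>U\<close> is determined by \<open>H\<close> and by the block \<beta> of the next level;
  this is how \<beta> enters the formulas for \<open>H\<close>.\<close>

lemma U_next:
  assumes "mlength \<gamma> = Suc (mlength \<alpha>)"
  shows "U \<alpha> \<gamma> = - (\<Sum>\<zeta>\<in>level (mlength \<alpha>). H \<alpha> \<zeta> * S \<gamma> \<zeta>)"
proof -
  let ?k = "mlength \<alpha>"
  have "(\<Sum>\<delta>\<in>below (Suc (Suc ?k)). S \<gamma> \<delta> * U \<alpha> \<delta>) = 0"
    using pairing_sym[of \<alpha> "Suc (Suc ?k)" \<gamma>] pairing_low[of \<alpha> \<gamma>] assms by simp
  moreover have "(\<Sum>\<delta>\<in>below ?k. S \<gamma> \<delta> * U \<alpha> \<delta>) = 0"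
    by (rule sum.neutral) (auto simp: U_low)
  moreover have "(\<Sum>\<delta>\<in>level ?k. S \<gamma> \<delta> * U \<alpha> \<delta>) = (\<Sum>\<zeta>\<in>level ?k. H \<alpha> \<zeta> * S \<gamma> \<zeta>)"
    by (rule sum.cong) (auto simp: U_diag)
  moreover have "(\<Sum>\<delta>\<in>level (Suc ?k). S \<gamma> \<delta> * U \<alpha> \<delta>) =
      (\<Sum>\<delta>\<in>level (Suc ?k). if \<delta> = \<gamma> then U \<alpha> \<delta> else 0)"
    by (rule sum.cong) (use assms in \<open>auto simp: S_unit\<close>)
  then have "(\<Sum>\<delta>\<in>level (Suc ?k). S \<gamma> \<delta> * U \<alpha> \<delta>) = U \<alpha> \<gamma>"
    using assms by simp
  ultimately show ?thesis by (simp add: sum_below_Suc)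
qed

text \<open>The P_\<eta> of the top level pair to zero with all lower monomials, so \<open>H\<close>
  of that level annihilates the top coefficients, and these vanish since \<open>Hi\<close> inverts
  \<open>H\<close>. The degree then drops by one.\<close>

lemma nondegenerate:
  assumes "\<And>\<eta>. mlength \<eta> < k \<Longrightarrow> (\<Sum>\<gamma>\<in>below k. X \<gamma> * U \<eta> \<gamma>) = 0" "mlength \<gamma> < k"
  shows "X \<gamma> = 0"
  using assms
proof (induction k)
  case (Suc k)
  have top: "X \<delta> = 0" if \<delta>: "mlength \<delta> = k" for \<delta>
  proof -
    have HX: "(\<Sum>\<zeta>\<in>level k. H \<epsilon> \<zeta> * X \<zeta>) = 0" if "\<epsilon> \<in> level k" for \<epsilon>
    proof -
      have "(\<Sum>\<gamma>\<in>below k. X \<gamma> * U \<epsilon> \<gamma>) = 0"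
        by (rule sum.neutral) (use that in \<open>auto simp: U_low\<close>)
      then have "(\<Sum>\<zeta>\<in>level k. X \<zeta> * U \<epsilon> \<zeta>) = 0"
        using Suc.prems(1)[of \<epsilon>] that by (simp add: sum_below_Suc)
      moreover have "(\<Sum>\<zeta>\<in>level k. X \<zeta> * U \<epsilon> \<zeta>) = (\<Sum>\<zeta>\<in>level k. H \<epsilon> \<zeta> * X \<zeta>)"
        by (rule sum.cong) (use that in \<open>auto simp: U_diag\<close>)
      ultimately show ?thesis by simp
    qed
    have HiH: "(\<Sum>\<epsilon>\<in>level k. Hi \<delta> \<epsilon> * H \<epsilon> \<zeta>) = of_bool (\<zeta> = \<delta>)" if "\<zeta> \<in> level k" for \<zeta>
      using Hi_left[of \<delta> \<zeta>] \<delta> that by auto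
    have "X \<delta> = (\<Sum>\<zeta>\<in>level k. if \<zeta> = \<delta> then X \<zeta> else 0)"
      using \<delta> by simp
    also have "\<dots> = (\<Sum>\<zeta>\<in>level k. (\<Sum>\<epsilon>\<in>level k. Hi \<delta> \<epsilon> * H \<epsilon> \<zeta>) * X \<zeta>)"
      by (intro sum.cong refl) (simp add: HiH)
    also have "\<dots> = (\<Sum>\<epsilon>\<in>level k. Hi \<delta> \<epsilon> * (\<Sum>\<zeta>\<in>level k. H \<epsilon> \<zeta> * X \<zeta>))"
      unfolding sum_distrib_left sum_distrib_right by (subst sum.swap) (simp add: mult_ac)
    also have "\<dots> = 0" by (simp add: HX)
    finally show ?thesis .
  qed
  then have "(\<Sum>\<gamma>\<in>level k. X \<gamma> * U \<eta> \<gamma>) = 0" for \<eta>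
    by (intro sum.neutral) auto
  then have "mlength \<gamma> < k \<Longrightarrow> X \<gamma> = 0"
    using Suc.IH Suc.prems(1) by (simp add: sum_below_Suc)
  with top Suc.prems(2) show ?case by (cases "mlength \<gamma> = k") auto
qed simp

text \<open>Expansion of the polynomial with coefficients \<open>X\<close> in the orthogonal polynomials.\<close>

lemma expansion:
  assumes "mlength \<gamma> < k"
  shows "X \<gamma> = (\<Sum>\<zeta>\<in>below k. \<Sum>\<epsilon>\<in>level (mlength \<zeta>).
    (\<Sum>\<delta>\<in>below k. X \<delta> * U \<zeta> \<delta>) * Hi \<zeta> \<epsilon> * S \<epsilon> \<gamma>)"
proof -
  define x where "x \<zeta> = (\<Sum>\<delta>\<in>below k. X \<delta> * U \<zeta> \<delta>)" for \<zeta>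
  define Y where "Y \<gamma> = X \<gamma> - (\<Sum>\<zeta>\<in>below k. \<Sum>\<epsilon>\<in>level (mlength \<zeta>). x \<zeta> * Hi \<zeta> \<epsilon> * S \<epsilon> \<gamma>)" for \<gamma>
  \<comment> \<open>The residual \<open>Y\<close> of the expansion is orthogonal to every P_\<eta>:
    only the level of \<eta> contributes, and there \<open>Hi\<close> cancels
    \<open>H\<close>.\<close>
  have "(\<Sum>\<gamma>\<in>below k. Y \<gamma> * U \<eta> \<gamma>) = 0" if \<eta>: "mlength \<eta> < k" for \<eta>
  proof -
    have pair: "(\<Sum>\<gamma>\<in>below k. S \<epsilon> \<gamma> * U \<eta> \<gamma>) = of_bool (mlength \<epsilon> = mlength \<eta>) * H \<epsilon> \<eta>"
      if "mlength \<epsilon> < k" for \<epsilon>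
    proof -
      consider "mlength \<epsilon> < mlength \<eta>" | "mlength \<epsilon> = mlength \<eta>" | "mlength \<eta> < mlength \<epsilon>"
        by linarith
      then show ?thesis
      proof cases
        case 2 then show ?thesis using \<eta> by (simp add: pairing_diag H_sym)
      next
        case 3 then show ?thesis
          using pairing_sym[OF \<eta> that] by (simp add: pairing_low)
      qed (simp add: pairing_low)
    qed
    have "(\<Sum>\<gamma>\<in>below k. (\<Sum>\<zeta>\<in>below k. \<Sum>\<epsilon>\<in>level (mlength \<zeta>). x \<zeta> * Hi \<zeta> \<epsilon> * S \<epsilon> \<gamma>) * U \<eta> \<gamma>)
      = (\<Sum>\<zeta>\<in>below k. \<Sum>\<epsilon>\<in>level (mlength \<zeta>). \<Sum>\<gamma>\<in>below k. x \<zeta> * Hi \<zeta> \<epsilon> * S \<epsilon> \<gamma> * U \<eta> \<gamma>)"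
      unfolding sum_distrib_right
      by (subst sum.swap, rule sum.cong[OF refl], subst sum.swap, rule refl)
    also have "\<dots> = (\<Sum>\<zeta>\<in>below k. \<Sum>\<epsilon>\<in>level (mlength \<zeta>).
        x \<zeta> * Hi \<zeta> \<epsilon> * (\<Sum>\<gamma>\<in>below k. S \<epsilon> \<gamma> * U \<eta> \<gamma>))"
      by (simp add: sum_distrib_left mult_ac)
    also have "\<dots> = (\<Sum>\<zeta>\<in>below k. \<Sum>\<epsilon>\<in>level (mlength \<zeta>).
        x \<zeta> * of_bool (mlength \<zeta> = mlength \<eta>) * (Hi \<zeta> \<epsilon> * H \<epsilon> \<eta>))"
      by (intro sum.cong refl) (simp add: pair)
    also have "\<dots> = (\<Sum>\<zeta>\<in>below k. x \<zeta> * of_bool (mlength \<zeta> = mlength \<eta>) *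
        (\<Sum>\<epsilon>\<in>level (mlength \<zeta>). Hi \<zeta> \<epsilon> * H \<epsilon> \<eta>))"
      by (simp add: sum_distrib_left mult_ac)
    also have "\<dots> = (\<Sum>\<zeta>\<in>below k. if \<zeta> = \<eta> then x \<zeta> else 0)"
      using Hi_left[of _ \<eta>] by (intro sum.cong refl) auto
    also have "\<dots> = x \<eta>" using \<eta> by simp
    finally show ?thesis
      by (simp add: Y_def left_diff_distrib sum_subtractf) (simp add: x_def)
  qed
  from nondegenerate[OF this assms] show ?thesis by (simp add: Y_def x_def)
qed

text \<open>Orthogonality is given as pairings with monomials, while expansion coefficients are
  pairings with the P_\<zeta>; this converts the former into the latter.\<close>

lemma sum_times_U:
  assumes "mlength \<zeta> < k"
  shows "(\<Sum>\<delta>\<in>below k. X \<delta> * U \<zeta> \<delta>) =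
    (\<Sum>\<delta>\<in>below k. S \<zeta> \<delta> * (\<Sum>\<gamma>\<in>below k. X \<gamma> * g (\<gamma> + \<delta>)))"
  unfolding U_below[OF assms] sum_distrib_left
  by (subst sum.swap) (simp add: mult_ac add_ac)

text \<open>Since P_\<zeta> is monic, its pairing with \<open>X\<close> is \<open>b \<zeta>\<close>
  on the level k - 1 and zero below it, so \<open>expansion\<close> leaves a single level. The
  second part continues the pairing to degree k by \<open>U_next\<close>, where \<open>Hi\<close>
  cancels \<open>H\<close>; this keeps the formulas for the change of \<open>H\<close> free of
  inverses. \<open>b\<close> is left general because it occurs with both signs.\<close>

lemma solve:
  assumes "\<And>\<delta>. mlength \<delta> < k \<Longrightarrow> (\<Sum>\<gamma>\<in>below k. X \<gamma> * g (\<gamma> + \<delta>)) = (if Suc (mlength \<delta>) = k then b \<delta> else 0)"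
  shows "mlength \<gamma> < k \<Longrightarrow> X \<gamma> = (\<Sum>\<delta>\<in>plevel k. \<Sum>\<epsilon>\<in>plevel k. b \<delta> * Hi \<delta> \<epsilon> * S \<epsilon> \<gamma>)"
    and "mlength \<gamma> = k \<Longrightarrow> (\<Sum>\<delta>\<in>below k. X \<delta> * g (\<delta> + \<gamma>)) = - (\<Sum>\<delta>\<in>plevel k. b \<delta> * S \<gamma> \<delta>)"
proof -
  have xU: "(\<Sum>\<delta>\<in>below k. X \<delta> * U \<zeta> \<delta>) = (if \<zeta> \<in> plevel k then b \<zeta> else 0)" if "mlength \<zeta> < k" for \<zeta>
  proof -
    have "(\<Sum>\<delta>\<in>below k. X \<delta> * U \<zeta> \<delta>) = (\<Sum>\<delta>\<in>below k. if \<delta> = \<zeta> then (if \<zeta> \<in> plevel k then b \<zeta> else 0) else 0)"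
      unfolding sum_times_U[OF that]
    proof (intro sum.cong refl)
      fix \<delta> :: "'d mindex" assume "\<delta> \<in> below k"
      then show "S \<zeta> \<delta> * (\<Sum>\<gamma>\<in>below k. X \<gamma> * g (\<gamma> + \<delta>)) =
          (if \<delta> = \<zeta> then if \<zeta> \<in> plevel k then b \<zeta> else 0 else 0)"
        using assms[of \<delta>] S_unit[of \<zeta> \<delta>] that by (cases "Suc (mlength \<delta>) = k") auto
    qed
    then show ?thesis using that by simp
  qed
  have 1: "X \<gamma> = (\<Sum>\<delta>\<in>plevel k. \<Sum>\<epsilon>\<in>plevel k. b \<delta> * Hi \<delta> \<epsilon> * S \<epsilon> \<gamma>)" if "mlength \<gamma> < k" for \<gamma>
  proof -
    have "X \<gamma> = (\<Sum>\<zeta>\<in>below k. \<Sum>\<epsilon>\<in>level (mlength \<zeta>).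
        (if \<zeta> \<in> plevel k then b \<zeta> else 0) * Hi \<zeta> \<epsilon> * S \<epsilon> \<gamma>)"
      by (subst expansion[OF that], intro sum.cong refl) (simp add: xU)
    also have "\<dots> = (\<Sum>\<zeta>\<in>plevel k. \<Sum>\<epsilon>\<in>level (mlength \<zeta>).
        (if \<zeta> \<in> plevel k then b \<zeta> else 0) * Hi \<zeta> \<epsilon> * S \<epsilon> \<gamma>)"
      by (rule sum.mono_neutral_right) auto
    also have "\<dots> = (\<Sum>\<delta>\<in>plevel k. \<Sum>\<epsilon>\<in>plevel k. b \<delta> * Hi \<delta> \<epsilon> * S \<epsilon> \<gamma>)"
      by (intro sum.cong refl) auto
    finally show ?thesis .
  qed
  then show "mlength \<gamma> < k \<Longrightarrow> X \<gamma> = (\<Sum>\<delta>\<in>plevel k. \<Sum>\<epsilon>\<in>plevel k. b \<delta> * Hi \<delta> \<epsilon> * S \<epsilon> \<gamma>)" .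
  show "(\<Sum>\<delta>\<in>below k. X \<delta> * g (\<delta> + \<gamma>)) = - (\<Sum>\<delta>\<in>plevel k. b \<delta> * S \<gamma> \<delta>)" if \<gamma>: "mlength \<gamma> = k"
  proof -
    have next': "U \<epsilon> \<gamma> = - (\<Sum>\<zeta>\<in>plevel k. H \<epsilon> \<zeta> * S \<gamma> \<zeta>)" if "\<epsilon> \<in> plevel k" for \<epsilon>
      using U_next[of \<gamma> \<epsilon>] that \<gamma> by auto
    have "(\<Sum>\<delta>\<in>below k. X \<delta> * g (\<delta> + \<gamma>)) =
      (\<Sum>\<eta>\<in>below k. \<Sum>\<delta>\<in>plevel k. \<Sum>\<epsilon>\<in>plevel k. b \<delta> * Hi \<delta> \<epsilon> * S \<epsilon> \<eta> * g (\<eta> + \<gamma>))"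
      by (intro sum.cong refl) (simp add: 1 sum_distrib_right)
    also have "\<dots> = (\<Sum>\<delta>\<in>plevel k. \<Sum>\<epsilon>\<in>plevel k. \<Sum>\<eta>\<in>below k. b \<delta> * Hi \<delta> \<epsilon> * S \<epsilon> \<eta> * g (\<eta> + \<gamma>))"
      by (subst sum.swap, rule sum.cong[OF refl], subst sum.swap, rule refl)
    also have "\<dots> = (\<Sum>\<delta>\<in>plevel k. \<Sum>\<epsilon>\<in>plevel k. b \<delta> * Hi \<delta> \<epsilon> * U \<epsilon> \<gamma>)"
      by (intro sum.cong refl, subst U_below[where K=k]) (auto simp: sum_distrib_left mult_ac)
    also have "\<dots> = - (\<Sum>\<delta>\<in>plevel k. \<Sum>\<epsilon>\<in>plevel k. \<Sum>\<zeta>\<in>plevel k. b \<delta> * (Hi \<delta> \<epsilon> * H \<epsilon> \<zeta>) * S \<gamma> \<zeta>)"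
      by (simp add: next' sum_distrib_left sum_negf mult_ac)
    also have "(\<Sum>\<delta>\<in>plevel k. \<Sum>\<epsilon>\<in>plevel k. \<Sum>\<zeta>\<in>plevel k. b \<delta> * (Hi \<delta> \<epsilon> * H \<epsilon> \<zeta>) * S \<gamma> \<zeta>) =
        (\<Sum>\<delta>\<in>plevel k. \<Sum>\<zeta>\<in>plevel k. b \<delta> * (\<Sum>\<epsilon>\<in>plevel k. Hi \<delta> \<epsilon> * H \<epsilon> \<zeta>) * S \<gamma> \<zeta>)"
      unfolding sum_distrib_left sum_distrib_right by (rule sum.cong[OF refl], rule sum.swap)
    also have "\<dots> = (\<Sum>\<delta>\<in>plevel k. \<Sum>\<zeta>\<in>plevel k. if \<zeta> = \<delta> then b \<delta> * S \<gamma> \<zeta> else 0)"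
    proof (intro sum.cong refl)
      fix \<delta> \<zeta> :: "'d mindex" assume *: "\<delta> \<in> plevel k" "\<zeta> \<in> plevel k"
      then have "(\<Sum>\<epsilon>\<in>plevel k. Hi \<delta> \<epsilon> * H \<epsilon> \<zeta>) = of_bool (\<delta> = \<zeta>)"
        using Hi_left[of \<delta> \<zeta>] by auto
      then show "b \<delta> * (\<Sum>\<epsilon>\<in>plevel k. Hi \<delta> \<epsilon> * H \<epsilon> \<zeta>) * S \<gamma> \<zeta> = (if \<zeta> = \<delta> then b \<delta> * S \<gamma> \<zeta> else 0)"
        by simp
    qed
    also have "\<dots> = (\<Sum>\<delta>\<in>plevel k. b \<delta> * S \<gamma> \<delta>)" by simp
    finally show ?thesis .
  qed
qed

end

section \<open>Multiplication by a linear form and the three-term recurrence\<close>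

context orth_system
begin

lemma sum_S_level: "(\<Sum>\<delta>\<in>level (mlength \<alpha>). S \<alpha> \<delta> * f \<delta>) = f \<alpha>"
proof -
  have "(\<Sum>\<delta>\<in>level (mlength \<alpha>). S \<alpha> \<delta> * f \<delta>) = (\<Sum>\<delta>\<in>level (mlength \<alpha>). if \<delta> = \<alpha> then f \<delta> else 0)"
    by (intro sum.cong refl) (simp add: S_unit)
  then show ?thesis by simp
qed

text \<open>The factor n \<bullet> x can be moved from the functional to the test monomial.\<close>

lemma sum_S_dshift:
  assumes "mlength \<alpha> < K"
  shows "(\<Sum>\<gamma>\<in>below K. S \<alpha> \<gamma> * dshift n g (\<gamma> + \<delta>)) = dshift n (U \<alpha>) \<delta>"
proof -
  have "dshift n (U \<alpha>) \<delta> = dshift n (\<lambda>\<delta>. \<Sum>\<gamma>\<in>below K. S \<alpha> \<gamma> * g (\<gamma> + \<delta>)) \<delta>"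
    by (rule dshift_cong) (rule U_below[OF assms])
  then show ?thesis by (simp add: dshift_sum dshift_cmult dshift_translate)
qed

lemma dshift_U_low:
  assumes "mlength \<delta> < mlength \<alpha>"
  shows "dshift n (U \<alpha>) \<delta> = (if Suc (mlength \<delta>) = mlength \<alpha> then dshift n (H \<alpha>) \<delta> else 0)"
  using assms by (auto simp: dshift_def U_low U_diag)

lemma dshift_U_diag:
  assumes "mlength \<delta> = mlength \<alpha>"
  shows "dshift n (U \<alpha>) \<delta> = - (\<Sum>\<zeta>\<in>level (mlength \<alpha>). H \<alpha> \<zeta> * dshift n (\<lambda>\<eta>. S \<eta> \<zeta>) \<delta>)"
proof -
  have "dshift n (U \<alpha>) \<delta> = dshift n (\<lambda>\<eta>. - (\<Sum>\<zeta>\<in>level (mlength \<alpha>). H \<alpha> \<zeta> * S \<eta> \<zeta>)) \<delta>"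
    by (rule dshift_cong) (simp add: U_next assms)
  then show ?thesis by (simp add: dshift_minus dshift_sum dshift_cmult)
qed

text \<open>The unit shift brings \<delta> from the level below to the level of \<alpha>, where
  \<open>H\<close> is symmetric.\<close>

lemma H_row_transpose:
  "(\<Sum>\<delta>\<in>plevel (mlength \<alpha>). dshift n (H \<alpha>) \<delta> * f \<delta>) =
   (\<Sum>\<delta>\<in>plevel (mlength \<alpha>). f \<delta> * dshift n (\<lambda>\<zeta>. H \<zeta> \<alpha>) \<delta>)"
  by (rule sum.cong[OF refl]) (auto simp: dshift_def H_sym)

text \<open>The coefficients of degree \<open>k - 1\<close> in the three-term recurrence for the product of \<open>n \<bullet> x\<close> with
  an orthogonal polynomial of degree \<open>k\<close>; \<open>SL\<close> is the matrix \<open>S (n \<cdot> \<Lambda>)\<close>.\<close>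

lemma recurrence:
  fixes n :: "real ^ 'd"
  defines "SL \<equiv> \<lambda>\<alpha> \<gamma>. \<Sum>\<delta>\<in>plevel (mlength \<gamma>). S \<alpha> \<delta> * (\<Sum>c\<in>UNIV. n $ c * of_bool (\<delta> + axis c 1 = \<gamma>))"
  assumes "Suc (mlength \<gamma>) = mlength \<alpha>"
  shows "(\<Sum>\<delta>\<in>plevel (mlength \<alpha>). dshift n (H \<alpha>) \<delta> * Hi \<delta> \<gamma>) =
    SL \<alpha> \<gamma> - dshift n (\<lambda>\<eta>. S \<eta> \<gamma>) \<alpha>
      - (\<Sum>\<zeta>\<in>level (mlength \<alpha>). (SL \<alpha> \<zeta> - dshift n (\<lambda>\<eta>. S \<eta> \<zeta>) \<alpha>) * S \<zeta> \<gamma>)"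
proof -
  let ?k = "mlength \<alpha>"
  \<comment> \<open>\<open>A\<close> is the coefficient vector of (n \<bullet> x) P_\<alpha> minus
    the combination of the P_(\<alpha> + e_c) with weights n_c. In \<open>X\<close> the terms of
    degree |\<alpha>| are removed as well, by subtracting multiples of the P_\<zeta> of that level,
    so that \<open>X\<close> has degree less than |\<alpha>|.\<close>
  define A where "A \<zeta> = SL \<alpha> \<zeta> - dshift n (\<lambda>\<eta>. S \<eta> \<zeta>) \<alpha>" for \<zeta>
  define X where "X \<gamma> = A \<gamma> - (\<Sum>\<zeta>\<in>level ?k. A \<zeta> * S \<zeta> \<gamma>)" for \<gamma>
  have X_level: "X \<gamma> = 0" if "\<gamma> \<in> level ?k" for \<gamma>
  proof -
    have "(\<Sum>\<zeta>\<in>level ?k. A \<zeta> * S \<zeta> \<gamma>) = (\<Sum>\<zeta>\<in>level ?k. if \<zeta> = \<gamma> then A \<zeta> else 0)"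
      using that by (intro sum.cong refl) (simp add: S_unit)
    then show ?thesis using that by (simp add: X_def)
  qed
  have X_level_Suc: "X \<gamma> = 0" if "\<gamma> \<in> level (Suc ?k)" for \<gamma>
  proof -
    have "(\<Sum>\<zeta>\<in>level ?k. A \<zeta> * S \<zeta> \<gamma>) = 0"
      using that by (intro sum.neutral) (auto simp: S_zero)
    moreover have "SL \<alpha> \<gamma> = (\<Sum>\<delta>\<in>level ?k. if \<delta> = \<alpha> then
        \<Sum>c\<in>UNIV. n $ c * of_bool (\<delta> + axis c 1 = \<gamma>) else 0)"
      unfolding SL_def using that by (intro sum.cong) (auto simp: S_unit)
    then have "SL \<alpha> \<gamma> = dshift n (\<lambda>\<eta>. S \<eta> \<gamma>) \<alpha>"
      using that by (simp add: dshift_def S_unit)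
    ultimately show ?thesis by (simp add: X_def A_def)
  qed
  have SL_g: "(\<Sum>\<gamma>\<in>below (Suc (Suc ?k)). SL \<alpha> \<gamma> * g (\<gamma> + \<delta>)) = dshift n (U \<alpha>) \<delta>" for \<delta>
  proof -
    have "(\<Sum>\<gamma>\<in>below (Suc (Suc ?k)). SL \<alpha> \<gamma> * g (\<gamma> + \<delta>)) =
      (\<Sum>\<gamma>\<in>below (Suc (Suc ?k)). \<Sum>\<epsilon>\<in>below (Suc ?k).
         S \<alpha> \<epsilon> * (\<Sum>c\<in>UNIV. n $ c * of_bool (\<epsilon> + axis c 1 = \<gamma>)) * g (\<gamma> + \<delta>))"
    proof (rule sum.cong[OF refl])
      fix \<gamma> :: "'d mindex" assume \<gamma>: "\<gamma> \<in> below (Suc (Suc ?k))"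
      have "(\<Sum>c\<in>UNIV. n $ c * of_bool (\<epsilon> + axis c 1 = \<gamma>)) = 0" if "\<epsilon> \<notin> plevel (mlength \<gamma>)" for \<epsilon>
        using that by (intro sum.neutral) auto
      then have "SL \<alpha> \<gamma> = (\<Sum>\<epsilon>\<in>below (Suc ?k).
         S \<alpha> \<epsilon> * (\<Sum>c\<in>UNIV. n $ c * of_bool (\<epsilon> + axis c 1 = \<gamma>)))"
        unfolding SL_def using \<gamma> by (intro sum.mono_neutral_left) auto
      then show "SL \<alpha> \<gamma> * g (\<gamma> + \<delta>) = (\<Sum>\<epsilon>\<in>below (Suc ?k).
         S \<alpha> \<epsilon> * (\<Sum>c\<in>UNIV. n $ c * of_bool (\<epsilon> + axis c 1 = \<gamma>)) * g (\<gamma> + \<delta>))"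
        by (simp add: sum_distrib_right)
    qed
    also have "\<dots> = (\<Sum>\<epsilon>\<in>below (Suc ?k). S \<alpha> \<epsilon> * (\<Sum>c\<in>UNIV. n $ c *
        (\<Sum>\<gamma>\<in>below (Suc (Suc ?k)). of_bool (\<epsilon> + axis c 1 = \<gamma>) * g (\<gamma> + \<delta>))))"
      unfolding sum_distrib_left sum_distrib_right
      by (subst sum.swap, rule sum.cong[OF refl], subst sum.swap) (simp add: mult_ac)
    also have "\<dots> = (\<Sum>\<epsilon>\<in>below (Suc ?k). S \<alpha> \<epsilon> * dshift n g (\<epsilon> + \<delta>))"
    proof (rule sum.cong[OF refl])
      fix \<epsilon> :: "'d mindex" assume "\<epsilon> \<in> below (Suc ?k)"
      then have "(\<Sum>\<gamma>\<in>below (Suc (Suc ?k)). of_bool (\<epsilon> + axis c 1 = \<gamma>) * g (\<gamma> + \<delta>)) =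
          g (\<epsilon> + axis c 1 + \<delta>)" for c
        by (simp add: of_bool_def if_distrib[where f="\<lambda>x. x * _"] sum.delta cong: if_cong)
      then show "S \<alpha> \<epsilon> * (\<Sum>c\<in>UNIV. n $ c *
        (\<Sum>\<gamma>\<in>below (Suc (Suc ?k)). of_bool (\<epsilon> + axis c 1 = \<gamma>) * g (\<gamma> + \<delta>))) =
        S \<alpha> \<epsilon> * dshift n g (\<epsilon> + \<delta>)"
        by (simp add: dshift_def add_ac)
    qed
    finally show ?thesis by (simp add: sum_S_dshift)
  qed
  have Sc_g: "(\<Sum>\<gamma>\<in>below (Suc (Suc ?k)). dshift n (\<lambda>\<eta>. S \<eta> \<gamma>) \<alpha> * g (\<gamma> + \<delta>)) =
      dshift n (\<lambda>\<eta>. U \<eta> \<delta>) \<alpha>" for \<delta>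
    unfolding dshift_def sum_distrib_right
    by (subst sum.swap) (simp add: U_below[where K="Suc (Suc ?k)"] sum_distrib_left mult_ac)
  \<comment> \<open>Against a monomial of degree less than |\<alpha>| all subtracted polynomials
    pair to zero. The remaining (n \<bullet> x) P_\<alpha> contributes at most in degree |\<alpha>|
    - 1, where the linear form lifts the monomial to the diagonal of \<open>U\<close>.\<close>
  have "(\<Sum>\<gamma>\<in>below ?k. X \<gamma> * g (\<gamma> + \<delta>)) =
      (if Suc (mlength \<delta>) = ?k then dshift n (H \<alpha>) \<delta> else 0)" if \<delta>: "mlength \<delta> < ?k" for \<delta>
  proof -
    have "(\<Sum>\<gamma>\<in>below ?k. X \<gamma> * g (\<gamma> + \<delta>)) = (\<Sum>\<gamma>\<in>below (Suc (Suc ?k)). X \<gamma> * g (\<gamma> + \<delta>))"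
      by (simp add: sum_below_Suc X_level X_level_Suc)
    also have "\<dots> = dshift n (U \<alpha>) \<delta> - dshift n (\<lambda>\<eta>. U \<eta> \<delta>) \<alpha>
        - (\<Sum>\<gamma>\<in>below (Suc (Suc ?k)). \<Sum>\<zeta>\<in>level ?k. A \<zeta> * S \<zeta> \<gamma> * g (\<gamma> + \<delta>))"
      by (simp add: X_def left_diff_distrib sum_subtractf sum_distrib_right)
        (simp add: A_def left_diff_distrib sum_subtractf SL_g Sc_g)
    also have "(\<Sum>\<gamma>\<in>below (Suc (Suc ?k)). \<Sum>\<zeta>\<in>level ?k. A \<zeta> * S \<zeta> \<gamma> * g (\<gamma> + \<delta>)) =
        (\<Sum>\<zeta>\<in>level ?k. A \<zeta> * U \<zeta> \<delta>)"
      by (subst sum.swap, rule sum.cong[OF refl], subst U_below[where K="Suc (Suc ?k)"])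
        (auto simp: sum_distrib_left mult_ac)
    also have "\<dots> = 0" using \<delta> by (intro sum.neutral) (auto simp: U_low)
    also have "dshift n (\<lambda>\<eta>. U \<eta> \<delta>) \<alpha> = 0" using \<delta> by (simp add: dshift_def U_low)
    finally show ?thesis using \<delta> by (simp add: dshift_U_low)
  qed
  from solve(1)[OF this, of \<gamma>] assms
  have "X \<gamma> = (\<Sum>\<delta>\<in>plevel ?k. \<Sum>\<epsilon>\<in>plevel ?k. dshift n (H \<alpha>) \<delta> * Hi \<delta> \<epsilon> * S \<epsilon> \<gamma>)"
    by simp
  also have "\<dots> = (\<Sum>\<delta>\<in>plevel ?k. \<Sum>\<epsilon>\<in>plevel ?k. if \<epsilon> = \<gamma> then dshift n (H \<alpha>) \<delta> * Hi \<delta> \<epsilon> else 0)"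
    using assms(2) by (intro sum.cong refl) (auto simp: S_unit)
  also have "\<dots> = (\<Sum>\<delta>\<in>plevel ?k. dshift n (H \<alpha>) \<delta> * Hi \<delta> \<gamma>)"
    using assms(2) by simp
  finally show ?thesis by (simp add: X_def A_def)
qed

end

text \<open>Both polynomials are monic, so their difference has degree less than |\<alpha>|. For the
  new functional it pairs with a lower monomial x^\<delta> as P_\<alpha> pairs with (n \<bullet> x -
  r) x^\<delta> for the old one, which is zero except in degree |\<alpha>| - 1. \<open>solve\<close>
  for the new system gives the coefficients, and the pairing in degree |\<alpha>| relates the two
  norms.\<close>

lemma orth_system_difference:
  assumes "orth_system g S H Hi" and "orth_system g' S' H' Hi'"
    and g': "\<And>\<gamma>. g' \<gamma> = dshift n g \<gamma> - r * g \<gamma>"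
  shows "mlength \<gamma> < mlength \<alpha> \<Longrightarrow> S \<alpha> \<gamma> - S' \<alpha> \<gamma> =
      (\<Sum>\<delta>\<in>plevel (mlength \<alpha>). \<Sum>\<epsilon>\<in>plevel (mlength \<alpha>). dshift n (H \<alpha>) \<delta> * Hi' \<delta> \<epsilon> * S' \<epsilon> \<gamma>)"
    and "mlength \<gamma> = mlength \<alpha> \<Longrightarrow> H' \<alpha> \<gamma> =
      (\<Sum>\<delta>\<in>plevel (mlength \<alpha>). S' \<alpha> \<delta> * dshift n (\<lambda>\<zeta>. H \<zeta> \<gamma>) \<delta>)
      - (\<Sum>\<zeta>\<in>level (mlength \<alpha>). dshift n (\<lambda>\<eta>. S \<eta> \<zeta>) \<alpha> * H \<zeta> \<gamma>) - r * H \<alpha> \<gamma>"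
proof -
  interpret P: orth_system g S H Hi by fact
  interpret P': orth_system g' S' H' Hi' by fact
  have X: "(\<Sum>\<gamma>\<in>below (mlength \<alpha>). (S \<alpha> \<gamma> - S' \<alpha> \<gamma>) * g' (\<gamma> + \<delta>)) =
      dshift n (P.U \<alpha>) \<delta> - r * P.U \<alpha> \<delta> - P'.U \<alpha> \<delta>" for \<alpha> \<delta>
  proof -
    let ?K = "Suc (mlength \<alpha>)"
    have "(\<Sum>\<gamma>\<in>below (mlength \<alpha>). (S \<alpha> \<gamma> - S' \<alpha> \<gamma>) * g' (\<gamma> + \<delta>)) =
        (\<Sum>\<gamma>\<in>below ?K. (S \<alpha> \<gamma> - S' \<alpha> \<gamma>) * g' (\<gamma> + \<delta>))"
      by (simp add: sum_below_Suc P.S_unit P'.S_unit)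
    also have "\<dots> = (\<Sum>\<gamma>\<in>below ?K. S \<alpha> \<gamma> * dshift n g (\<gamma> + \<delta>))
        - r * (\<Sum>\<gamma>\<in>below ?K. S \<alpha> \<gamma> * g (\<gamma> + \<delta>)) - (\<Sum>\<gamma>\<in>below ?K. S' \<alpha> \<gamma> * g' (\<gamma> + \<delta>))"
      unfolding sum_distrib_left sum_subtractf[symmetric]
      by (intro sum.cong refl) (simp add: g' algebra_simps)
    finally show ?thesis
      by (simp add: P.sum_S_dshift P.U_def P'.U_def)
  qed
  have Y: "(\<Sum>\<gamma>\<in>below (mlength \<alpha>). (S \<alpha> \<gamma> - S' \<alpha> \<gamma>) * g' (\<gamma> + \<delta>)) =
      (if Suc (mlength \<delta>) = mlength \<alpha> then dshift n (H \<alpha>) \<delta> else 0)" if "mlength \<delta> < mlength \<alpha>" for \<alpha> \<delta>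
    unfolding X using that by (simp add: P.dshift_U_low P.U_low P'.U_low)
  show "mlength \<gamma> < mlength \<alpha> \<Longrightarrow> S \<alpha> \<gamma> - S' \<alpha> \<gamma> =
      (\<Sum>\<delta>\<in>plevel (mlength \<alpha>). \<Sum>\<epsilon>\<in>plevel (mlength \<alpha>). dshift n (H \<alpha>) \<delta> * Hi' \<delta> \<epsilon> * S' \<epsilon> \<gamma>)"
    by (rule P'.solve(1)[OF Y])
  assume \<gamma>: "mlength \<gamma> = mlength \<alpha>"
  \<comment> \<open>The roles of \<alpha> and \<gamma> are exchanged on purpose: after transposition
    by the symmetry of the norms, \<open>H\<close> stands on the right, and the result reads as a
    matrix times \<open>H\<close>.\<close>
  have "dshift n (P.U \<gamma>) \<alpha> - r * P.U \<gamma> \<alpha> - P'.U \<gamma> \<alpha> =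
      - (\<Sum>\<delta>\<in>plevel (mlength \<gamma>). dshift n (H \<gamma>) \<delta> * S' \<alpha> \<delta>)"
    unfolding X[symmetric] by (rule P'.solve(2)[OF Y]) (simp_all add: \<gamma>)
  moreover have "P.U \<gamma> \<alpha> = H \<alpha> \<gamma>" "P'.U \<gamma> \<alpha> = H' \<alpha> \<gamma>"
    using \<gamma> P.H_sym[of \<alpha> \<gamma>] P'.H_sym[of \<alpha> \<gamma>] by (simp_all add: P.U_diag P'.U_diag)
  moreover have "dshift n (P.U \<gamma>) \<alpha> = - (\<Sum>\<zeta>\<in>level (mlength \<alpha>). dshift n (\<lambda>\<eta>. S \<eta> \<zeta>) \<alpha> * H \<zeta> \<gamma>)"
    using \<gamma> by (simp add: P.dshift_U_diag) (auto intro!: sum.cong simp: P.H_sym)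
  ultimately show "H' \<alpha> \<gamma> =
      (\<Sum>\<delta>\<in>plevel (mlength \<alpha>). S' \<alpha> \<delta> * dshift n (\<lambda>\<zeta>. H \<zeta> \<gamma>) \<delta>)
      - (\<Sum>\<zeta>\<in>level (mlength \<alpha>). dshift n (\<lambda>\<eta>. S \<eta> \<zeta>) \<alpha> * H \<zeta> \<gamma>) - r * H \<alpha> \<gamma>"
    using \<gamma> P.H_row_transpose[of n \<gamma> "S' \<alpha>"] by simp
qed

text \<open>\<open>M\<close> inverts the coefficient matrix at \<open>s0\<close> only, and nothing
  is assumed about the dependence of x on s. Multiplying the system by \<open>M\<close> gives x = c
  - x E with c and E differentiable at \<open>s0\<close> and E = 0 there; boundedness near
  \<open>s0\<close>, continuity and differentiability of x at \<open>s0\<close> follow in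
  turn.\<close>

lemma linear_system_derivative:
  fixes x b :: "real \<Rightarrow> 'i \<Rightarrow> real" and A :: "real \<Rightarrow> 'i \<Rightarrow> 'i \<Rightarrow> real"
  assumes F: "finite F"
    and eq: "\<And>s i. i \<in> F \<Longrightarrow> (\<Sum>j\<in>F. x s j * A s j i) = b s i"
    and dA: "\<And>i j. i \<in> F \<Longrightarrow> j \<in> F \<Longrightarrow> ((\<lambda>s. A s j i) has_real_derivative A' j i) (at s0)"
    and db: "\<And>i. i \<in> F \<Longrightarrow> ((\<lambda>s. b s i) has_real_derivative b' i) (at s0)"
    and inv: "\<And>y k. k \<in> F \<Longrightarrow> y k = (\<Sum>i\<in>F. (\<Sum>j\<in>F. y j * A s0 j i) * M i k)"
  obtains x' where "\<And>k. k \<in> F \<Longrightarrow> ((\<lambda>s. x s k) has_real_derivative x' k) (at s0)"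
proof -
  define E where "E s j k = (\<Sum>i\<in>F. (A s j i - A s0 j i) * M i k)" for s j k
  define c where "c s k = (\<Sum>i\<in>F. b s i * M i k)" for s k
  define E' where "E' j k = (\<Sum>i\<in>F. A' j i * M i k)" for j k
  define c' where "c' k = (\<Sum>i\<in>F. b' i * M i k)" for k
  have dE: "((\<lambda>s. E s j k) has_real_derivative E' j k) (at s0)" if "j \<in> F" for j k
    unfolding E_def E'_def using dA[OF _ that] by (auto intro!: derivative_eq_intros)
  have dc: "((\<lambda>s. c s k) has_real_derivative c' k) (at s0)" for k
    unfolding c_def c'_def using db by (auto intro!: derivative_eq_intros)
  have E0 [simp]: "E s0 j k = 0" for j k by (simp add: E_def)
  have xeq: "x s k = c s k - (\<Sum>j\<in>F. x s j * E s j k)" if "k \<in> F" for s k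
  proof -
    have "(\<Sum>j\<in>F. x s j * E s j k) =
        (\<Sum>i\<in>F. (\<Sum>j\<in>F. x s j * A s j i) * M i k) - (\<Sum>i\<in>F. (\<Sum>j\<in>F. x s j * A s0 j i) * M i k)"
      unfolding E_def sum_distrib_left sum_distrib_right sum_subtractf[symmetric]
      by (subst sum.swap) (simp add: algebra_simps)
    also have "\<dots> = c s k - x s k"
      using inv[OF that, of "x s"] by (simp add: eq c_def)
    finally show ?thesis by simp
  qed
  have E_lim: "((\<lambda>s. E s j k) \<longlongrightarrow> 0) (at s0)" if "j \<in> F" for j k
    using DERIV_isCont[OF dE[OF that, of k]] by (simp add: isCont_def)
  have c_lim: "((\<lambda>s. c s k) \<longlongrightarrow> c s0 k) (at s0)" for k
    using DERIV_isCont[OF dc[of k]] by (simp add: isCont_def)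
  define e where "e s = (\<Sum>j\<in>F. \<Sum>k\<in>F. \<bar>E s j k\<bar>)" for s
  define C where "C s = (\<Sum>k\<in>F. \<bar>c s k\<bar>)" for s
  define nx where "nx s = (\<Sum>k\<in>F. \<bar>x s k\<bar>)" for s
  have "(e \<longlongrightarrow> 0) (at s0)"
    unfolding e_def using E_lim by (intro tendsto_null_sum tendsto_rabs_zero)
  \<comment> \<open>A bound below 1 on the entries of \<open>E\<close> allows absorption: nx <= C +
    nx / 2 gives nx <= 2 C near \<open>s0\<close>.\<close>
  then have ev1: "eventually (\<lambda>s. e s < 1/2) (at s0)"
    by (rule order_tendstoD) simp
  have "(C \<longlongrightarrow> C s0) (at s0)"
    unfolding C_def by (intro tendsto_intros c_lim)
  then have ev2: "eventually (\<lambda>s. C s < C s0 + 1) (at s0)"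
    by (rule order_tendstoD) simp
  have nx_le: "nx s \<le> C s + nx s * e s" for s
  proof -
    have "nx s \<le> (\<Sum>k\<in>F. \<bar>c s k\<bar> + (\<Sum>j\<in>F. \<bar>x s j\<bar> * \<bar>E s j k\<bar>))"
      unfolding nx_def
    proof (rule sum_mono)
      fix k assume "k \<in> F"
      have "\<bar>\<Sum>j\<in>F. x s j * E s j k\<bar> \<le> (\<Sum>j\<in>F. \<bar>x s j\<bar> * \<bar>E s j k\<bar>)"
        by (rule order_trans[OF sum_abs]) (simp add: abs_mult)
      then show "\<bar>x s k\<bar> \<le> \<bar>c s k\<bar> + (\<Sum>j\<in>F. \<bar>x s j\<bar> * \<bar>E s j k\<bar>)"
        by (subst xeq[OF \<open>k \<in> F\<close>]) linarith
    qed
    also have "\<dots> = C s + (\<Sum>j\<in>F. \<bar>x s j\<bar> * (\<Sum>k\<in>F. \<bar>E s j k\<bar>))"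
      by (simp add: sum.distrib C_def sum_distrib_left) (rule sum.swap)
    also have "(\<Sum>j\<in>F. \<bar>x s j\<bar> * (\<Sum>k\<in>F. \<bar>E s j k\<bar>)) \<le> (\<Sum>j\<in>F. \<bar>x s j\<bar> * e s)"
      unfolding e_def
      by (intro sum_mono mult_left_mono member_le_sum F sum_nonneg) auto
    finally show ?thesis by (simp add: nx_def sum_distrib_right)
  qed
  have bound: "eventually (\<lambda>s. nx s \<le> 2 * (C s0 + 1)) (at s0)"
    using ev1 ev2
  proof eventually_elim
    case (elim s)
    have "nx s \<ge> 0" by (auto simp: nx_def sum_nonneg)
    then have "nx s * e s \<le> nx s * (1/2)" using elim by (intro mult_left_mono) auto
    then have "nx s \<le> 2 * C s" using nx_le[of s] by simp
    with elim show ?case by simp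
  qed
  have xE_lim: "((\<lambda>s. x s j * E s j k) \<longlongrightarrow> 0) (at s0)" if "j \<in> F" for j k
  proof (rule tendsto_0_le[OF E_lim[OF that, of k]])
    show "\<forall>\<^sub>F s in at s0. norm (x s j * E s j k) \<le> norm (E s j k) * (2 * (C s0 + 1))"
      using bound
    proof eventually_elim
      case (elim s)
      have "\<bar>x s j\<bar> \<le> nx s" unfolding nx_def by (rule member_le_sum) (use F that in auto)
      with elim have "\<bar>x s j\<bar> \<le> 2 * (C s0 + 1)" by linarith
      then have "\<bar>E s j k\<bar> * \<bar>x s j\<bar> \<le> \<bar>E s j k\<bar> * (2 * (C s0 + 1))"
        by (intro mult_left_mono) auto
      then show ?case by (simp add: abs_mult mult_ac)
    qed
  qed
  have x_lim: "((\<lambda>s. x s k) \<longlongrightarrow> x s0 k) (at s0)" if "k \<in> F" for k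
  proof -
    have "((\<lambda>s. c s k - (\<Sum>j\<in>F. x s j * E s j k)) \<longlongrightarrow> c s0 k - 0) (at s0)"
      using xE_lim by (intro tendsto_diff c_lim tendsto_null_sum)
    moreover have "x s0 k = c s0 k" using xeq[OF that, of s0] by simp
    ultimately show ?thesis by (simp add: xeq[OF that, symmetric])
  qed
  \<comment> \<open>Product rule with a factor known only to be continuous: \<open>E\<close>
    vanishes at \<open>s0\<close>, so the difference quotient of x E is x times that of
    \<open>E\<close>.\<close>
  have dxE: "((\<lambda>s. x s j * E s j k) has_real_derivative x s0 j * E' j k) (at s0)" if "j \<in> F" for j k
  proof -
    have "((\<lambda>s. (E s j k - E s0 j k) / (s - s0)) \<longlongrightarrow> E' j k) (at s0)"
      using dE[OF that, of k] by (simp add: has_field_derivative_iff)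
    from tendsto_mult[OF x_lim[OF that] this] show ?thesis
      by (simp add: has_field_derivative_iff)
  qed
  show thesis
  proof
    fix k assume "k \<in> F"
    have "((\<lambda>s. c s k - (\<Sum>j\<in>F. x s j * E s j k)) has_real_derivative
        (c' k - (\<Sum>j\<in>F. x s0 j * E' j k))) (at s0)"
      by (intro DERIV_diff dc DERIV_sum dxE)
    then show "((\<lambda>s. x s k) has_real_derivative (c' k - (\<Sum>j\<in>F. x s0 j * E' j k))) (at s0)"
      by (simp add: xeq[OF \<open>k \<in> F\<close>, symmetric])
  qed
qed

text \<open>Existence comes from \<open>linear_system_derivative\<close>, applied to the
  orthogonality relations of one polynomial. The values come from differentiating \<open>U\<close>:
  below the diagonal it vanishes identically in s, which yields the pairings of the derivative of
  P_\<alpha> and hence its coefficients by \<open>solve\<close>; on the diagonal it is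
  \<open>H\<close>.\<close>

lemma orth_system_derivative:
  fixes g :: "real \<Rightarrow> 'd::finite mindex \<Rightarrow> real"
  assumes sys: "\<And>s. orth_system (g s) (S s) (H s) (Hi s)"
    and dg: "\<And>\<gamma>. ((\<lambda>s. g s \<gamma>) has_real_derivative dshift n (g s0) \<gamma>) (at s0)"
  shows "mlength \<gamma> < mlength \<alpha> \<Longrightarrow> ((\<lambda>s. S s \<alpha> \<gamma>) has_real_derivative
      - (\<Sum>\<delta>\<in>plevel (mlength \<alpha>). \<Sum>\<epsilon>\<in>plevel (mlength \<alpha>).
          dshift n (H s0 \<alpha>) \<delta> * Hi s0 \<delta> \<epsilon> * S s0 \<epsilon> \<gamma>)) (at s0)"
    and "mlength \<gamma> = mlength \<alpha> \<Longrightarrow> ((\<lambda>s. H s \<alpha> \<gamma>) has_real_derivative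
      (\<Sum>\<delta>\<in>plevel (mlength \<alpha>). S s0 \<alpha> \<delta> * dshift n (\<lambda>\<zeta>. H s0 \<zeta> \<gamma>) \<delta>)
      - (\<Sum>\<zeta>\<in>level (mlength \<alpha>). dshift n (\<lambda>\<eta>. S s0 \<eta> \<zeta>) \<alpha> * H s0 \<zeta> \<gamma>)) (at s0)"
proof -
  interpret P: orth_system "g s" "S s" "H s" "Hi s" for s by (rule sys)
  have ex: "\<exists>x'. \<forall>\<gamma>\<in>below (mlength \<alpha>). ((\<lambda>s. S s \<alpha> \<gamma>) has_real_derivative x' \<gamma>) (at s0)" for \<alpha>
  proof -
    let ?k = "mlength \<alpha>"
    \<comment> \<open>The inverse of the truncated moment matrix at \<open>s0\<close>, in the form
      S^T H^(-1) S that \<open>expansion\<close> provides.\<close>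
    define M where "M \<delta> \<gamma> = (\<Sum>\<zeta>\<in>below ?k. \<Sum>\<epsilon>\<in>level (mlength \<zeta>).
        S s0 \<zeta> \<delta> * Hi s0 \<zeta> \<epsilon> * S s0 \<epsilon> \<gamma>)" for \<delta> \<gamma>
    have inv: "y \<gamma> = (\<Sum>\<delta>\<in>below ?k. (\<Sum>\<delta>'\<in>below ?k. y \<delta>' * g s0 (\<delta>' + \<delta>)) * M \<delta> \<gamma>)"
      if "\<gamma> \<in> below ?k" for y \<gamma>
    proof -
      have "y \<gamma> = (\<Sum>\<zeta>\<in>below ?k. \<Sum>\<epsilon>\<in>level (mlength \<zeta>).
          (\<Sum>\<delta>\<in>below ?k. S s0 \<zeta> \<delta> * (\<Sum>\<delta>'\<in>below ?k. y \<delta>' * g s0 (\<delta>' + \<delta>))) * Hi s0 \<zeta> \<epsilon> * S s0 \<epsilon> \<gamma>)"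
        unfolding P.expansion[where k="?k" and X=y and s=s0 and \<gamma>=\<gamma>, OF that[unfolded mem_below]]
        by (intro sum.cong refl) (simp add: P.sum_times_U)
      also have "\<dots> = (\<Sum>\<delta>\<in>below ?k. \<Sum>\<zeta>\<in>below ?k. \<Sum>\<epsilon>\<in>level (mlength \<zeta>).
          S s0 \<zeta> \<delta> * (\<Sum>\<delta>'\<in>below ?k. y \<delta>' * g s0 (\<delta>' + \<delta>)) * Hi s0 \<zeta> \<epsilon> * S s0 \<epsilon> \<gamma>)"
        unfolding sum_distrib_right
        by (subst (2) sum.swap, rule sum.cong[OF refl], subst sum.swap, rule refl)
      finally show ?thesis by (simp add: M_def sum_distrib_left mult_ac)
    qed
    have eq: "(\<Sum>\<delta>\<in>below ?k. S s \<alpha> \<delta> * g s (\<delta> + \<gamma>)) = - g s (\<alpha> + \<gamma>)" if "\<gamma> \<in> below ?k" for s \<gamma>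
      using P.U_split[of s \<alpha> \<gamma>] P.U_low[of \<gamma> \<alpha> s] that by simp
    have dA: "((\<lambda>s. g s (\<delta> + \<gamma>)) has_real_derivative dshift n (g s0) (\<delta> + \<gamma>)) (at s0)" for \<delta> \<gamma>
      by (rule dg)
    have db: "((\<lambda>s. - g s (\<alpha> + \<gamma>)) has_real_derivative - dshift n (g s0) (\<alpha> + \<gamma>)) (at s0)" for \<gamma>
      by (rule DERIV_minus[OF dg])
    obtain x' where "\<And>\<gamma>. \<gamma> \<in> below ?k \<Longrightarrow> ((\<lambda>s. S s \<alpha> \<gamma>) has_real_derivative x' \<gamma>) (at s0)"
      using linear_system_derivative[where x="\<lambda>s. S s \<alpha>" and A="\<lambda>s \<delta> \<gamma>. g s (\<delta> + \<gamma>)"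
            and b="\<lambda>s \<gamma>. - g s (\<alpha> + \<gamma>)" and F="below ?k" and M=M and ?s0.0=s0
            and A'="\<lambda>\<delta> \<gamma>. dshift n (g s0) (\<delta> + \<gamma>)" and b'="\<lambda>\<gamma>. - dshift n (g s0) (\<alpha> + \<gamma>)",
            OF finite_below eq dA db inv] by blast
    then show ?thesis by blast
  qed
  define S' where "S' \<alpha> \<gamma> = deriv (\<lambda>s. S s \<alpha> \<gamma>) s0" for \<alpha> \<gamma>
  have S': "((\<lambda>s. S s \<alpha> \<gamma>) has_real_derivative S' \<alpha> \<gamma>) (at s0)" if "mlength \<gamma> < mlength \<alpha>" for \<alpha> \<gamma>
    using ex[of \<alpha>] that by (auto simp: S'_def DERIV_deriv_iff_has_field_derivative)
  have dU: "((\<lambda>s. P.U s \<alpha> \<delta>) has_real_derivative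
      (\<Sum>\<gamma>\<in>below (mlength \<alpha>). S' \<alpha> \<gamma> * g s0 (\<gamma> + \<delta>)) + dshift n (P.U s0 \<alpha>) \<delta>) (at s0)" for \<alpha> \<delta>
  proof -
    have "((\<lambda>s. (\<Sum>\<gamma>\<in>below (mlength \<alpha>). S s \<alpha> \<gamma> * g s (\<gamma> + \<delta>)) + g s (\<alpha> + \<delta>)) has_real_derivative
        (\<Sum>\<gamma>\<in>below (mlength \<alpha>). S' \<alpha> \<gamma> * g s0 (\<gamma> + \<delta>) + dshift n (g s0) (\<gamma> + \<delta>) * S s0 \<alpha> \<gamma>) +
        dshift n (g s0) (\<alpha> + \<delta>)) (at s0)"
      by (intro DERIV_add DERIV_sum DERIV_mult dg S') simp
    moreover have "dshift n (P.U s0 \<alpha>) \<delta> =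
        (\<Sum>\<gamma>\<in>below (mlength \<alpha>). S s0 \<alpha> \<gamma> * dshift n (g s0) (\<gamma> + \<delta>)) + dshift n (g s0) (\<alpha> + \<delta>)"
      using P.sum_S_dshift[of \<alpha> "Suc (mlength \<alpha>)" s0 n \<delta>]
        P.sum_S_level[of s0 \<alpha> "\<lambda>\<gamma>. dshift n (g s0) (\<gamma> + \<delta>)"] by (simp add: sum_below_Suc)
    then have "(\<Sum>\<gamma>\<in>below (mlength \<alpha>). S' \<alpha> \<gamma> * g s0 (\<gamma> + \<delta>) + dshift n (g s0) (\<gamma> + \<delta>) * S s0 \<alpha> \<gamma>) +
        dshift n (g s0) (\<alpha> + \<delta>) =
        (\<Sum>\<gamma>\<in>below (mlength \<alpha>). S' \<alpha> \<gamma> * g s0 (\<gamma> + \<delta>)) + dshift n (P.U s0 \<alpha>) \<delta>"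
      by (simp add: sum.distrib mult.commute)
    ultimately show ?thesis
      by (simp only: P.U_split[symmetric])
  qed
  have Y: "(\<Sum>\<gamma>\<in>below (mlength \<alpha>). S' \<alpha> \<gamma> * g s0 (\<gamma> + \<delta>)) =
      (if Suc (mlength \<delta>) = mlength \<alpha> then - dshift n (H s0 \<alpha>) \<delta> else 0)" if "mlength \<delta> < mlength \<alpha>" for \<alpha> \<delta>
    using DERIV_unique[OF dU[of \<alpha> \<delta>], of 0] that
    by (simp add: P.U_low P.dshift_U_low split: if_splits)
  show "((\<lambda>s. S s \<alpha> \<gamma>) has_real_derivative
      - (\<Sum>\<delta>\<in>plevel (mlength \<alpha>). \<Sum>\<epsilon>\<in>plevel (mlength \<alpha>).
          dshift n (H s0 \<alpha>) \<delta> * Hi s0 \<delta> \<epsilon> * S s0 \<epsilon> \<gamma>)) (at s0)" if "mlength \<gamma> < mlength \<alpha>"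
    using S'[OF that] P.solve(1)[OF Y that] by (simp add: sum_negf)
  assume \<gamma>: "mlength \<gamma> = mlength \<alpha>"
  have "((\<lambda>s. P.U s \<gamma> \<alpha>) has_real_derivative
      (\<Sum>\<delta>\<in>plevel (mlength \<gamma>). dshift n (H s0 \<gamma>) \<delta> * S s0 \<alpha> \<delta>)
      - (\<Sum>\<zeta>\<in>level (mlength \<gamma>). H s0 \<gamma> \<zeta> * dshift n (\<lambda>\<eta>. S s0 \<eta> \<zeta>) \<alpha>)) (at s0)"
  proof -
    have "(\<Sum>\<delta>\<in>below (mlength \<gamma>). S' \<gamma> \<delta> * g s0 (\<delta> + \<alpha>)) =
        - (\<Sum>\<delta>\<in>plevel (mlength \<gamma>). - dshift n (H s0 \<gamma>) \<delta> * S s0 \<alpha> \<delta>)"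
      by (rule P.solve(2)[where k="mlength \<gamma>" and X="S' \<gamma>" and s=s0 and \<gamma>=\<alpha>
            and b="\<lambda>\<delta>. - dshift n (H s0 \<gamma>) \<delta>"]) (rule Y, assumption, rule \<gamma>[symmetric])
    with dU[of \<gamma> \<alpha>] show ?thesis
      unfolding P.dshift_U_diag[where \<alpha>=\<gamma> and \<delta>=\<alpha> and n=n and s=s0, OF \<gamma>[symmetric]]
      by (simp add: sum_negf)
  qed
  moreover have "P.U s \<gamma> \<alpha> = H s \<alpha> \<gamma>" for s
    using P.U_diag[of \<alpha> \<gamma> s] P.H_sym[of \<gamma> \<alpha> s] \<gamma> by simp
  moreover have "(\<Sum>\<zeta>\<in>level (mlength \<gamma>). H s0 \<gamma> \<zeta> * dshift n (\<lambda>\<eta>. S s0 \<eta> \<zeta>) \<alpha>) =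
      (\<Sum>\<zeta>\<in>level (mlength \<alpha>). dshift n (\<lambda>\<eta>. S s0 \<eta> \<zeta>) \<alpha> * H s0 \<zeta> \<gamma>)"
    unfolding \<gamma> by (intro sum.cong refl) (use \<gamma> P.H_sym[of \<gamma> _ s0] in simp)
  ultimately show "((\<lambda>s. H s \<alpha> \<gamma>) has_real_derivative
      (\<Sum>\<delta>\<in>plevel (mlength \<alpha>). S s0 \<alpha> \<delta> * dshift n (\<lambda>\<zeta>. H s0 \<zeta> \<gamma>) \<delta>)
      - (\<Sum>\<zeta>\<in>level (mlength \<alpha>). dshift n (\<lambda>\<eta>. S s0 \<eta> \<zeta>) \<alpha> * H s0 \<zeta> \<gamma>)) (at s0)"
    using P.H_row_transpose[where n=n and s=s0 and \<alpha>=\<gamma> and f="S s0 \<alpha>"] \<gamma> by (simp only:)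
qed

section \<open>Moments of the deformed measures\<close>

lemma monomial_add: "monomial (\<alpha> + \<beta>) x = monomial \<alpha> x * monomial \<beta> x"
  unfolding monomial_def prod.distrib[symmetric]
  by (rule prod.cong[OF refl]) (simp add: power_add)

lemma monomial_axis: "monomial (axis c (Suc 0)) x = x $ c"
proof -
  have "monomial (axis c (Suc 0)) x = (\<Prod>i\<in>UNIV. if i = c then x $ c else 1)"
    unfolding monomial_def by (rule prod.cong) (auto simp: axis_def)
  then show ?thesis by simp
qed

lemma borel_measurable_monomial [measurable]: "monomial \<alpha> \<in> borel_measurable borel"
  unfolding monomial_def by (intro borel_measurable_continuous_onI continuous_intros)

lemma summable_update:
  "(\<lambda>\<alpha>. (t(\<alpha>0 := s)) \<alpha> * monomial \<alpha> x) summable_on UNIV \<longleftrightarrow>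
   (\<lambda>\<alpha>. t \<alpha> * monomial \<alpha> x) summable_on UNIV"
proof -
  have *: "f summable_on UNIV \<longleftrightarrow> f summable_on (UNIV - {\<alpha>0})" for f :: "'a mindex \<Rightarrow> real"
    using summable_on_insert_iff[of f \<alpha>0 "UNIV - {\<alpha>0}"] by (simp add: insert_absorb)
  show ?thesis
    unfolding *[of "\<lambda>\<alpha>. (t(\<alpha>0 := s)) \<alpha> * monomial \<alpha> x"] *[of "\<lambda>\<alpha>. t \<alpha> * monomial \<alpha> x"]
    by (rule summable_on_cong) auto
qed

text \<open>Splitting off one term relies on summability, because \<open>infsum\<close> is 0 on a
  family that is not summable. This is what the almost everywhere clause of
  \<open>admissible\<close> is used for.\<close>

lemma tpoly_update:
  assumes "(\<lambda>\<alpha>. t \<alpha> * monomial \<alpha> x) summable_on UNIV"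
  shows "tpoly (t(\<alpha>0 := s)) x = (s - t \<alpha>0) * monomial \<alpha>0 x + tpoly t x"
proof -
  have *: "infsum f UNIV = f \<alpha>0 + infsum f (UNIV - {\<alpha>0})" if "f summable_on UNIV" for f :: "'a mindex \<Rightarrow> real"
    using infsum_insert[of f "UNIV - {\<alpha>0}" \<alpha>0] summable_on_subset_banach[OF that, of "UNIV - {\<alpha>0}"]
    by (simp add: insert_absorb)
  have "infsum (\<lambda>\<alpha>. (t(\<alpha>0 := s)) \<alpha> * monomial \<alpha> x) (UNIV - {\<alpha>0}) =
      infsum (\<lambda>\<alpha>. t \<alpha> * monomial \<alpha> x) (UNIV - {\<alpha>0})"
    by (rule infsum_cong) auto
  with *[OF assms] *[OF summable_update[of t \<alpha>0 s x, THEN iffD2, OF assms]]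
  show ?thesis by (simp add: tpoly_def left_diff_distrib)
qed

text \<open>The set where the family is summable has to be measurable, since \<open>infsum\<close>
  is 0 off it. The family is moved to the naturals along \<open>to_nat\<close>, with zeros outside
  the range; there summability of reals is absolute summability, that is, finiteness of a series of
  extended nonnegative reals.\<close>

lemma borel_measurable_infsum:
  fixes f :: "'i::countable \<Rightarrow> 'a \<Rightarrow> real"
  assumes [measurable]: "\<And>i. f i \<in> borel_measurable M"
  shows "(\<lambda>x. \<Sum>\<^sub>\<infinity>i. f i x) \<in> borel_measurable M"
proof -
  define h where "h n x = (if n \<in> range (to_nat :: 'i \<Rightarrow> nat) then f (from_nat n) x else 0)" for n x
  have [measurable]: "h n \<in> borel_measurable M" for n
    by (cases "n \<in> range (to_nat :: 'i \<Rightarrow> nat)") (simp_all add: h_def[abs_def])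
  have "(\<Sum>\<^sub>\<infinity>i. f i x) = (if (\<Sum>n. ennreal \<bar>h n x\<bar>) = Orderings.top_class.top then 0 else (\<Sum>n. h n x))" for x
  proof -
    have "(\<Sum>\<^sub>\<infinity>i. f i x) = infsum ((\<lambda>n. h n x) \<circ> to_nat) (UNIV :: 'i set)"
      by (rule infsum_cong) (simp add: h_def)
    also have "\<dots> = infsum (\<lambda>n. h n x) (range (to_nat :: 'i \<Rightarrow> nat))"
      by (rule infsum_reindex[symmetric]) simp
    also have "\<dots> = infsum (\<lambda>n. h n x) UNIV"
      by (rule infsum_cong_neutral) (auto simp: h_def)
    also have "\<dots> = (if summable (\<lambda>n. \<bar>h n x\<bar>) then (\<Sum>n. h n x) else 0)"
    proof (cases "summable (\<lambda>n. \<bar>h n x\<bar>)")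
      case True
      then have "(\<lambda>n. h n x) summable_on UNIV"
        by (intro norm_summable_imp_summable_on) simp
      then have "((\<lambda>n. h n x) has_sum infsum (\<lambda>n. h n x) UNIV) UNIV" by simp
      then show ?thesis using True by (auto dest!: has_sum_imp_sums simp: sums_iff)
    next
      case False
      then have "\<not> (\<lambda>n. h n x) summable_on UNIV"
        using summable_on_iff_abs_summable_on_real[of "\<lambda>n. h n x" UNIV]
          summable_on_UNIV_nonneg_real_iff[of "\<lambda>n. \<bar>h n x\<bar>"] by simp
      then show ?thesis using False by (simp add: infsum_not_exists)
    qed
    also have "summable (\<lambda>n. \<bar>h n x\<bar>) \<longleftrightarrow> (\<Sum>n. ennreal \<bar>h n x\<bar>) \<noteq> Orderings.top_class.top"
      by (rule iffI, rule ennreal_suminf_neq_top, simp_all) (rule summable_suminf_not_top, simp_all)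
    finally show ?thesis by (simp only: if_not_P if_cancel split: if_split) blast
  qed
  then have "(\<lambda>x. \<Sum>\<^sub>\<infinity>i. f i x) =
      (\<lambda>x. if (\<Sum>n. ennreal \<bar>h n x\<bar>) = Orderings.top_class.top then 0 else (\<Sum>n. h n x))"
    by (rule ext)
  moreover have "\<dots> \<in> borel_measurable M" by measurable
  ultimately show ?thesis by (simp only:)
qed

lemma borel_measurable_weight:
  assumes "sets \<mu> = sets borel"
  shows "weight N q t m \<in> borel_measurable \<mu>"
proof -
  have "weight N q t m \<in> borel_measurable borel"
    unfolding weight_def tpoly_def power_int_def
    by (intro borel_measurable_times borel_measurable_exp[THEN measurable_compose[rotated]]
        borel_measurable_infsum borel_measurable_prod) auto
  then show ?thesis by (simp add: measurable_cong_sets[OF assms refl])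
qed

lemma weight_update:
  assumes "(\<lambda>\<alpha>. t \<alpha> * monomial \<alpha> x) summable_on UNIV"
  shows "weight N q (t(axis a 1 := s)) m x = exp ((s - t (axis a 1)) * x $ a) * weight N q t m x"
  unfolding weight_def tpoly_update[OF assms] by (simp add: exp_add monomial_axis)

text \<open>At a zero of the linear factor the identity can fail, because \<open>0 powi (-1)\<close>
  is 0 while \<open>0 powi 0\<close> is 1. The strict inequalities of the support exclude such
  points almost everywhere.\<close>

lemma weight_shift:
  fixes N :: "'d::finite coeffs" and q x :: "'d point"
  assumes "N $ b \<bullet> x \<noteq> q $ b"
  shows "weight N q t (m + axis b 1) x = (N $ b \<bullet> x - q $ b) * weight N q t m x"
proof -
  have "(\<Prod>c\<in>UNIV. (N $ c \<bullet> x - q $ c) powi ((m + axis b 1) $ c)) =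
      (\<Prod>c\<in>UNIV. (N $ c \<bullet> x - q $ c) powi (m $ c) * (if c = b then N $ b \<bullet> x - q $ b else 1))"
    using assms by (intro prod.cong refl) (auto simp: axis_def power_int_add)
  then show ?thesis by (simp add: weight_def prod.distrib)
qed

text \<open>The point x is recovered from the numbers N_d \<bullet> x by the inverse of
  \<open>N\<close>. \<open>C\<close> adds up the bounds of all coordinates, so that one constant
  serves for every c.\<close>

lemma polytope_bounded:
  fixes N :: "'d::finite coeffs" and q :: "'d point"
  assumes "invertible N"
  obtains C where "C \<ge> 0" "\<And>(x :: 'd point) c. \<forall>c. \<bar>N $ c \<bullet> x\<bar> < \<bar>q $ c\<bar> \<Longrightarrow> \<bar>x $ c\<bar> \<le> C"
proof -
  obtain N' where N': "N' ** N = Finite_Cartesian_Product.mat 1" using assms by (auto simp: invertible_def)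
  define C where "C = (\<Sum>c\<in>UNIV. \<Sum>d\<in>UNIV. \<bar>N' $ c $ d\<bar> * \<bar>q $ d\<bar>)"
  have "\<bar>x $ c\<bar> \<le> C" if x: "\<forall>c. \<bar>N $ c \<bullet> x\<bar> < \<bar>q $ c\<bar>" for x :: "'d point" and c
  proof -
    have "x = N' *v (N *v x)" by (simp add: matrix_vector_mul_assoc N')
    then have "x $ c = (\<Sum>d\<in>UNIV. N' $ c $ d * (N $ d \<bullet> x))"
      by (metis (mono_tags, lifting) matrix_vector_mul_component inner_vec_def inner_real_def sum.cong)
    then have "\<bar>x $ c\<bar> \<le> (\<Sum>d\<in>UNIV. \<bar>N' $ c $ d\<bar> * \<bar>N $ d \<bullet> x\<bar>)"
      by (simp add: sum_abs[THEN order_trans] abs_mult)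
    also have "\<dots> \<le> (\<Sum>d\<in>UNIV. \<bar>N' $ c $ d\<bar> * \<bar>q $ d\<bar>)"
      by (rule sum_mono) (use x in \<open>auto intro!: mult_left_mono simp: less_imp_le\<close>)
    also have "\<dots> \<le> C" unfolding C_def
      by (rule member_le_sum[where f="\<lambda>c. \<Sum>d\<in>UNIV. \<bar>N' $ c $ d\<bar> * \<bar>q $ d\<bar>"]) (auto intro!: sum_nonneg)
    finally show ?thesis .
  qed
  moreover have "C \<ge> 0" by (auto simp: C_def intro!: sum_nonneg)
  ultimately show ?thesis using that by blast
qed

section \<open>Closure of the admissible pairs under the flows\<close>

definition moment ::
    "'d::finite point measure \<Rightarrow> 'd coeffs \<Rightarrow> 'd point \<Rightarrow> 'd times \<Rightarrow> 'd ishift \<Rightarrow> 'd mindex \<Rightarrow> real" where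
  "moment \<mu> N q t m \<gamma> = (\<integral>x. monomial \<gamma> x * weight N q t m x \<partial>\<mu>)"

text \<open>A factor bounded almost everywhere keeps all moments finite. Applied to first level
  times and to shifts, this makes the factorization available on whole lines of times, where
  derivatives are taken, and at the neighbouring m.\<close>

lemma admissible_rescale:
  assumes "admissible \<mu> N q t m" and borel: "sets \<mu> = sets borel"
    and "AE x in \<mu>. weight N q t' m' x = f x * weight N q t m x"
    and "AE x in \<mu>. \<bar>f x\<bar> \<le> K"
    and "AE x in \<mu>. (\<lambda>\<alpha>. t' \<alpha> * monomial \<alpha> x) summable_on UNIV"
  shows "admissible \<mu> N q t' m'"
  unfolding admissible_def
proof (intro conjI allI assms)
  fix \<gamma>
  have "integrable \<mu> (\<lambda>x. K * (monomial \<gamma> x * weight N q t m x))"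
    using assms(1) by (auto simp: admissible_def)
  then show "integrable \<mu> (\<lambda>x. monomial \<gamma> x * weight N q t' m' x)"
  proof (rule Bochner_Integration.integrable_bound)
    show "(\<lambda>x. monomial \<gamma> x * weight N q t' m' x) \<in> borel_measurable \<mu>"
      by (intro borel_measurable_times borel_measurable_weight[OF borel])
        (simp add: measurable_cong_sets[OF borel refl] borel_measurable_monomial)
    show "AE x in \<mu>. norm (monomial \<gamma> x * weight N q t' m' x) \<le>
        norm (K * (monomial \<gamma> x * weight N q t m x))"
      using assms(3,4)
    proof eventually_elim
      case (elim x)
      have "\<bar>f x\<bar> * \<bar>monomial \<gamma> x * weight N q t m x\<bar> \<le> \<bar>K\<bar> * \<bar>monomial \<gamma> x * weight N q t m x\<bar>"
        using elim(2) by (intro mult_right_mono) auto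
      then show ?case by (simp add: elim(1) abs_mult mult_ac)
    qed
  qed
qed

locale flow =
  fixes \<mu> :: "'d::finite point measure" and N :: "'d coeffs" and q :: "'d point"
  assumes N: "invertible N"
    and borel: "sets \<mu> = sets borel"
    and support: "AE x in \<mu>. \<forall>c. \<bar>N $ c \<bullet> x\<bar> < \<bar>q $ c\<bar>"
begin

lemma admissible_update:
  assumes "admissible \<mu> N q t m"
  shows "admissible \<mu> N q (t(axis a 1 := s)) m"
proof -
  obtain C where C: "C \<ge> 0" "\<And>(x :: 'd point) c. \<forall>c. \<bar>N $ c \<bullet> x\<bar> < \<bar>q $ c\<bar> \<Longrightarrow> \<bar>x $ c\<bar> \<le> C"
    by (rule polytope_bounded[OF N, of q]) blast
  have sm: "AE x in \<mu>. (\<lambda>\<alpha>. t \<alpha> * monomial \<alpha> x) summable_on UNIV"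
    using assms by (simp add: admissible_def)
  show ?thesis
  proof (rule admissible_rescale[OF assms borel])
    show "AE x in \<mu>. weight N q (t(axis a 1 := s)) m x =
        exp ((s - t (axis a 1)) * x $ a) * weight N q t m x"
      using sm by eventually_elim (rule weight_update)
    show "AE x in \<mu>. \<bar>exp ((s - t (axis a 1)) * x $ a)\<bar> \<le> exp (\<bar>s - t (axis a 1)\<bar> * C)"
      using support
    proof eventually_elim
      case (elim x)
      have "(s - t (axis a 1)) * x $ a \<le> \<bar>s - t (axis a 1)\<bar> * \<bar>x $ a\<bar>"
        by (metis abs_ge_self abs_mult)
      also have "\<dots> \<le> \<bar>s - t (axis a 1)\<bar> * C"
        using C(2)[of x a] elim by (intro mult_left_mono) auto
      finally show ?case by simp
    qed
    show "AE x in \<mu>. (\<lambda>\<alpha>. (t(axis a 1 := s)) \<alpha> * monomial \<alpha> x) summable_on UNIV"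
      using sm by (simp only: summable_update)
  qed
qed

lemma admissible_shift:
  assumes "admissible \<mu> N q t m"
  shows "admissible \<mu> N q t (m + axis b 1)"
proof (rule admissible_rescale[OF assms borel])
  show "AE x in \<mu>. weight N q t (m + axis b 1) x = (N $ b \<bullet> x - q $ b) * weight N q t m x"
    using support by eventually_elim (rule weight_shift, metis less_irrefl)
  show "AE x in \<mu>. \<bar>N $ b \<bullet> x - q $ b\<bar> \<le> 2 * \<bar>q $ b\<bar>"
    using support
  proof eventually_elim
    case (elim x)
    then have "\<bar>N $ b \<bullet> x\<bar> < \<bar>q $ b\<bar>" by blast
    then show ?case by linarith
  qed
  show "AE x in \<mu>. (\<lambda>\<alpha>. t \<alpha> * monomial \<alpha> x) summable_on UNIV"
    using assms by (simp add: admissible_def)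
qed

text \<open>The relation between two functionals that \<open>orth_system_difference\<close>
  requires, with n the row \<open>N $ b\<close> and r = \<open>q $ b\<close>.\<close>

lemma moment_shift:
  assumes "admissible \<mu> N q t m"
  shows "moment \<mu> N q t (m + axis b 1) \<gamma> =
    dshift (N $ b) (moment \<mu> N q t m) \<gamma> - q $ b * moment \<mu> N q t m \<gamma>"
proof -
  have int [simp]: "integrable \<mu> (\<lambda>x. monomial \<gamma> x * weight N q t m x)" for \<gamma>
    using assms by (auto simp: admissible_def)
  have "moment \<mu> N q t (m + axis b 1) \<gamma> =
      (\<integral>x. (\<Sum>c\<in>UNIV. N $ b $ c * (monomial (\<gamma> + axis c 1) x * weight N q t m x))
        - q $ b * (monomial \<gamma> x * weight N q t m x) \<partial>\<mu>)"
    unfolding moment_def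
  proof (rule integral_cong_AE)
    show "AE x in \<mu>. monomial \<gamma> x * weight N q t (m + axis b 1) x =
      (\<Sum>c\<in>UNIV. N $ b $ c * (monomial (\<gamma> + axis c 1) x * weight N q t m x))
        - q $ b * (monomial \<gamma> x * weight N q t m x)"
      using support
    proof eventually_elim
      case (elim x)
      then have "weight N q t (m + axis b 1) x = (N $ b \<bullet> x - q $ b) * weight N q t m x"
        by (intro weight_shift) (metis less_irrefl)
      then show ?case
        by (simp only:) (simp add: monomial_add monomial_axis inner_vec_def algebra_simps sum_distrib_left
            sum_distrib_right)
    qed
    show "(\<lambda>x. monomial \<gamma> x * weight N q t (m + axis b 1) x) \<in> borel_measurable \<mu>"
      using admissible_shift[OF assms, of b] by (auto simp: admissible_def)
    show "(\<lambda>x. (\<Sum>c\<in>UNIV. N $ b $ c * (monomial (\<gamma> + axis c 1) x * weight N q t m x))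
        - q $ b * (monomial \<gamma> x * weight N q t m x)) \<in> borel_measurable \<mu>"
      by (intro borel_measurable_integrable Bochner_Integration.integrable_diff
          Bochner_Integration.integrable_sum integrable_mult_right int)
  qed
  also have "\<dots> = dshift (N $ b) (moment \<mu> N q t m) \<gamma> - q $ b * moment \<mu> N q t m \<gamma>"
    by (simp add: dshift_def moment_def Bochner_Integration.integral_sum del: One_nat_def)
  finally show ?thesis .
qed

end

text \<open>A quadratic bound on the remainder allows differentiation under the integral by one
  explicit estimate, in which \<open>exp_quadratic_bound\<close> controls the integrand
  pointwise.\<close>

lemma has_real_derivative_quadratic:
  assumes "d > 0" "\<And>s. \<bar>s - s0\<bar> < d \<Longrightarrow> \<bar>f s - f s0 - (s - s0) * D\<bar> \<le> K * (s - s0)\<^sup>2"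
  shows "(f has_real_derivative D) (at s0)"
proof -
  have "((\<lambda>s. (f s - f s0) / (s - s0) - D) \<longlongrightarrow> 0) (at s0)"
  proof (rule tendsto_0_le)
    show "((\<lambda>s. s - s0) \<longlongrightarrow> 0) (at s0)" by (rule tendsto_eq_intros refl)+ simp
    have "eventually (\<lambda>s. s \<in> {s0 - d<..<s0 + d} \<and> s \<noteq> s0) (at s0)"
      using assms(1) by (auto simp: eventually_at_filter intro!: eventually_mono[OF eventually_nhds_in_open[of "{s0 - d<..<s0 + d}"]])
    then show "\<forall>\<^sub>F s in at s0. norm ((f s - f s0) / (s - s0) - D) \<le> norm (s - s0) * K"
    proof eventually_elim
      case (elim s)
      then have "\<bar>f s - f s0 - (s - s0) * D\<bar> \<le> K * (s - s0)\<^sup>2" by (intro assms(2)) auto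
      moreover have "(f s - f s0) / (s - s0) - D = (f s - f s0 - (s - s0) * D) / (s - s0)"
        using elim by (simp add: field_simps)
      moreover have "(s - s0)\<^sup>2 = \<bar>s - s0\<bar> * \<bar>s - s0\<bar>" by (simp add: power2_eq_square)
      ultimately show ?case using elim by (simp add: divide_le_eq mult_ac)
    qed
  qed
  then show ?thesis by (simp add: has_field_derivative_iff LIM_zero_iff)
qed

lemma exp_quadratic_bound:
  fixes y :: real
  assumes "\<bar>y\<bar> \<le> 1"
  shows "\<bar>exp y - 1 - y\<bar> \<le> y\<^sup>2"
proof -
  have "exp y \<le> 1 + y + y\<^sup>2"
  proof (cases "y \<ge> 0")
    case True then show ?thesis using assms exp_bound[of y] by simp
  next
    case False
    define z where "z = - y"
    have z: "0 < z" using False by (simp add: z_def)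
    \<comment> \<open>The bound 1 - z + z^2 is the cofactor of 1 + z in 1 + z^3; hence it dominates
      1 / (1 + z), which in turn dominates exp (- z).\<close>
    have "(1 - z + z\<^sup>2) * (1 + z) = 1 + z ^ 3" by (simp add: algebra_simps power2_eq_square power3_eq_cube)
    then have "1 \<le> (1 - z + z\<^sup>2) * (1 + z)" using z by simp
    then have "1 / (1 + z) \<le> 1 - z + z\<^sup>2" using z by (simp add: divide_le_eq)
    moreover have "exp (- z) \<le> 1 / (1 + z)"
      using exp_ge_add_one_self[of z] z by (simp add: exp_minus inverse_eq_divide frac_le)
    ultimately show ?thesis by (simp add: z_def)
  qed
  moreover have "exp y \<ge> 1 + y" by (rule exp_ge_add_one_self)
  ultimately show ?thesis using zero_le_power2[of y] by linarith
qed

section \<open>Differentiation of the moments\<close>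

context flow
begin

lemma moment_derivative_aux:
  assumes adm: "admissible \<mu> N q t m"
  shows "((\<lambda>s. moment \<mu> N q (t(axis a 1 := s)) m \<gamma>) has_real_derivative
    moment \<mu> N q t m (\<gamma> + axis a 1)) (at (t (axis a 1)))"
proof -
  obtain C where C: "C \<ge> 0" "\<And>(x :: 'd point) c. \<forall>c. \<bar>N $ c \<bullet> x\<bar> < \<bar>q $ c\<bar> \<Longrightarrow> \<bar>x $ c\<bar> \<le> C"
    by (rule polytope_bounded[OF N, of q]) blast
  let ?s0 = "t (axis a 1)"
  let ?w = "\<lambda>x. monomial \<gamma> x * weight N q t m x"
  have int [simp]: "integrable \<mu> (\<lambda>x. monomial \<gamma> x * weight N q t m x)" for \<gamma>
    using adm by (auto simp: admissible_def)
  show ?thesis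
  proof (rule has_real_derivative_quadratic)
    \<comment> \<open>Within this radius the exponent (s - s0) x_a has absolute value at most 1 on
      the support, the range of \<open>exp_quadratic_bound\<close>; the added 1 covers C =
      0.\<close>
    show "1 / (C + 1) > 0" using C(1) by simp
    fix s assume s: "\<bar>s - ?s0\<bar> < 1 / (C + 1)"
    let ?h = "s - ?s0"
    let ?w' = "\<lambda>x. monomial \<gamma> x * weight N q (t(axis a 1 := s)) m x"
    have [simp]: "integrable \<mu> ?w'"
      using admissible_update[OF adm, of a s] by (auto simp: admissible_def)
    have "\<bar>?h\<bar> * (C + 1) \<le> 1" using s C(1) by (simp add: field_simps)
    then have hC: "\<bar>?h\<bar> * C \<le> 1" using C(1) by (simp add: algebra_simps)
    have "\<bar>moment \<mu> N q (t(axis a 1 := s)) m \<gamma> - moment \<mu> N q t m \<gamma> - ?h * moment \<mu> N q t m (\<gamma> + axis a 1)\<bar>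
      = \<bar>\<integral>x. ?w' x - ?w x - ?h * (monomial (\<gamma> + axis a 1) x * weight N q t m x) \<partial>\<mu>\<bar>"
      by (simp add: moment_def del: One_nat_def)
    also have "\<dots> \<le> (\<integral>x. (C * ?h)\<^sup>2 * \<bar>?w x\<bar> \<partial>\<mu>)"
    proof (rule order_trans[OF integral_abs_bound integral_mono_AE])
      show "AE x in \<mu>. \<bar>?w' x - ?w x - ?h * (monomial (\<gamma> + axis a 1) x * weight N q t m x)\<bar>
          \<le> (C * ?h)\<^sup>2 * \<bar>?w x\<bar>"
        using support adm[unfolded admissible_def, THEN conjunct1]
      proof eventually_elim
        case (elim x)
        let ?y = "?h * x $ a"
        have "\<bar>x $ a\<bar> \<le> C" using elim C(2) by blast
        then have y: "\<bar>?y\<bar> \<le> \<bar>?h\<bar> * C" by (auto simp: abs_mult intro: mult_left_mono)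
        then have "?y\<^sup>2 \<le> (\<bar>?h\<bar> * C)\<^sup>2" by (rule power2_le_iff_abs_le[THEN iffD2, rotated]) (use C(1) in auto)
        moreover have "\<bar>exp ?y - 1 - ?y\<bar> \<le> ?y\<^sup>2" using y hC by (intro exp_quadratic_bound) simp
        ultimately have "\<bar>exp ?y - 1 - ?y\<bar> \<le> (C * ?h)\<^sup>2" by (simp add: power_mult_distrib mult_ac)
        then have "\<bar>exp ?y - 1 - ?y\<bar> * \<bar>?w x\<bar> \<le> (C * ?h)\<^sup>2 * \<bar>?w x\<bar>" by (rule mult_right_mono) simp
        moreover have "?w' x - ?w x - ?h * (monomial (\<gamma> + axis a 1) x * weight N q t m x) =
            (exp ?y - 1 - ?y) * ?w x"
          unfolding weight_update[OF elim(2)] by (simp add: monomial_add monomial_axis algebra_simps)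
        ultimately show ?case by (simp only: abs_mult)
      qed
    qed (auto simp del: One_nat_def intro!: integrable_mult_right integrable_abs)
    also have "\<dots> = (C\<^sup>2 * (\<integral>x. \<bar>?w x\<bar> \<partial>\<mu>)) * ?h\<^sup>2"
      by (simp add: power_mult_distrib)
    finally show "\<bar>moment \<mu> N q (t(axis a 1 := s)) m \<gamma> - moment \<mu> N q (t(axis a 1 := ?s0)) m \<gamma>
        - ?h * moment \<mu> N q t m (\<gamma> + axis a 1)\<bar> \<le> (C\<^sup>2 * (\<integral>x. \<bar>?w x\<bar> \<partial>\<mu>)) * ?h\<^sup>2"
      by simp
  qed
qed

text \<open>The base point becomes arbitrary, and raising the index is written as
  \<open>dshift\<close> in a coordinate direction, the form that
  \<open>orth_system_derivative\<close> takes.\<close>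

lemma moment_derivative:
  assumes "admissible \<mu> N q t m"
  shows "((\<lambda>s. moment \<mu> N q (t(axis a 1 := s)) m \<gamma>) has_real_derivative
    dshift (axis a 1) (moment \<mu> N q (t(axis a 1 := s0)) m) \<gamma>) (at s0)"
proof -
  have "dshift (axis a 1) f \<gamma> = f (\<gamma> + axis a 1)" for f
  proof -
    have "dshift (axis a 1) f \<gamma> = (\<Sum>c\<in>UNIV. if c = a then f (\<gamma> + axis a 1) else 0)"
      unfolding dshift_def by (intro sum.cong refl) (auto simp: axis_def)
    then show ?thesis by simp
  qed
  then show ?thesis
    using moment_derivative_aux[OF admissible_update[OF assms, of a s0], of a \<gamma>] by simp
qed

end

section \<open>Blocks indexed by multi-indices\<close>

text \<open>Lexicographic comparison: totality uses the least coordinate of disagreement,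
  transitivity the smaller of two first differences. The linear order supplies the unique sorted
  list behind \<open>mlist\<close>.\<close>

lemma mless_linorder:
  "class.linorder (\<lambda>\<alpha> \<beta> :: 'd::{finite,linorder} mindex. \<alpha> = \<beta> \<or> mless \<alpha> \<beta>) mless"
proof
  have irrefl: "\<not> mless \<alpha> \<alpha>" for \<alpha> :: "'d mindex" by (simp add: mless_def)
  have trans: "mless \<alpha> \<gamma>" if "mless \<alpha> \<beta>" "mless \<beta> \<gamma>" for \<alpha> \<beta> \<gamma> :: "'d mindex"
  proof -
    obtain i j where i: "\<beta> $ i < \<alpha> $ i" "\<forall>l<i. \<alpha> $ l = \<beta> $ l"
      and j: "\<gamma> $ j < \<beta> $ j" "\<forall>l<j. \<beta> $ l = \<gamma> $ l"
      using \<open>mless \<alpha> \<beta>\<close> \<open>mless \<beta> \<gamma>\<close> by (auto simp: mless_def)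
    have "\<gamma> $ min i j < \<alpha> $ min i j"
      using i j by (cases i j rule: linorder_cases) (auto simp: min_absorb1 min_absorb2)
    moreover have "\<forall>l<min i j. \<alpha> $ l = \<gamma> $ l" using i j by simp
    ultimately show ?thesis by (auto simp: mless_def)
  qed
  have total: "mless \<alpha> \<beta> \<or> mless \<beta> \<alpha>" if "\<alpha> \<noteq> \<beta>" for \<alpha> \<beta> :: "'d mindex"
  proof -
    define D where "D = {i. \<alpha> $ i \<noteq> \<beta> $ i}"
    have D: "finite D" "D \<noteq> {}" using that by (auto simp: D_def Finite_Cartesian_Product.vec_eq_iff)
    have "\<alpha> $ Min D \<noteq> \<beta> $ Min D" using Min_in[OF D] by (simp add: D_def)
    moreover have "\<forall>l<Min D. \<alpha> $ l = \<beta> $ l"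
    proof (intro allI impI)
      fix l assume "l < Min D"
      then have "l \<notin> D" using Min_le[OF D(1), of l] leD by blast
      then show "\<alpha> $ l = \<beta> $ l" by (simp add: D_def)
    qed
    ultimately show ?thesis unfolding mless_def by (metis linorder_neqE_nat)
  qed
  fix x y z :: "'d mindex"
  show "mless x y = ((x = y \<or> mless x y) \<and> \<not> (y = x \<or> mless y x))" using irrefl trans by blast
  show "x = x \<or> mless x x" by simp
  show "x = z \<or> mless x z" if "x = y \<or> mless x y" "y = z \<or> mless y z" using trans that by blast
  show "x = y" if "x = y \<or> mless x y" "y = x \<or> mless y x" using irrefl trans that by blast
  show "(x = y \<or> mless x y) \<or> (y = x \<or> mless y x)" using total by blast
qed

lemma
  fixes k :: nat
  defines "xs \<equiv> mlist k :: 'd::{finite,linorder} mindex list"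
  shows set_mlist: "set xs = level k" and distinct_mlist: "distinct xs"
    and length_mlist: "length xs = bsize TYPE('d) k"
proof -
  interpret M: linorder "\<lambda>\<alpha> \<beta> :: 'd mindex. \<alpha> = \<beta> \<or> mless \<alpha> \<beta>" mless
    by (rule mless_linorder)
  have "\<exists>!xs. set xs = (level k :: 'd mindex set) \<and> sorted_wrt mless xs"
    using M.finite_sorted_distinct_unique[OF finite_level[of k]] by (simp add: M.strict_sorted_iff)
  then have *: "set xs = level k \<and> sorted_wrt mless xs"
    unfolding xs_def mlist_def by (rule theI')
  then show "set xs = level k" "distinct xs" by (auto simp: M.strict_sorted_iff)
  then show "length xs = bsize TYPE('d) k"
    by (simp add: bsize_def distinct_card[symmetric])
qed

lemma mlength_nth_mlist [simp]:
  "i < bsize TYPE('d::{finite,linorder}) k \<Longrightarrow> mlength (mlist k ! i :: 'd mindex) = k"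
  using nth_mem[of i "mlist k :: 'd mindex list"] by (simp add: set_mlist length_mlist)

lemma sum_mlist:
  "(\<Sum>i<bsize TYPE('d::{finite,linorder}) k. f (mlist k ! i :: 'd mindex)) = sum f (level k)"
  by (rule sum.reindex_bij_betw, rule bij_betw_nth) (simp_all add: distinct_mlist length_mlist set_mlist)

definition mpos :: "'d::{finite,linorder} mindex \<Rightarrow> nat" where
  "mpos \<alpha> = (SOME i. i < bsize TYPE('d) (mlength \<alpha>) \<and> mlist (mlength \<alpha>) ! i = \<alpha>)"

lemma
  fixes \<alpha> :: "'d::{finite,linorder} mindex"
  shows mpos_less: "mpos \<alpha> < bsize TYPE('d) (mlength \<alpha>)"
    and nth_mpos: "mlist (mlength \<alpha>) ! mpos \<alpha> = \<alpha>"
proof -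
  have "\<exists>i. i < bsize TYPE('d) (mlength \<alpha>) \<and> mlist (mlength \<alpha>) ! i = \<alpha>"
    using in_set_conv_nth[of \<alpha> "mlist (mlength \<alpha>)"] by (simp add: set_mlist length_mlist)
  from someI_ex[OF this]
  show "mpos \<alpha> < bsize TYPE('d) (mlength \<alpha>)" "mlist (mlength \<alpha>) ! mpos \<alpha> = \<alpha>"
    by (auto simp: mpos_def)
qed

lemma mpos_less' [simp]:
  "mlength \<alpha> = k \<Longrightarrow> mpos (\<alpha> :: 'd::{finite,linorder} mindex) < bsize TYPE('d) k"
  using mpos_less by auto

lemma nth_mpos' [simp]: "mlength \<alpha> = k \<Longrightarrow> mlist k ! mpos \<alpha> = \<alpha>"
  using nth_mpos by auto

lemma mpos_nth [simp]:
  assumes "i < bsize TYPE('d::{finite,linorder}) k"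
  shows "mpos (mlist k ! i :: 'd mindex) = i"
  using nth_eq_iff_index_eq[of "mlist k :: 'd mindex list" "mpos (mlist k ! i :: 'd mindex)" i] assms
  by (simp add: distinct_mlist length_mlist)

lemma mpos_eq_iff: "mlength \<alpha> = mlength \<gamma> \<Longrightarrow> mpos \<alpha> = mpos \<gamma> \<longleftrightarrow> \<alpha> = \<gamma>"
  by (metis nth_mpos)

lemma nth_mlist_eq_iff:
  "i < bsize TYPE('d::{finite,linorder}) k \<Longrightarrow> j < bsize TYPE('d) k \<Longrightarrow>
    (mlist k ! i :: 'd mindex) = mlist k ! j \<longleftrightarrow> i = j"
  by (simp add: nth_eq_iff_index_eq distinct_mlist length_mlist)

text \<open>Values of \<open>f\<close> off the levels k and l are irrelevant, so one function
  represents all blocks of a semi-infinite matrix. Matrix algebra turns into sums over levels, in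
  which the order of the list disappears.\<close>

definition blk ::
    "nat \<Rightarrow> nat \<Rightarrow> ('d::{finite,linorder} mindex \<Rightarrow> 'd mindex \<Rightarrow> real) \<Rightarrow> real mat" where
  "blk k l f = Matrix.mat (bsize TYPE('d) k) (bsize TYPE('d) l) (\<lambda>(i, j). f (mlist k ! i) (mlist l ! j))"

definition entry :: "real mat \<Rightarrow> 'd::{finite,linorder} mindex \<Rightarrow> 'd mindex \<Rightarrow> real" where
  "entry M \<alpha> \<gamma> = M $$ (mpos \<alpha>, mpos \<gamma>)"

lemma dim_blk [simp]:
  fixes f :: "'d::{finite,linorder} mindex \<Rightarrow> 'd mindex \<Rightarrow> real"
  shows "dim_row (blk k l f) = bsize TYPE('d) k" and "dim_col (blk k l f) = bsize TYPE('d) l"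
  by (simp_all add: blk_def)

lemma blk_carrier [simp]:
  fixes f :: "'d::{finite,linorder} mindex \<Rightarrow> 'd mindex \<Rightarrow> real"
  shows "blk k l f \<in> carrier_mat (bsize TYPE('d) k) (bsize TYPE('d) l)"
  by (simp add: blk_def)

lemma blk_cong:
  fixes f :: "'d::{finite,linorder} mindex \<Rightarrow> 'd mindex \<Rightarrow> real"
  assumes "\<And>\<alpha> \<gamma>. mlength \<alpha> = k \<Longrightarrow> mlength \<gamma> = l \<Longrightarrow> f \<alpha> \<gamma> = h \<alpha> \<gamma>"
  shows "blk k l f = blk k l h"
  by (rule eq_matI) (simp_all add: blk_def assms)

lemma blk_entry:
  assumes "M \<in> carrier_mat (bsize TYPE('d::{finite,linorder}) k) (bsize TYPE('d) l)"
  shows "blk k l (entry M :: 'd mindex \<Rightarrow> 'd mindex \<Rightarrow> real) = M"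
  by (rule eq_matI) (use assms in \<open>auto simp: blk_def entry_def\<close>)

lemma entry_blk: "mlength \<alpha> = k \<Longrightarrow> mlength \<gamma> = l \<Longrightarrow> entry (blk k l f) \<alpha> \<gamma> = f \<alpha> \<gamma>"
  by (simp add: blk_def entry_def)

lemma blk_mult: "blk k p f * blk p l h = blk k l (\<lambda>\<alpha> \<gamma>. \<Sum>\<delta>\<in>level p. f \<alpha> \<delta> * h \<delta> \<gamma>)"
  by (rule eq_matI)
    (simp_all add: blk_def scalar_prod_def sum_mlist[symmetric] lessThan_atLeast0)

lemma blk_minus: "blk k l f - blk k l h = blk k l (\<lambda>\<alpha> \<gamma>. f \<alpha> \<gamma> - h \<alpha> \<gamma>)"
  and blk_uminus: "- blk k l f = blk k l (\<lambda>\<alpha> \<gamma>. - f \<alpha> \<gamma>)"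
  and blk_smult: "r \<cdot>\<^sub>m blk k l f = blk k l (\<lambda>\<alpha> \<gamma>. r * f \<alpha> \<gamma>)"
  and blk_transpose: "transpose_mat (blk k l f) = blk l k (\<lambda>\<alpha> \<gamma>. f \<gamma> \<alpha>)"
  by (rule eq_matI; simp add: blk_def)+

lemma blk_zero: "0\<^sub>m (bsize TYPE('d) k) (bsize TYPE('d) l) = blk k l (\<lambda>(_ :: 'd::{finite,linorder} mindex) _. 0)"
  by (rule eq_matI) (simp_all add: blk_def)

lemma blk_one: "1\<^sub>m (bsize TYPE('d) k) = blk k k (\<lambda>(\<alpha> :: 'd::{finite,linorder} mindex) \<gamma>. of_bool (\<alpha> = \<gamma>))"
  by (rule eq_matI) (auto simp: blk_def nth_mlist_eq_iff)

lemma blk_Lam: "Lam a k l = blk k l (\<lambda>\<alpha> \<gamma>. of_bool (\<alpha> + axis a 1 = \<gamma>))"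
  by (rule eq_matI) (simp_all add: blk_def Lam_def)

definition lam :: "real ^ 'd \<Rightarrow> 'd::finite mindex \<Rightarrow> 'd mindex \<Rightarrow> real" where
  "lam n \<alpha> \<gamma> = (\<Sum>c\<in>UNIV. n $ c * of_bool (\<alpha> + axis c 1 = \<gamma>))"

lemma blk_Lam_dir: "Lam_dir n k l = blk k l (lam n)"
  by (rule eq_matI) (simp_all add: blk_def Lam_dir_def blk_Lam lam_def)

text \<open>Coordinate shifts become directional ones, so that only \<open>Lam_dir\<close> needs a
  calculus.\<close>

lemma Lam_eq_Lam_dir: "Lam a k l = Lam_dir (axis a 1) k l"
proof -
  have "lam (axis a 1) \<alpha> \<gamma> = of_bool (\<alpha> + axis a 1 = \<gamma>)" for \<alpha> \<gamma>
  proof -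
    have "lam (axis a 1) \<alpha> \<gamma> = (\<Sum>c\<in>UNIV. if c = a then of_bool (\<alpha> + axis a 1 = \<gamma>) else 0)"
      unfolding lam_def by (intro sum.cong refl) (auto simp: axis_def)
    then show ?thesis by simp
  qed
  then show ?thesis unfolding blk_Lam blk_Lam_dir by (intro blk_cong) simp
qed

lemma sum_lam:
  assumes "mlength \<alpha> = k"
  shows "(\<Sum>\<gamma>\<in>level (Suc k). lam n \<alpha> \<gamma> * f \<gamma>) = dshift n f \<alpha>"
proof -
  have "(\<Sum>\<gamma>\<in>level (Suc k). lam n \<alpha> \<gamma> * f \<gamma>) =
      (\<Sum>c\<in>UNIV. n $ c * (\<Sum>\<gamma>\<in>level (Suc k). if \<gamma> = \<alpha> + axis c 1 then f \<gamma> else 0))"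
    unfolding lam_def sum_distrib_left sum_distrib_right
    by (subst sum.swap) (auto intro!: sum.cong)
  then show ?thesis using assms by (simp add: dshift_def)
qed

lemma Lam_dir_blk:
  "Lam_dir n k (Suc k) * blk (Suc k) l f = blk k l (\<lambda>\<alpha> \<gamma>. dshift n (\<lambda>\<eta>. f \<eta> \<gamma>) \<alpha>)"
  unfolding blk_Lam_dir blk_mult by (rule blk_cong) (simp add: sum_lam)

lemma blk_Lam_dir_transpose:
  "blk p (Suc k) f * transpose_mat (Lam_dir n k (Suc k)) = blk p k (\<lambda>\<alpha> \<gamma>. dshift n (f \<alpha>) \<gamma>)"
  unfolding blk_Lam_dir blk_mult blk_transpose
  by (rule blk_cong) (simp add: sum_lam[symmetric] mult.commute)

lemma sum_below_levels:
  fixes f :: "'d::finite mindex \<Rightarrow> real"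
  shows "sum f (below k) = (\<Sum>p<k. sum f (level p))"
  by (induction k) (simp_all add: sum_below_Suc)

section \<open>Semi-infinite matrices as functions of two multi-indices\<close>

definition bentry :: "bmat \<Rightarrow> 'd::{finite,linorder} mindex \<Rightarrow> 'd mindex \<Rightarrow> real" where
  "bentry A \<alpha> \<gamma> = entry (A (mlength \<alpha>) (mlength \<gamma>)) \<alpha> \<gamma>"

text \<open>The block is chosen by the row index alone. At indices of different lengths the value
  has no meaning; \<open>bentry_bdiag\<close> masks it.\<close>

definition dentry :: "(nat \<Rightarrow> real mat) \<Rightarrow> 'd::{finite,linorder} mindex \<Rightarrow> 'd mindex \<Rightarrow> real" where
  "dentry A \<alpha> \<gamma> = entry (A (mlength \<alpha>)) \<alpha> \<gamma>"

lemma blk_bentry: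
  assumes "A k l \<in> carrier_mat (bsize TYPE('d::{finite,linorder}) k) (bsize TYPE('d) l)"
  shows "A k l = blk k l (bentry A :: 'd mindex \<Rightarrow> 'd mindex \<Rightarrow> real)"
proof -
  have "blk k l (bentry A :: 'd mindex \<Rightarrow> 'd mindex \<Rightarrow> real) = blk k l (entry (A k l) :: 'd mindex \<Rightarrow> 'd mindex \<Rightarrow> real)"
    by (rule blk_cong) (simp add: bentry_def)
  then show ?thesis using blk_entry[OF assms] by simp
qed

lemma blk_dentry:
  assumes "A k \<in> carrier_mat (bsize TYPE('d::{finite,linorder}) k) (bsize TYPE('d) k)"
  shows "A k = blk k k (dentry A :: 'd mindex \<Rightarrow> 'd mindex \<Rightarrow> real)"
proof -
  have "blk k k (dentry A :: 'd mindex \<Rightarrow> 'd mindex \<Rightarrow> real) = blk k k (entry (A k) :: 'd mindex \<Rightarrow> 'd mindex \<Rightarrow> real)"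
    by (rule blk_cong) (simp add: dentry_def)
  then show ?thesis using blk_entry[OF assms] by simp
qed

lemma bentry_bmult:
  fixes \<alpha> \<gamma> :: "'d::{finite,linorder} mindex"
  assumes "\<And>k l. A k l \<in> carrier_mat (bsize TYPE('d) k) (bsize TYPE('d) l)"
    and "\<And>k l. B k l \<in> carrier_mat (bsize TYPE('d) k) (bsize TYPE('d) l)"
  shows "bentry (bmult TYPE('d) A B) \<alpha> \<gamma> =
    (\<Sum>\<delta>\<in>below (Suc (mlength \<alpha>)). bentry A \<alpha> \<delta> * bentry B \<delta> \<gamma>)"
proof -
  have "bentry (bmult TYPE('d) A B) \<alpha> \<gamma> =
      (\<Sum>p\<le>mlength \<alpha>. entry (A (mlength \<alpha>) p * B p (mlength \<gamma>)) \<alpha> \<gamma>)"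
    by (simp add: bentry_def entry_def bmult_def)
  also have "\<dots> = (\<Sum>p\<le>mlength \<alpha>. \<Sum>\<delta>\<in>level p. bentry A \<alpha> \<delta> * bentry B \<delta> \<gamma>)"
    by (intro sum.cong refl)
      (simp add: blk_bentry[where A=A, OF assms(1)] blk_bentry[where A=B, OF assms(2)] blk_mult entry_blk)
  finally show ?thesis by (simp add: sum_below_levels lessThan_Suc_atMost)
qed

lemma bmult_carrier: "bmult TYPE('d::{finite,linorder}) A B k l \<in> carrier_mat (bsize TYPE('d) k) (bsize TYPE('d) l)"
  by (simp add: bmult_def)

text \<open>An invertible matrix is a unit of the matrix ring, and for units
  \<open>mat_inverse\<close> returns a result. The dimensions of the inverse are not part of
  \<open>invertible_mat\<close> and are recovered from the two product identities.\<close>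

lemma minv_inverse:
  assumes "A \<in> carrier_mat n n" "invertible_mat A"
  shows "minv A \<in> carrier_mat n n" "A * minv A = 1\<^sub>m n" "minv A * A = 1\<^sub>m n"
proof -
  obtain B where B: "A * B = 1\<^sub>m n" "B * A = 1\<^sub>m (dim_row B)"
    using assms by (auto simp: invertible_mat_def inverts_mat_def)
  have "dim_col (A * B) = n" by (simp add: B(1))
  then have "dim_col B = n" by simp
  moreover have "dim_col (B * A) = dim_row B" by (simp add: B(2))
  then have "dim_row B = n" using assms(1) by simp
  ultimately have "B \<in> carrier_mat n n" "B * A = 1\<^sub>m n" using B by auto
  then have "A \<in> Units (ring_mat TYPE(real) n ())"
    using assms B(1) by (auto simp: Units_def ring_mat_def)
  then obtain C where "mat_inverse A = Some C"
    using mat_inverse(1)[OF assms(1), of "()"] by (cases "mat_inverse A") auto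
  then show "minv A \<in> carrier_mat n n" "A * minv A = 1\<^sub>m n" "minv A * A = 1\<^sub>m n"
    using mat_inverse(2)[OF assms(1)] by (auto simp: minv_def)
qed

lemma bentry_moment_matrix:
  "bentry (moment_matrix \<mu> N q t m) \<alpha> \<gamma> = moment \<mu> N q t m (\<alpha> + \<gamma>)"
  by (simp add: bentry_def entry_def moment_matrix_def moment_def monomial_add)

lemma bentry_bdiag:
  fixes \<alpha> \<gamma> :: "'d::{finite,linorder} mindex"
  shows "bentry (bdiag TYPE('d) H) \<alpha> \<gamma> = of_bool (mlength \<alpha> = mlength \<gamma>) * dentry H \<alpha> \<gamma>"
  by (simp add: bentry_def bdiag_def dentry_def entry_def)

lemma bentry_bone:
  fixes \<alpha> \<gamma> :: "'d::{finite,linorder} mindex"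
  shows "bentry (bone TYPE('d)) \<alpha> \<gamma> = of_bool (\<alpha> = \<gamma>)"
  by (auto simp: bone_def bentry_bdiag dentry_def entry_def mpos_eq_iff)

text \<open>With R the inverse of \<open>S\<close>, the factorization reads S G = H R^T, which is
  block upper triangular with diagonal blocks \<open>H\<close> because R is block lower triangular
  with identity diagonal. These are the orthogonality relations; the work lies in truncating and
  exchanging the sums.\<close>

lemma block_factorization_orth_system:
  fixes \<mu> :: "'d::{finite,linorder} point measure"
  assumes "block_factorization TYPE('d) (moment_matrix \<mu> N q t m) S H"
  shows "orth_system (moment \<mu> N q t m) (bentry S) (dentry H) (dentry (\<lambda>k. minv (H k)))"
proof -
  let ?S = "bentry S :: 'd mindex \<Rightarrow> 'd mindex \<Rightarrow> real"
  let ?H = "dentry H :: 'd mindex \<Rightarrow> 'd mindex \<Rightarrow> real"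
  obtain R where unitri: "bunitri TYPE('d) S"
    and Hcar: "\<And>k. H k \<in> carrier_mat (bsize TYPE('d) k) (bsize TYPE('d) k)"
    and Hinv: "\<And>k. invertible_mat (H k)"
    and R: "blower TYPE('d) R" "bmult TYPE('d) S R = bone TYPE('d)"
    and G: "moment_matrix \<mu> N q t m =
      bmult TYPE('d) (bmult TYPE('d) R (bdiag TYPE('d) H)) (btranspose R)"
    using assms by (auto simp: block_factorization_def)
  let ?R = "bentry R :: 'd mindex \<Rightarrow> 'd mindex \<Rightarrow> real"
  have Scar: "S k l \<in> carrier_mat (bsize TYPE('d) k) (bsize TYPE('d) l)" for k l
    using unitri by (simp add: bunitri_def blower_def)
  have Rcar: "R k l \<in> carrier_mat (bsize TYPE('d) k) (bsize TYPE('d) l)" for k l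
    using R(1) by (simp add: blower_def)
  have Rtcar: "btranspose R k l \<in> carrier_mat (bsize TYPE('d) k) (bsize TYPE('d) l)" for k l
    using Rcar[of l k] by (simp add: btranspose_def)
  have Dcar: "bdiag TYPE('d) H k l \<in> carrier_mat (bsize TYPE('d) k) (bsize TYPE('d) l)" for k l
    using Hcar by (auto simp: bdiag_def)
  have S_unit: "?S \<alpha> \<gamma> = of_bool (\<alpha> = \<gamma>)" if "mlength \<alpha> \<le> mlength \<gamma>" for \<alpha> \<gamma>
  proof (cases "mlength \<alpha> = mlength \<gamma>")
    case True
    then show ?thesis using unitri by (simp add: bunitri_def bentry_def entry_def mpos_eq_iff)
  next
    case False
    then show ?thesis using unitri that
      by (auto simp: bunitri_def blower_def bentry_def entry_def)
  qed
  have R_low: "?R \<alpha> \<gamma> = 0" if "mlength \<alpha> < mlength \<gamma>" for \<alpha> \<gamma>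
    using that R(1) by (simp add: blower_def bentry_def entry_def)
  have SR: "(\<Sum>\<delta>\<in>below (Suc (mlength \<alpha>)). ?S \<alpha> \<delta> * ?R \<delta> \<gamma>) = of_bool (\<alpha> = \<gamma>)" for \<alpha> \<gamma>
    using bentry_bmult[OF Scar Rcar, of \<alpha> \<gamma>] by (simp add: R(2) bentry_bone)
  \<comment> \<open>The identity diagonal of R is not part of the factorization; it follows from S R
    = 1.\<close>
  have R_diag: "?R \<alpha> \<gamma> = of_bool (\<alpha> = \<gamma>)" if "mlength \<alpha> = mlength \<gamma>" for \<alpha> \<gamma>
  proof -
    have "(\<Sum>\<delta>\<in>below (mlength \<alpha>). ?S \<alpha> \<delta> * ?R \<delta> \<gamma>) = 0"
      using that by (intro sum.neutral) (auto simp: R_low)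
    moreover have "(\<Sum>\<delta>\<in>level (mlength \<alpha>). ?S \<alpha> \<delta> * ?R \<delta> \<gamma>) =
        (\<Sum>\<delta>\<in>level (mlength \<alpha>). if \<delta> = \<alpha> then ?R \<delta> \<gamma> else 0)"
      by (intro sum.cong refl) (simp add: S_unit)
    ultimately show ?thesis using SR[of \<alpha> \<gamma>] by (simp add: sum_below_Suc)
  qed
  \<comment> \<open>Since R is lower triangular, the sums may run up to any K beyond the length of
    \<delta>. One K common to all \<delta> makes the exchange of sums in \<open>SG\<close>
    possible.\<close>
  have G_entry: "moment \<mu> N q t m (\<delta> + \<gamma>) =
      (\<Sum>\<epsilon>\<in>below K. (\<Sum>\<zeta>\<in>below K. ?R \<delta> \<zeta> * (of_bool (mlength \<zeta> = mlength \<epsilon>) * ?H \<zeta> \<epsilon>)) * ?R \<gamma> \<epsilon>)"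
    if K: "mlength \<delta> < K" for \<delta> \<gamma> K
  proof -
    have inner: "(\<Sum>\<zeta>\<in>below K. ?R \<delta> \<zeta> * f \<zeta>) = (\<Sum>\<zeta>\<in>below (Suc (mlength \<delta>)). ?R \<delta> \<zeta> * f \<zeta>)" for f
      using K by (intro sum_below_le) (auto simp: R_low)
    have "moment \<mu> N q t m (\<delta> + \<gamma>) = bentry (moment_matrix \<mu> N q t m) \<delta> \<gamma>"
      by (simp add: bentry_moment_matrix)
    also have "\<dots> = (\<Sum>\<epsilon>\<in>below (Suc (mlength \<delta>)).
        (\<Sum>\<zeta>\<in>below (Suc (mlength \<delta>)). ?R \<delta> \<zeta> * (of_bool (mlength \<zeta> = mlength \<epsilon>) * ?H \<zeta> \<epsilon>)) * ?R \<gamma> \<epsilon>)"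
    proof -
      have "bentry (btranspose R) \<epsilon> \<gamma> = ?R \<gamma> \<epsilon>" for \<epsilon>
        using Rcar[of "mlength \<gamma>" "mlength \<epsilon>"] by (simp add: bentry_def btranspose_def entry_def)
      then show ?thesis
        by (simp add: G bentry_bmult[OF bmult_carrier Rtcar] bentry_bmult[OF Rcar Dcar] bentry_bdiag)
    qed
    also have "\<dots> = (\<Sum>\<epsilon>\<in>below K.
        (\<Sum>\<zeta>\<in>below (Suc (mlength \<delta>)). ?R \<delta> \<zeta> * (of_bool (mlength \<zeta> = mlength \<epsilon>) * ?H \<zeta> \<epsilon>)) * ?R \<gamma> \<epsilon>)"
    proof (rule sum_below_le[symmetric])
      fix \<epsilon> :: "'d mindex" assume "Suc (mlength \<delta>) \<le> mlength \<epsilon>"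
      then have "(\<Sum>\<zeta>\<in>below (Suc (mlength \<delta>)). ?R \<delta> \<zeta> * (of_bool (mlength \<zeta> = mlength \<epsilon>) * ?H \<zeta> \<epsilon>)) = 0"
        by (intro sum.neutral) auto
      then show "(\<Sum>\<zeta>\<in>below (Suc (mlength \<delta>)). ?R \<delta> \<zeta> * (of_bool (mlength \<zeta> = mlength \<epsilon>) * ?H \<zeta> \<epsilon>)) * ?R \<gamma> \<epsilon> = 0"
        by simp
    qed (use K in simp)
    finally show ?thesis by (simp only: inner)
  qed
  have SG: "(\<Sum>\<delta>\<in>below (Suc (mlength \<alpha>)). ?S \<alpha> \<delta> * moment \<mu> N q t m (\<delta> + \<gamma>)) =
      (\<Sum>\<epsilon>\<in>level (mlength \<alpha>). ?H \<alpha> \<epsilon> * ?R \<gamma> \<epsilon>)" for \<alpha> \<gamma>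
  proof -
    let ?K = "Suc (mlength \<alpha>)"
    let ?D = "\<lambda>\<zeta> \<epsilon>. of_bool (mlength \<zeta> = mlength \<epsilon>) * ?H \<zeta> \<epsilon>"
    have "(\<Sum>\<delta>\<in>below ?K. ?S \<alpha> \<delta> * moment \<mu> N q t m (\<delta> + \<gamma>)) =
        (\<Sum>\<delta>\<in>below ?K. ?S \<alpha> \<delta> * (\<Sum>\<epsilon>\<in>below ?K. (\<Sum>\<zeta>\<in>below ?K. ?R \<delta> \<zeta> * ?D \<zeta> \<epsilon>) * ?R \<gamma> \<epsilon>))"
      by (intro sum.cong refl) (simp add: G_entry[where K="?K"])
    also have "\<dots> = (\<Sum>\<epsilon>\<in>below ?K. \<Sum>\<zeta>\<in>below ?K. (\<Sum>\<delta>\<in>below ?K. ?S \<alpha> \<delta> * ?R \<delta> \<zeta>) * ?D \<zeta> \<epsilon> * ?R \<gamma> \<epsilon>)"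
      unfolding sum_distrib_left sum_distrib_right
      by (subst sum.swap, rule sum.cong[OF refl], subst sum.swap) (simp add: mult_ac)
    also have "\<dots> = (\<Sum>\<epsilon>\<in>below ?K. \<Sum>\<zeta>\<in>below ?K. if \<zeta> = \<alpha> then ?D \<zeta> \<epsilon> * ?R \<gamma> \<epsilon> else 0)"
      by (intro sum.cong refl) (auto simp: SR)
    also have "\<dots> = (\<Sum>\<epsilon>\<in>below ?K. ?D \<alpha> \<epsilon> * ?R \<gamma> \<epsilon>)" by simp
    also have "\<dots> = (\<Sum>\<epsilon>\<in>level (mlength \<alpha>). ?D \<alpha> \<epsilon> * ?R \<gamma> \<epsilon>)"
      by (rule sum.mono_neutral_right) auto
    finally show ?thesis by simp
  qed
  show ?thesis
  proof
    fix \<alpha> \<gamma> :: "'d mindex"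
    show "mlength \<alpha> \<le> mlength \<gamma> \<Longrightarrow> ?S \<alpha> \<gamma> = of_bool (\<alpha> = \<gamma>)" by (rule S_unit)
    show "(\<Sum>\<delta>\<in>below (Suc (mlength \<alpha>)). ?S \<alpha> \<delta> * moment \<mu> N q t m (\<delta> + \<gamma>)) = 0"
      if "mlength \<gamma> < mlength \<alpha>"
      unfolding SG using that by (intro sum.neutral) (auto simp: R_low)
    show "(\<Sum>\<delta>\<in>below (Suc (mlength \<alpha>)). ?S \<alpha> \<delta> * moment \<mu> N q t m (\<delta> + \<gamma>)) = ?H \<alpha> \<gamma>"
      if "mlength \<gamma> = mlength \<alpha>"
    proof -
      have "(\<Sum>\<epsilon>\<in>level (mlength \<alpha>). ?H \<alpha> \<epsilon> * ?R \<gamma> \<epsilon>) = (\<Sum>\<epsilon>\<in>level (mlength \<alpha>). if \<epsilon> = \<gamma> then ?H \<alpha> \<epsilon> else 0)"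
        using that by (intro sum.cong refl) (simp add: R_diag)
      then show ?thesis using that by (simp add: SG)
    qed
  next
    fix \<delta> \<zeta> :: "'d mindex" assume lev: "mlength \<delta> = mlength \<zeta>"
    let ?k = "mlength \<zeta>"
    have "(\<Sum>\<epsilon>\<in>level ?k. dentry (\<lambda>k. minv (H k)) \<delta> \<epsilon> * ?H \<epsilon> \<zeta>) =
        entry (blk ?k ?k (dentry (\<lambda>k. minv (H k)) :: 'd mindex \<Rightarrow> 'd mindex \<Rightarrow> real) * blk ?k ?k ?H) \<delta> \<zeta>"
      using lev by (simp add: blk_mult entry_blk)
    also have "\<dots> = entry (minv (H ?k) * H ?k) \<delta> \<zeta>"
      using blk_dentry[where A=H and k="?k", OF Hcar]
        blk_dentry[where A="\<lambda>k. minv (H k)" and k="?k", OF minv_inverse(1)[OF Hcar Hinv]] by simp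
    also have "\<dots> = of_bool (\<delta> = \<zeta>)"
      using lev by (simp add: minv_inverse(3)[OF Hcar Hinv] blk_one entry_blk)
    finally show "(\<Sum>\<epsilon>\<in>level (mlength \<delta>). dentry (\<lambda>k. minv (H k)) \<delta> \<epsilon> * ?H \<epsilon> \<zeta>) = of_bool (\<delta> = \<zeta>)"
      using lev by simp
  qed
qed

section \<open>Derivatives of matrix-valued functions\<close>

text \<open>Existence and value in one relation, with dimensions constant along the line of times,
  so that sum and product rules compose; \<open>tdifferentiable\<close> and \<open>tderiv\<close>
  are read off at the end.\<close>

definition has_tderiv ::
    "'d::finite \<Rightarrow> ('d times \<Rightarrow> real mat) \<Rightarrow> 'd times \<Rightarrow> real mat \<Rightarrow> bool" where
  "has_tderiv a F t D \<longleftrightarrow>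
     (\<forall>s. F (t(axis a 1 := s)) \<in> carrier_mat (dim_row D) (dim_col D)) \<and>
     (\<forall>i<dim_row D. \<forall>j<dim_col D.
        ((\<lambda>s. F (t(axis a 1 := s)) $$ (i, j)) has_real_derivative D $$ (i, j)) (at (t (axis a 1))))"

lemma has_tderiv_carrier:
  assumes "has_tderiv a F t D"
  shows "F t \<in> carrier_mat (dim_row D) (dim_col D)"
proof -
  have "F (t(axis a 1 := t (axis a 1))) \<in> carrier_mat (dim_row D) (dim_col D)"
    using assms unfolding has_tderiv_def by blast
  then show ?thesis by (simp only: fun_upd_triv)
qed

lemma has_tderiv_imp:
  assumes "has_tderiv a F t D"
  shows "tdifferentiable a F t" and "tderiv a F t = D"
proof -
  note F = has_tderiv_carrier[OF assms]
  show "tdifferentiable a F t"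
    using assms F unfolding tdifferentiable_def has_tderiv_def
    by (auto simp: field_differentiable_def)
  show "tderiv a F t = D"
    using assms F unfolding tderiv_def has_tderiv_def
    by (intro eq_matI) (auto simp: DERIV_imp_deriv)
qed

text \<open>Agreement is required only on the line through \<open>t\<close>. Identities for
  derivatives and inverses of \<open>H\<close> are known at admissible times only, and such a line
  stays admissible.\<close>

lemma has_tderiv_cong:
  assumes "has_tderiv a F t D" "\<And>s. F' (t(axis a 1 := s)) = F (t(axis a 1 := s))"
  shows "has_tderiv a F' t D"
  using assms by (simp add: has_tderiv_def)

lemma has_tderiv_blk:
  fixes f' :: "'d::{finite,linorder} mindex \<Rightarrow> 'd mindex \<Rightarrow> real"
  assumes "\<And>s. F (t(axis a 1 := s)) = blk k l (f s)"
    and "\<And>\<alpha> \<gamma>. mlength \<alpha> = k \<Longrightarrow> mlength \<gamma> = l \<Longrightarrow>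
      ((\<lambda>s. f s \<alpha> \<gamma>) has_real_derivative f' \<alpha> \<gamma>) (at (t (axis a 1)))"
  shows "has_tderiv a F t (blk k l f')"
  unfolding has_tderiv_def assms(1) using assms(2) by (auto simp: blk_def)

lemma has_tderiv_const: "has_tderiv a (\<lambda>_. A) t (0\<^sub>m (dim_row A) (dim_col A))"
  by (simp add: has_tderiv_def)

lemma has_tderiv_minus:
  assumes F: "has_tderiv a F t D" and G: "has_tderiv a G t E"
    and dim: "dim_row D = dim_row E" "dim_col D = dim_col E"
  shows "has_tderiv a (\<lambda>t. F t - G t) t (D - E)"
  unfolding has_tderiv_def
proof (intro conjI allI impI)
  have Fc: "F (t(axis a 1 := s)) \<in> carrier_mat (dim_row E) (dim_col E)"
    and Gc: "G (t(axis a 1 := s)) \<in> carrier_mat (dim_row E) (dim_col E)" for s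
    using F G dim unfolding has_tderiv_def by auto
  show "F (t(axis a 1 := s)) - G (t(axis a 1 := s)) \<in> carrier_mat (dim_row (D - E)) (dim_col (D - E))" for s
    using minus_carrier_mat[OF Gc[of s], of "F (t(axis a 1 := s))"] by simp
  fix i j
  assume "i < dim_row (D - E)" "j < dim_col (D - E)"
  then have ij: "i < dim_row E" "j < dim_col E" by simp_all
  have entry: "(F (t(axis a 1 := s)) - G (t(axis a 1 := s))) $$ (i, j) =
      F (t(axis a 1 := s)) $$ (i, j) - G (t(axis a 1 := s)) $$ (i, j)" for s
    using Gc[of s] ij by simp
  have "((\<lambda>s. F (t(axis a 1 := s)) $$ (i, j) - G (t(axis a 1 := s)) $$ (i, j)) has_real_derivative
      D $$ (i, j) - E $$ (i, j)) (at (t (axis a 1)))"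
    by (rule DERIV_diff) (use F G ij dim in \<open>simp_all add: has_tderiv_def\<close>)
  then show "((\<lambda>s. (F (t(axis a 1 := s)) - G (t(axis a 1 := s))) $$ (i, j)) has_real_derivative
      (D - E) $$ (i, j)) (at (t (axis a 1)))"
    unfolding entry using ij by simp
qed

lemma has_tderiv_add:
  assumes F: "has_tderiv a F t D" and G: "has_tderiv a G t E"
    and dim: "dim_row D = dim_row E" "dim_col D = dim_col E"
  shows "has_tderiv a (\<lambda>t. F t + G t) t (D + E)"
  unfolding has_tderiv_def
proof (intro conjI allI impI)
  have Fc: "F (t(axis a 1 := s)) \<in> carrier_mat (dim_row E) (dim_col E)"
    and Gc: "G (t(axis a 1 := s)) \<in> carrier_mat (dim_row E) (dim_col E)" for s
    using F G dim unfolding has_tderiv_def by auto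
  show "F (t(axis a 1 := s)) + G (t(axis a 1 := s)) \<in> carrier_mat (dim_row (D + E)) (dim_col (D + E))" for s
    using Fc[of s] Gc[of s] by simp
  fix i j
  assume "i < dim_row (D + E)" "j < dim_col (D + E)"
  then have ij: "i < dim_row E" "j < dim_col E" by simp_all
  have entry: "(F (t(axis a 1 := s)) + G (t(axis a 1 := s))) $$ (i, j) =
      F (t(axis a 1 := s)) $$ (i, j) + G (t(axis a 1 := s)) $$ (i, j)" for s
    using Gc[of s] ij by simp
  have "((\<lambda>s. F (t(axis a 1 := s)) $$ (i, j) + G (t(axis a 1 := s)) $$ (i, j)) has_real_derivative
      D $$ (i, j) + E $$ (i, j)) (at (t (axis a 1)))"
    by (rule DERIV_add) (use F G ij dim in \<open>simp_all add: has_tderiv_def\<close>)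
  then show "((\<lambda>s. (F (t(axis a 1 := s)) + G (t(axis a 1 := s))) $$ (i, j)) has_real_derivative
      (D + E) $$ (i, j)) (at (t (axis a 1)))"
    unfolding entry using ij by simp
qed

lemma has_tderiv_mult:
  assumes F: "has_tderiv a F t D" and G: "has_tderiv a G t E" and dim: "dim_col D = dim_row E"
  shows "has_tderiv a (\<lambda>t. F t * G t) t (D * G t + F t * E)"
proof -
  let ?s0 = "t (axis a 1)"
  have Fc: "F (t(axis a 1 := s)) \<in> carrier_mat (dim_row D) (dim_row E)"
    and Gc: "G (t(axis a 1 := s)) \<in> carrier_mat (dim_row E) (dim_col E)" for s
    using F G dim unfolding has_tderiv_def by auto
  have t: "t(axis a 1 := ?s0) = t" by simp
  note Ft = Fc[of ?s0, unfolded t] and Gt = Gc[of ?s0, unfolded t]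
  show ?thesis
    unfolding has_tderiv_def
  proof (intro conjI allI impI)
    fix s show "F (t(axis a 1 := s)) * G (t(axis a 1 := s)) \<in>
        carrier_mat (dim_row (D * G t + F t * E)) (dim_col (D * G t + F t * E))"
      using mult_carrier_mat[OF Fc Gc] Ft by simp
  next
    fix i j
    assume "i < dim_row (D * G t + F t * E)" "j < dim_col (D * G t + F t * E)"
    then have i: "i < dim_row D" and j: "j < dim_col E" using Ft by simp_all
    have entry: "(F (t(axis a 1 := s)) * G (t(axis a 1 := s))) $$ (i, j) =
        (\<Sum>l<dim_row E. F (t(axis a 1 := s)) $$ (i, l) * G (t(axis a 1 := s)) $$ (l, j))" for s
      using Fc[of s] Gc[of s] i j by (simp add: scalar_prod_def lessThan_atLeast0)
    have der: "(D * G t + F t * E) $$ (i, j) =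
        (\<Sum>l<dim_row E. D $$ (i, l) * G t $$ (l, j) + E $$ (l, j) * F t $$ (i, l))"
      using Ft Gt i j dim by (simp add: scalar_prod_def lessThan_atLeast0 sum.distrib mult.commute)
    have "((\<lambda>s. \<Sum>l<dim_row E. F (t(axis a 1 := s)) $$ (i, l) * G (t(axis a 1 := s)) $$ (l, j))
        has_real_derivative (\<Sum>l<dim_row E. D $$ (i, l) * G (t(axis a 1 := ?s0)) $$ (l, j)
          + E $$ (l, j) * F (t(axis a 1 := ?s0)) $$ (i, l))) (at ?s0)"
      by (intro DERIV_sum DERIV_mult) (use F G i j dim in \<open>auto simp: has_tderiv_def\<close>)
    then show "((\<lambda>s. (F (t(axis a 1 := s)) * G (t(axis a 1 := s))) $$ (i, j))
        has_real_derivative (D * G t + F t * E) $$ (i, j)) (at ?s0)"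
      unfolding entry der t .
  qed
qed

lemma has_tderiv_mult_const:
  assumes "has_tderiv a F t D" "dim_col D = dim_row A"
  shows "has_tderiv a (\<lambda>t. F t * A) t (D * A)"
proof -
  have "D * A + F t * 0\<^sub>m (dim_row A) (dim_col A) = D * A"
    using has_tderiv_carrier[OF assms(1)] assms(2) by (intro eq_matI) auto
  then show ?thesis using has_tderiv_mult[OF assms(1) has_tderiv_const[of a A]] assms(2) by simp
qed

lemma has_tderiv_const_mult:
  assumes "has_tderiv a F t D" "dim_row D = dim_col A"
  shows "has_tderiv a (\<lambda>t. A * F t) t (A * D)"
proof -
  have "0\<^sub>m (dim_row A) (dim_col A) * F t + A * D = A * D"
    using has_tderiv_carrier[OF assms(1)] assms(2) by (intro eq_matI) auto
  then show ?thesis using has_tderiv_mult[OF has_tderiv_const[of a A] assms(1)] assms(2) by simp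
qed

lemma mat_mult_assoc:
  "dim_col A = dim_row B \<Longrightarrow> dim_col B = dim_row C \<Longrightarrow> A * B * C = A * (B * C)"
  for A B C :: "real mat"
  by (rule assoc_mult_mat[of _ "dim_row A" "dim_col A" _ "dim_col B" _ "dim_col C"]) auto

lemma dim_Lam [simp]:
  fixes a :: "'d::{finite,linorder}"
  shows "dim_row (Lam a k l) = bsize TYPE('d) k" "dim_col (Lam a k l) = bsize TYPE('d) l"
  by (simp_all add: Lam_def)

lemma dim_Lam_dir [simp]:
  fixes n :: "'d::{finite,linorder} point"
  shows "dim_row (Lam_dir n k l) = bsize TYPE('d) k" "dim_col (Lam_dir n k l) = bsize TYPE('d) l"
  by (simp_all add: Lam_dir_def)

text \<open>Moves n \<cdot> \<Lambda> from the first factor to the second. The right side has the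
  entrywise form in which the derivative and the shift of \<open>H\<close> were computed.\<close>

lemma blk_lam_mult:
  "blk k k (\<lambda>\<alpha> \<zeta>. (\<Sum>\<delta>\<in>plevel k. f \<alpha> \<delta> * lam n \<delta> \<zeta>) - e \<alpha> \<zeta>) * blk k k h =
   blk k k (\<lambda>\<alpha> \<gamma>. (\<Sum>\<delta>\<in>plevel k. f \<alpha> \<delta> * dshift n (\<lambda>\<zeta>. h \<zeta> \<gamma>) \<delta>) - (\<Sum>\<zeta>\<in>level k. e \<alpha> \<zeta> * h \<zeta> \<gamma>))"
  unfolding blk_mult
proof (rule blk_cong)
  fix \<alpha> \<gamma> :: "'a mindex"
  have "(\<Sum>\<zeta>\<in>level k. (\<Sum>\<delta>\<in>plevel k. f \<alpha> \<delta> * lam n \<delta> \<zeta>) * h \<zeta> \<gamma>) =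
      (\<Sum>\<delta>\<in>plevel k. f \<alpha> \<delta> * (\<Sum>\<zeta>\<in>level k. lam n \<delta> \<zeta> * h \<zeta> \<gamma>))"
    unfolding sum_distrib_left sum_distrib_right by (subst sum.swap) (simp add: mult_ac)
  also have "\<dots> = (\<Sum>\<delta>\<in>plevel k. f \<alpha> \<delta> * dshift n (\<lambda>\<zeta>. h \<zeta> \<gamma>) \<delta>)"
    by (intro sum.cong refl) (auto simp: sum_lam)
  finally show "(\<Sum>\<zeta>\<in>level k. ((\<Sum>\<delta>\<in>plevel k. f \<alpha> \<delta> * lam n \<delta> \<zeta>) - e \<alpha> \<zeta>) * h \<zeta> \<gamma>) =
      (\<Sum>\<delta>\<in>plevel k. f \<alpha> \<delta> * dshift n (\<lambda>\<zeta>. h \<zeta> \<gamma>) \<delta>) - (\<Sum>\<zeta>\<in>level k. e \<alpha> \<zeta> * h \<zeta> \<gamma>)"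
    by (simp add: left_diff_distrib sum_subtractf)
qed

section \<open>The Toda equations\<close>

locale toda = flow \<mu> N q
  for \<mu> :: "'d::{finite,linorder} point measure" and N :: "'d coeffs" and q :: "'d point" +
  fixes S :: "'d times \<Rightarrow> 'd ishift \<Rightarrow> nat \<Rightarrow> nat \<Rightarrow> real mat"
    and H :: "'d times \<Rightarrow> 'd ishift \<Rightarrow> nat \<Rightarrow> real mat"
    and \<beta> :: "'d times \<Rightarrow> 'd ishift \<Rightarrow> nat \<Rightarrow> real mat"
  assumes factorization: "\<And>t m. admissible \<mu> N q t m \<Longrightarrow>
      block_factorization TYPE('d) (moment_matrix \<mu> N q t m) (S t m) (H t m)"
    and beta: "\<And>t m k. k \<ge> 1 \<Longrightarrow> \<beta> t m k = S t m k (k - 1)"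
begin

section \<open>The given blocks as an orthogonal system\<close>

abbreviation adm :: "'d times \<Rightarrow> 'd ishift \<Rightarrow> bool" where
  "adm \<equiv> admissible \<mu> N q"

definition Sb :: "'d times \<Rightarrow> 'd ishift \<Rightarrow> 'd mindex \<Rightarrow> 'd mindex \<Rightarrow> real" where
  "Sb t m = bentry (S t m)"

definition Hb :: "'d times \<Rightarrow> 'd ishift \<Rightarrow> 'd mindex \<Rightarrow> 'd mindex \<Rightarrow> real" where
  "Hb t m = dentry (H t m)"

definition Hib :: "'d times \<Rightarrow> 'd ishift \<Rightarrow> 'd mindex \<Rightarrow> 'd mindex \<Rightarrow> real" where
  "Hib t m = dentry (\<lambda>k. minv (H t m k))"

lemma orth_system:
  assumes "adm t m"
  shows "orth_system (moment \<mu> N q t m) (Sb t m) (Hb t m) (Hib t m)"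
  unfolding Sb_def Hb_def Hib_def
  by (rule block_factorization_orth_system[OF factorization[OF assms]])

context
  fixes t m
  assumes adm: "adm t m"
begin

lemma S_carrier: "S t m k l \<in> carrier_mat (bsize TYPE('d) k) (bsize TYPE('d) l)"
  and S_diag: "S t m k k = 1\<^sub>m (bsize TYPE('d) k)"
  and H_carrier: "H t m k \<in> carrier_mat (bsize TYPE('d) k) (bsize TYPE('d) k)"
  and H_invertible: "invertible_mat (H t m k)"
  using factorization[OF adm] by (auto simp: block_factorization_def bunitri_def blower_def)

lemmas minv_H = minv_inverse[OF H_carrier H_invertible]

lemma S_blk: "S t m k l = blk k l (Sb t m)"
  unfolding Sb_def by (rule blk_bentry[OF S_carrier])

lemma beta_blk: "\<beta> t m (Suc k) = blk (Suc k) k (Sb t m)"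
  by (simp add: beta S_blk)

lemma H_blk: "H t m k = blk k k (Hb t m)"
  unfolding Hb_def by (rule blk_dentry[OF H_carrier])

lemma minv_H_blk: "minv (H t m k) = blk k k (Hib t m)"
  unfolding Hib_def using blk_dentry[where A="\<lambda>k. minv (H t m k)", OF minv_H(1)] .

lemma dims:
  "dim_row (S t m k l) = bsize TYPE('d) k" "dim_col (S t m k l) = bsize TYPE('d) l"
  "dim_row (H t m k) = bsize TYPE('d) k" "dim_col (H t m k) = bsize TYPE('d) k"
  "dim_row (minv (H t m k)) = bsize TYPE('d) k" "dim_col (minv (H t m k)) = bsize TYPE('d) k"
  "dim_row (\<beta> t m (Suc k)) = bsize TYPE('d) (Suc k)" "dim_col (\<beta> t m (Suc k)) = bsize TYPE('d) k"
  using S_carrier[of k l] H_carrier[of k] minv_H(1)[of k] by (auto simp: beta_blk)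

end

text \<open>The diagonal blocks of \<open>S' (n \<cdot> \<Lambda>) S\<^sup>-\<^sup>1\<close>, where \<open>S'\<close> and \<open>S\<close> belong to \<open>m'\<close> and \<open>m\<close>.\<close>

definition diagonal :: "'d point \<Rightarrow> 'd times \<Rightarrow> 'd ishift \<Rightarrow> 'd ishift \<Rightarrow> nat \<Rightarrow> real mat" where
  "diagonal n t m' m k =
     (if k = 0 then 0\<^sub>m (bsize TYPE('d) k) (bsize TYPE('d) k) else \<beta> t m' k * Lam_dir n (k - 1) k)
     - Lam_dir n k (Suc k) * \<beta> t m (Suc k)"

text \<open>For m = m' this is the block below the diagonal of S (n \<cdot> \<Lambda>) S^(-1), by
  symmetry of S (n \<cdot> \<Lambda>) G S^T. For m' = m + e_b and n = n_b it is the block in the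
  same place of S(m) S(m')^(-1).\<close>

definition subdiagonal :: "'d point \<Rightarrow> 'd times \<Rightarrow> 'd ishift \<Rightarrow> 'd ishift \<Rightarrow> nat \<Rightarrow> real mat" where
  "subdiagonal n t m m' k =
     H t m (Suc k) * transpose_mat (Lam_dir n k (Suc k)) * minv (H t m' k)"

lemma diagonal_blk:
  assumes "adm t m'" "adm t m"
  shows "diagonal n t m' m k = blk k k
    (\<lambda>\<alpha> \<zeta>. (\<Sum>\<delta>\<in>plevel k. Sb t m' \<alpha> \<delta> * lam n \<delta> \<zeta>) - dshift n (\<lambda>\<eta>. Sb t m \<eta> \<zeta>) \<alpha>)"
  unfolding diagonal_def using assms
  by (cases k) (simp_all add: beta_blk Lam_dir_blk blk_zero blk_minus, simp add: blk_Lam_dir blk_mult blk_minus)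

lemma subdiagonal_blk:
  assumes "adm t m" "adm t m'"
  shows "subdiagonal n t m m' k =
    blk (Suc k) k (\<lambda>\<alpha> \<gamma>. \<Sum>\<delta>\<in>level k. dshift n (Hb t m \<alpha>) \<delta> * Hib t m' \<delta> \<gamma>)"
  unfolding subdiagonal_def minv_H_blk[OF assms(2)] H_blk[OF assms(1)] blk_Lam_dir_transpose blk_mult ..

lemma dim_diagonal:
  assumes "adm t m'" "adm t m"
  shows "dim_row (diagonal n t m' m k) = bsize TYPE('d) k" "dim_col (diagonal n t m' m k) = bsize TYPE('d) k"
  by (simp_all add: diagonal_blk[OF assms])

lemma dim_subdiagonal:
  assumes "adm t m" "adm t m'"
  shows "dim_row (subdiagonal n t m m' k) = bsize TYPE('d) (Suc k)" "dim_col (subdiagonal n t m m' k) = bsize TYPE('d) k"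
  by (simp_all add: subdiagonal_blk[OF assms])

text \<open>In matrix form the derivative of S is minus the strictly lower part of S \<Lambda>_a
  S^(-1), a single block diagonal, times S. The column l = p gives \<beta>; the column l = p - 1
  enters the second order equation.\<close>

lemma has_tderiv_S:
  assumes adm: "adm t m" and l: "l \<le> p"
  shows "has_tderiv a (\<lambda>t. S t m (Suc p) l) t (- (subdiagonal (axis a 1) t m m p * S t m p l))"
proof -
  let ?t = "\<lambda>s. t(axis a 1 := s)" and ?s0 = "t (axis a 1)" and ?n = "axis a 1 :: 'd point"
  have t: "?t ?s0 = t" by simp
  have adm': "adm (?t s) m" for s by (rule admissible_update[OF adm])
  note der = orth_system_derivative(1)[where n="?n" and ?s0.0="?s0" and
      g="\<lambda>s. moment \<mu> N q (?t s) m" and S="\<lambda>s. Sb (?t s) m" and H="\<lambda>s. Hb (?t s) m" and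
      Hi="\<lambda>s. Hib (?t s) m", OF orth_system[OF adm'] moment_derivative[OF adm], unfolded t]
  have "has_tderiv a (\<lambda>t. S t m (Suc p) l) t (blk (Suc p) l
      (\<lambda>\<alpha> \<gamma>. - (\<Sum>\<delta>\<in>level p. \<Sum>\<epsilon>\<in>level p. dshift ?n (Hb t m \<alpha>) \<delta> * Hib t m \<delta> \<epsilon> * Sb t m \<epsilon> \<gamma>)))"
  proof (rule has_tderiv_blk)
    fix \<alpha> \<gamma> :: "'d mindex" assume "mlength \<alpha> = Suc p" "mlength \<gamma> = l"
    then show "((\<lambda>s. Sb (?t s) m \<alpha> \<gamma>) has_real_derivative
        - (\<Sum>\<delta>\<in>level p. \<Sum>\<epsilon>\<in>level p. dshift ?n (Hb t m \<alpha>) \<delta> * Hib t m \<delta> \<epsilon> * Sb t m \<epsilon> \<gamma>)) (at ?s0)"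
      using der[of \<gamma> \<alpha>] l by simp
  qed (rule S_blk[OF adm'])
  also have "blk (Suc p) l
      (\<lambda>\<alpha> \<gamma>. - (\<Sum>\<delta>\<in>level p. \<Sum>\<epsilon>\<in>level p. dshift ?n (Hb t m \<alpha>) \<delta> * Hib t m \<delta> \<epsilon> * Sb t m \<epsilon> \<gamma>)) =
      - (subdiagonal ?n t m m p * S t m p l)"
    unfolding subdiagonal_blk[OF adm adm] S_blk[OF adm] blk_mult blk_uminus sum_distrib_right
    by (rule blk_cong) (simp, rule sum.swap)
  finally show ?thesis .
qed

lemma has_tderiv_beta:
  assumes adm: "adm t m"
  shows "has_tderiv a (\<lambda>t. \<beta> t m (Suc p)) t (- subdiagonal (axis a 1) t m m p)"
proof -
  have "subdiagonal (axis a 1) t m m p * S t m p p = subdiagonal (axis a 1) t m m p"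
    unfolding S_diag[OF adm] by (rule right_mult_one_mat') (simp add: dim_subdiagonal adm)
  then show ?thesis using has_tderiv_S[OF adm order_refl, of a p] by (simp add: beta)
qed

lemma has_tderiv_H:
  assumes adm: "adm t m"
  shows "has_tderiv a (\<lambda>t. H t m k) t (diagonal (axis a 1) t m m k * H t m k)"
proof -
  let ?t = "\<lambda>s. t(axis a 1 := s)" and ?s0 = "t (axis a 1)" and ?n = "axis a 1 :: 'd point"
  have t: "?t ?s0 = t" by simp
  have adm': "adm (?t s) m" for s by (rule admissible_update[OF adm])
  note der = orth_system_derivative(2)[where n="?n" and ?s0.0="?s0" and
      g="\<lambda>s. moment \<mu> N q (?t s) m" and S="\<lambda>s. Sb (?t s) m" and H="\<lambda>s. Hb (?t s) m" and
      Hi="\<lambda>s. Hib (?t s) m", OF orth_system[OF adm'] moment_derivative[OF adm], unfolded t]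
  show ?thesis
    unfolding diagonal_blk[OF adm adm] H_blk[OF adm] blk_lam_mult
  proof (rule has_tderiv_blk)
    fix \<alpha> \<gamma> :: "'d mindex" assume "mlength \<alpha> = k" "mlength \<gamma> = k"
    then show "((\<lambda>s. Hb (?t s) m \<alpha> \<gamma>) has_real_derivative
        (\<Sum>\<delta>\<in>plevel k. Sb t m \<alpha> \<delta> * dshift ?n (\<lambda>\<zeta>. Hb t m \<zeta> \<gamma>) \<delta>)
        - (\<Sum>\<zeta>\<in>level k. dshift ?n (\<lambda>\<eta>. Sb t m \<eta> \<zeta>) \<alpha> * Hb t m \<zeta> \<gamma>)) (at ?s0)"
      using der[of \<gamma> \<alpha>] by simp
  qed (rule H_blk[OF adm'])
qed

text \<open>On the level just below the leading one, the shifted polynomials in the difference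
  formula contribute only their leading coefficients.\<close>

lemma beta_difference:
  assumes adm: "adm t m"
  shows "\<beta> t m (Suc p) - \<beta> t (m + axis b 1) (Suc p) = subdiagonal (N $ b) t m (m + axis b 1) p"
proof -
  note adm' = admissible_shift[OF adm, of b]
  note P' = orth_system[OF adm']
  note diff = orth_system_difference(1)[OF orth_system[OF adm] P' moment_shift[OF adm]]
  show ?thesis
    unfolding beta_blk[OF adm] beta_blk[OF adm'] subdiagonal_blk[OF adm adm'] blk_minus
  proof (rule blk_cong)
    fix \<alpha> \<gamma> :: "'d mindex" assume lev: "mlength \<alpha> = Suc p" "mlength \<gamma> = p"
    have "(\<Sum>\<epsilon>\<in>level p. dshift (N $ b) (Hb t m \<alpha>) \<delta> * Hib t (m + axis b 1) \<delta> \<epsilon> * Sb t (m + axis b 1) \<epsilon> \<gamma>)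
        = (\<Sum>\<epsilon>\<in>level p. if \<epsilon> = \<gamma> then dshift (N $ b) (Hb t m \<alpha>) \<delta> * Hib t (m + axis b 1) \<delta> \<epsilon> else 0)" for \<delta>
      using lev by (intro sum.cong refl) (simp add: orth_system.S_unit[OF P'])
    then show "Sb t m \<alpha> \<gamma> - Sb t (m + axis b 1) \<alpha> \<gamma> =
        (\<Sum>\<delta>\<in>level p. dshift (N $ b) (Hb t m \<alpha>) \<delta> * Hib t (m + axis b 1) \<delta> \<gamma>)"
      using diff[of \<gamma> \<alpha>] lev by simp
  qed
qed

text \<open>The summand with \<open>q $ b\<close> is the constant part of the factor n_b \<bullet> x
  - q_b. Divided by \<open>H\<close> it becomes a constant matrix, which time derivatives do not
  see.\<close>

lemma H_shift:
  assumes adm: "adm t m"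
  shows "H t (m + axis b 1) k = diagonal (N $ b) t (m + axis b 1) m k * H t m k - q $ b \<cdot>\<^sub>m H t m k"
proof -
  note adm' = admissible_shift[OF adm, of b]
  note diff = orth_system_difference(2)[OF orth_system[OF adm] orth_system[OF adm'] moment_shift[OF adm]]
  show ?thesis
    unfolding diagonal_blk[OF adm' adm] H_blk[OF adm] H_blk[OF adm'] blk_lam_mult blk_smult blk_minus
    by (rule blk_cong) (use diff in simp)
qed

text \<open>The block (p + 1, p) of J S = S (n \<cdot> \<Lambda>), where J = S (n \<cdot> \<Lambda>)
  S^(-1) has three block diagonals. It trades the inverse of \<open>H\<close> in the derivative of
  \<beta> for blocks of \<open>S\<close>, ready to be differentiated again.\<close>

lemma subdiagonal_recurrence:
  assumes adm: "adm t m"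
  shows "subdiagonal n t m m p =
    (if p = 0 then 0\<^sub>m (bsize TYPE('d) (Suc p)) (bsize TYPE('d) p) else S t m (Suc p) (p - 1) * Lam_dir n (p - 1) p)
    - Lam_dir n (Suc p) (Suc (Suc p)) * S t m (Suc (Suc p)) p
    - diagonal n t m m (Suc p) * \<beta> t m (Suc p)"
proof -
  note rec = orth_system.recurrence[OF orth_system[OF adm], of _ _ n, folded lam_def]
  have *: "(if p = 0 then 0\<^sub>m (bsize TYPE('d) (Suc p)) (bsize TYPE('d) p) else S t m (Suc p) (p - 1) * Lam_dir n (p - 1) p) =
      blk (Suc p) p (\<lambda>\<alpha> \<gamma>. \<Sum>\<delta>\<in>plevel p. Sb t m \<alpha> \<delta> * lam n \<delta> \<gamma>)"
    using adm by (cases p) (simp_all add: blk_zero S_blk blk_Lam_dir blk_mult)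
  show ?thesis
    unfolding *
    unfolding subdiagonal_blk[OF adm adm] diagonal_blk[OF adm adm] beta_blk[OF adm] S_blk[OF adm]
      Lam_dir_blk blk_mult blk_minus
  proof (rule blk_cong)
    fix \<alpha> \<gamma> :: "'d mindex" assume lev: "mlength \<alpha> = Suc p" "mlength \<gamma> = p"
    have "(\<Sum>\<zeta>\<in>level (Suc p). ((\<Sum>\<delta>\<in>plevel (mlength \<zeta>). Sb t m \<alpha> \<delta> * lam n \<delta> \<zeta>) - dshift n (\<lambda>\<eta>. Sb t m \<eta> \<zeta>) \<alpha>) * Sb t m \<zeta> \<gamma>)
      = (\<Sum>\<zeta>\<in>level (Suc p). ((\<Sum>\<delta>\<in>plevel (Suc p). Sb t m \<alpha> \<delta> * lam n \<delta> \<zeta>) - dshift n (\<lambda>\<eta>. Sb t m \<eta> \<zeta>) \<alpha>) * Sb t m \<zeta> \<gamma>)"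
      by (intro sum.cong refl) simp
    then show "(\<Sum>\<delta>\<in>level p. dshift n (Hb t m \<alpha>) \<delta> * Hib t m \<delta> \<gamma>) =
        (\<Sum>\<delta>\<in>plevel p. Sb t m \<alpha> \<delta> * lam n \<delta> \<gamma>) - dshift n (\<lambda>\<eta>. Sb t m \<eta> \<gamma>) \<alpha> -
        (\<Sum>\<zeta>\<in>level (Suc p). ((\<Sum>\<delta>\<in>plevel (Suc p). Sb t m \<alpha> \<delta> * lam n \<delta> \<zeta>) - dshift n (\<lambda>\<eta>. Sb t m \<eta> \<zeta>) \<alpha>) * Sb t m \<zeta> \<gamma>)"
      using rec[of \<gamma> \<alpha>] lev by simp
  qed
qed

text \<open>\<open>diagonal\<close> is linear in the two \<beta> blocks, and their derivatives are
  minus subdiagonal blocks, whence the reversed order of the two terms. The choice m' = m serves the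
  Toda equation, m' = m + e_b the time derivative of the difference quotient of
  \<open>H\<close>.\<close>

lemma has_tderiv_diagonal:
  assumes adm: "adm t m" "adm t m'"
  shows "has_tderiv a (\<lambda>t. diagonal n t m' m k) t
    (Lam_dir n k (Suc k) * subdiagonal (axis a 1) t m m k
      - (if k = 0 then 0\<^sub>m (bsize TYPE('d) k) (bsize TYPE('d) k)
         else subdiagonal (axis a 1) t m' m' (k - 1) * Lam_dir n (k - 1) k))"
proof -
  let ?n = "axis a 1 :: 'd point"
  note dim = dim_subdiagonal[OF adm(1) adm(1)] dim_subdiagonal[OF adm(2) adm(2)]
  have 1: "has_tderiv a (\<lambda>t. Lam_dir n k (Suc k) * \<beta> t m (Suc k)) t
      (Lam_dir n k (Suc k) * (- subdiagonal ?n t m m k))"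
    by (rule has_tderiv_const_mult[OF has_tderiv_beta[OF adm(1)]]) (simp add: dim)
  have 2: "Lam_dir n k (Suc k) * (- subdiagonal ?n t m m k) = - (Lam_dir n k (Suc k) * subdiagonal ?n t m m k)"
    by (rule uminus_mult_right_mat) (simp add: dim)
  show ?thesis
  proof (cases k)
    case 0
    have "has_tderiv a (\<lambda>t. diagonal n t m' m k) t
        (0\<^sub>m (bsize TYPE('d) k) (bsize TYPE('d) k) - Lam_dir n k (Suc k) * (- subdiagonal ?n t m m k))"
      unfolding diagonal_def using has_tderiv_minus[OF has_tderiv_const[of a "0\<^sub>m (bsize TYPE('d) k) (bsize TYPE('d) k)"] 1] 0
      by (simp add: dim)
    also have "0\<^sub>m (bsize TYPE('d) k) (bsize TYPE('d) k) - Lam_dir n k (Suc k) * (- subdiagonal ?n t m m k) =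
        Lam_dir n k (Suc k) * subdiagonal ?n t m m k - 0\<^sub>m (bsize TYPE('d) k) (bsize TYPE('d) k)"
      unfolding 2 by (rule eq_matI) (simp_all add: dim)
    finally show ?thesis using 0 by simp
  next
    case (Suc p)
    have "has_tderiv a (\<lambda>t. \<beta> t m' k * Lam_dir n p k) t ((- subdiagonal ?n t m' m' p) * Lam_dir n p k)"
      unfolding Suc by (rule has_tderiv_mult_const[OF has_tderiv_beta[OF adm(2)]]) (simp add: dim)
    from has_tderiv_minus[OF this 1]
    have "has_tderiv a (\<lambda>t. diagonal n t m' m k) t
        ((- subdiagonal ?n t m' m' p) * Lam_dir n p k - Lam_dir n k (Suc k) * (- subdiagonal ?n t m m k))"
      unfolding diagonal_def using Suc by (simp add: dim)
    also have "(- subdiagonal ?n t m' m' p) * Lam_dir n p k = - (subdiagonal ?n t m' m' p * Lam_dir n p k)"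
      by (rule uminus_mult_left_mat) (simp add: dim)
    also have "- (subdiagonal ?n t m' m' p * Lam_dir n p k) - Lam_dir n k (Suc k) * (- subdiagonal ?n t m m k) =
        Lam_dir n k (Suc k) * subdiagonal ?n t m m k - subdiagonal ?n t m' m' p * Lam_dir n p k"
      unfolding 2 by (rule eq_matI) (simp_all add: dim Suc)
    finally show ?thesis using Suc by simp
  qed
qed

section \<open>The equations for \<open>H\<close> and the second order equation for \<beta>\<close>

lemma mult_H_minv_H:
  assumes "adm t m" "dim_col A = bsize TYPE('d) k"
  shows "A * H t m k * minv (H t m k) = A"
  using assms minv_H(2)[OF assms(1), of k]
  by (simp add: mat_mult_assoc dims right_mult_one_mat')

lemma H_tderiv_minv_H:
  assumes "adm t m"
  shows "tderiv a (\<lambda>t. H t m k) t * minv (H t m k) = diagonal (axis a 1) t m m k"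
  unfolding has_tderiv_imp(2)[OF has_tderiv_H[OF assms]]
  using assms by (intro mult_H_minv_H) (simp_all add: dim_diagonal)

text \<open>The logarithmic derivative of \<open>H\<close> equals \<open>diagonal\<close> on the
  whole line of times through \<open>t\<close>, hence may be replaced by it before differentiating
  in direction b.\<close>

lemma toda_H:
  assumes "adm t m"
  shows "has_tderiv b (\<lambda>t. tderiv a (\<lambda>t. H t m k) t * minv (H t m k)) t
    (Lam a k (k + 1) * H t m (k + 1) * transpose_mat (Lam b k (k + 1)) * minv (H t m k)
     - (if k = 0 then 0\<^sub>m (bsize TYPE('d) k) (bsize TYPE('d) k)
        else H t m k * transpose_mat (Lam b (k - 1) k) * minv (H t m (k - 1)) * Lam a (k - 1) k))"
proof (rule has_tderiv_cong)
  show "has_tderiv b (\<lambda>t. diagonal (axis a 1) t m m k) t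
    (Lam a k (k + 1) * H t m (k + 1) * transpose_mat (Lam b k (k + 1)) * minv (H t m k)
     - (if k = 0 then 0\<^sub>m (bsize TYPE('d) k) (bsize TYPE('d) k)
        else H t m k * transpose_mat (Lam b (k - 1) k) * minv (H t m (k - 1)) * Lam a (k - 1) k))"
    using has_tderiv_diagonal[OF assms assms, of b "axis a 1" k]
    by (cases k) (simp_all add: subdiagonal_def Lam_eq_Lam_dir mat_mult_assoc dims assms)
  show "tderiv a (\<lambda>t. H t m k) (t(axis b 1 := s)) * minv (H (t(axis b 1 := s)) m k) =
      diagonal (axis a 1) (t(axis b 1 := s)) m m k" for s
    by (rule H_tderiv_minv_H[OF admissible_update[OF assms]])
qed

text \<open>The logarithmic derivatives at m and m + e_b are both \<open>diagonal\<close> blocks, so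
  their difference contains only differences of \<beta>, which \<open>beta_difference\<close>
  evaluates.\<close>

lemma toda_H_difference:
  assumes adm: "adm t m"
  shows "Tdiff b (\<lambda>m. tderiv a (\<lambda>t. H t m k) t * minv (H t m k)) m =
    Lam a k (k + 1) * H t m (k + 1) * transpose_mat (Lam_dir (N $ b) k (k + 1))
      * minv (Tshift b (\<lambda>m. H t m k) m)
    - (if k = 0 then 0\<^sub>m (bsize TYPE('d) k) (bsize TYPE('d) k)
       else H t m k * transpose_mat (Lam_dir (N $ b) (k - 1) k)
         * minv (Tshift b (\<lambda>m. H t m (k - 1)) m) * Lam a (k - 1) k)"
proof -
  note adm' = admissible_shift[OF adm, of b]
  let ?m = "m + axis b 1" and ?n = "axis a 1 :: 'd point"
  let ?L = "Lam_dir ?n k (Suc k)"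
  have 1: "?L * \<beta> t m (Suc k) - ?L * \<beta> t ?m (Suc k) = ?L * subdiagonal (N $ b) t m ?m k"
    unfolding beta_difference[OF adm, symmetric]
    by (rule mult_minus_distrib_mat[symmetric, of _ "bsize TYPE('d) k" "bsize TYPE('d) (Suc k)" _ "bsize TYPE('d) k"])
      (auto simp: dims adm adm')
  have "Tdiff b (\<lambda>m. tderiv a (\<lambda>t. H t m k) t * minv (H t m k)) m =
      diagonal ?n t ?m ?m k - diagonal ?n t m m k"
    by (simp add: Tdiff_def Tshift_def H_tderiv_minv_H adm adm' del: One_nat_def)
  also have "\<dots> = ?L * subdiagonal (N $ b) t m ?m k - (if k = 0 then 0\<^sub>m (bsize TYPE('d) k) (bsize TYPE('d) k)
      else subdiagonal (N $ b) t m ?m (k - 1) * Lam_dir ?n (k - 1) k)"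
  proof (cases k)
    case 0
    show ?thesis unfolding 1[symmetric]
      by (rule eq_matI) (simp_all add: 0 diagonal_def dims adm adm')
  next
    case (Suc p)
    have 2: "\<beta> t m k * Lam_dir ?n p k - \<beta> t ?m k * Lam_dir ?n p k = subdiagonal (N $ b) t m ?m p * Lam_dir ?n p k"
      unfolding Suc beta_difference[OF adm, symmetric]
      by (rule minus_mult_distrib_mat[symmetric, of _ "bsize TYPE('d) (Suc p)" "bsize TYPE('d) p" _ _ "bsize TYPE('d) (Suc p)"])
        (auto simp: dims adm adm')
    have "diagonal ?n t ?m ?m k - diagonal ?n t m m k =
        (?L * \<beta> t m (Suc k) - ?L * \<beta> t ?m (Suc k)) - (\<beta> t m k * Lam_dir ?n p k - \<beta> t ?m k * Lam_dir ?n p k)"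
      unfolding diagonal_def Suc
      by (rule eq_matI) (simp_all add: dims adm adm')
    then show ?thesis unfolding 1 2 using Suc by simp
  qed
  finally show ?thesis
    by (cases k) (simp_all add: subdiagonal_def Tshift_def Lam_eq_Lam_dir mat_mult_assoc dims adm adm')
qed

lemma toda_H_shift:
  assumes adm: "adm t m"
  shows "has_tderiv a (\<lambda>t. Tdiff b (\<lambda>m. H t m k) m * minv (H t m k)) t
    (Lam_dir (N $ b) k (k + 1) * H t m (k + 1) * transpose_mat (Lam a k (k + 1)) * minv (H t m k)
     - (if k = 0 then 0\<^sub>m (bsize TYPE('d) k) (bsize TYPE('d) k)
        else Tshift b (\<lambda>m. H t m k) m * transpose_mat (Lam a (k - 1) k)
          * minv (Tshift b (\<lambda>m. H t m (k - 1)) m) * Lam_dir (N $ b) (k - 1) k))"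
    (is "has_tderiv a _ t ?D")
proof (rule has_tderiv_cong)
  let ?m = "m + axis b 1" and ?n = "N $ b"
  \<comment> \<open>By \<open>H_shift\<close>, (T_b H) H^(-1) is \<open>diagonal\<close> minus q_b
    times the identity, and \<Delta>_b subtracts the identity once more; this constant matrix has
    derivative zero.\<close>
  let ?c = "(q $ b + 1) \<cdot>\<^sub>m 1\<^sub>m (bsize TYPE('d) k)"
  note adm' = admissible_shift[OF adm, of b]
  have D: "?D = Lam_dir ?n k (Suc k) * subdiagonal (axis a 1) t m m k
      - (if k = 0 then 0\<^sub>m (bsize TYPE('d) k) (bsize TYPE('d) k)
         else subdiagonal (axis a 1) t ?m ?m (k - 1) * Lam_dir ?n (k - 1) k)" (is "_ = ?D'")
    by (cases k) (simp_all add: subdiagonal_def Tshift_def Lam_eq_Lam_dir mat_mult_assoc dims adm adm')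
  have dim: "dim_row ?D' = bsize TYPE('d) k" "dim_col ?D' = bsize TYPE('d) k"
    by (cases k; simp add: dim_subdiagonal adm adm')+
  have "has_tderiv a (\<lambda>t. diagonal ?n t ?m m k - ?c) t (?D' - 0\<^sub>m (bsize TYPE('d) k) (bsize TYPE('d) k))"
    using has_tderiv_minus[OF has_tderiv_diagonal[OF adm adm', of a ?n k] has_tderiv_const[of a ?c]] dim by simp
  moreover have "?D' - 0\<^sub>m (bsize TYPE('d) k) (bsize TYPE('d) k) = ?D'"
    using dim by (intro eq_matI) simp_all
  ultimately show "has_tderiv a (\<lambda>t. diagonal ?n t ?m m k - ?c) t ?D" unfolding D by (simp only:)
  fix s
  let ?t = "t(axis a 1 := s)"
  note admt = admissible_update[OF adm, of a s] and admt' = admissible_update[OF adm', of a s]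
  let ?A = "diagonal ?n ?t ?m m k" and ?H = "H ?t m k"
  have car: "?A \<in> carrier_mat (bsize TYPE('d) k) (bsize TYPE('d) k)"
    unfolding diagonal_blk[OF admt' admt] by simp
  have "Tdiff b (\<lambda>m. H ?t m k) m = (?A - ?c) * ?H"
  proof -
    have "(?A - ?c) * ?H = ?A * ?H - ?c * ?H"
      by (rule minus_mult_distrib_mat[OF car _ H_carrier[OF admt]]) simp
    also have "?c * ?H = (q $ b + 1) \<cdot>\<^sub>m (1\<^sub>m (bsize TYPE('d) k) * ?H)"
      by (rule mult_smult_assoc_mat[OF one_carrier_mat H_carrier[OF admt]])
    also have "1\<^sub>m (bsize TYPE('d) k) * ?H = ?H"
      by (rule left_mult_one_mat[OF H_carrier[OF admt]])
    also have "?A * ?H - (q $ b + 1) \<cdot>\<^sub>m ?H = ?A * ?H - q $ b \<cdot>\<^sub>m ?H - ?H"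
      using H_carrier[OF admt, of k] car by (intro eq_matI) (auto simp: algebra_simps)
    finally show ?thesis unfolding Tdiff_def Tshift_def H_shift[OF admt] by (rule sym)
  qed
  then show "Tdiff b (\<lambda>m. H ?t m k) m * minv ?H = ?A - ?c"
    using admt car by (simp add: mult_H_minv_H)
qed

text \<open>The derivative of \<beta> in direction b is rewritten by
  \<open>subdiagonal_recurrence\<close> and then differentiated in direction a; p stands for k - 1.
  The signs on the right come from the derivative of \<beta> being minus a subdiagonal block. All
  three are opposite to those of the second order equation displayed in the opening statement, as
  the normalization G = S^(-1) H S^(-T) with \<beta> a block of S dictates.\<close>

lemma toda_beta:
  assumes adm: "adm t m"
  shows "\<exists>D. has_tderiv a (\<lambda>t. \<beta> t m (Suc p) * Lam b p (Suc p) * \<beta> t m (Suc p)) t D"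
    and "has_tderiv a (\<lambda>t. tderiv b (\<lambda>t. \<beta> t m (Suc p)) t) t
      (tderiv a (\<lambda>t. \<beta> t m (Suc p) * Lam b p (Suc p) * \<beta> t m (Suc p)) t
       - (if p = 0 then 0\<^sub>m (bsize TYPE('d) (Suc p)) (bsize TYPE('d) p)
          else tderiv a (\<lambda>t. \<beta> t m (Suc p)) t * \<beta> t m p * Lam b (p - 1) p)
       - Lam b (Suc p) (Suc (Suc p)) * \<beta> t m (Suc (Suc p)) * tderiv a (\<lambda>t. \<beta> t m (Suc p)) t)"
proof -
  let ?a = "axis a 1 :: 'd point" and ?b = "axis b 1 :: 'd point"
  let ?B = "\<lambda>t. \<beta> t m (Suc p)" and ?B2 = "\<lambda>t. \<beta> t m (Suc (Suc p))"
  let ?L = "Lam b p (Suc p)" and ?L2 = "Lam b (Suc p) (Suc (Suc p))"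
  let ?r = "bsize TYPE('d) (Suc p)" and ?c = "bsize TYPE('d) p" and ?r2 = "bsize TYPE('d) (Suc (Suc p))"
  define B' where "B' = - subdiagonal ?a t m m p"
  define B2' where "B2' = - subdiagonal ?a t m m (Suc p)"
  \<comment> \<open>The term of the recurrence with the block of \<open>S\<close> two places below
    the diagonal; for p = 0 that block would have a negative index, and the term is zero.\<close>
  define Q where "Q t = (if p = 0 then 0\<^sub>m ?r ?c else S t m (Suc p) (p - 1) * Lam b (p - 1) p)" for t
  define Q' where "Q' = (if p = 0 then 0\<^sub>m ?r ?c else B' * \<beta> t m p * Lam b (p - 1) p)"
  have dim: "dim_row B' = ?r" "dim_col B' = ?c" "dim_row B2' = ?r2" "dim_col B2' = ?r"
    by (simp_all add: B'_def B2'_def dim_subdiagonal adm)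
  have dB: "has_tderiv a ?B t B'" and dB2: "has_tderiv a ?B2 t B2'"
    unfolding B'_def B2'_def by (rule has_tderiv_beta[OF adm])+
  have tB: "tderiv a ?B t = B'" by (rule has_tderiv_imp(2)[OF dB])
  have "has_tderiv a (\<lambda>t. ?B t * ?L * ?B t) t (B' * ?L * ?B t + ?B t * ?L * B')"
    by (intro has_tderiv_mult has_tderiv_mult_const dB) (simp_all add: dim)
  moreover define D0 where "D0 = B' * ?L * ?B t + ?B t * ?L * B'"
  ultimately have d0: "has_tderiv a (\<lambda>t. ?B t * ?L * ?B t) t D0" by simp
  then show "\<exists>D. has_tderiv a (\<lambda>t. ?B t * ?L * ?B t) t D" ..
  have dim0: "dim_row D0 = ?r" "dim_col D0 = ?c"
    by (simp_all add: D0_def dim dims adm)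
  have d1: "has_tderiv a (\<lambda>t. ?L2 * (?B2 t * ?B t)) t (?L2 * (B2' * ?B t + ?B2 t * B'))"
    by (intro has_tderiv_mult has_tderiv_const_mult dB dB2) (simp_all add: dim dims adm)
  have dQ: "has_tderiv a Q t Q'"
  proof (cases p)
    case 0
    then show ?thesis using has_tderiv_const[of a "0\<^sub>m ?r ?c"] by (simp add: Q_def[abs_def] Q'_def)
  next
    case (Suc r)
    have "- (subdiagonal ?a t m m p * S t m p r) = B' * \<beta> t m p"
      unfolding B'_def using adm by (simp add: Suc beta uminus_mult_left_mat dim_subdiagonal dims)
    then have "has_tderiv a (\<lambda>t. S t m (Suc p) r) t (B' * \<beta> t m p)"
      using has_tderiv_S[OF adm, of r p a] Suc by simp
    from has_tderiv_mult_const[OF this, of "Lam b r p"] show ?thesis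
      using Suc adm by (simp add: Q_def[abs_def] Q'_def dims)
  qed
  have "- (subdiagonal ?a t m m (Suc p) * S t m (Suc p) p) = B2' * ?B t"
    unfolding B2'_def using adm by (simp add: beta uminus_mult_left_mat dim_subdiagonal dims)
  then have "has_tderiv a (\<lambda>t. S t m (Suc (Suc p)) p) t (B2' * ?B t)"
    using has_tderiv_S[OF adm, of p "Suc p" a] by simp
  then have dS: "has_tderiv a (\<lambda>t. ?L2 * S t m (Suc (Suc p)) p) t (?L2 * (B2' * ?B t))"
    by (rule has_tderiv_const_mult) (simp add: dim)
  have dimQ: "dim_row Q' = ?r" "dim_col Q' = ?c" by (simp_all add: Q'_def dim)
  have main: "has_tderiv a (\<lambda>t. ?B t * ?L * ?B t - ?L2 * (?B2 t * ?B t) - Q t + ?L2 * S t m (Suc (Suc p)) p) t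
      (D0 - ?L2 * (B2' * ?B t + ?B2 t * B') - Q' + ?L2 * (B2' * ?B t))"
    by (intro has_tderiv_add has_tderiv_minus d0 d1 dQ dS) (simp_all add: dim dim0 dimQ dims adm)
  \<comment> \<open>The derivative of \<open>S\<close> two places below the diagonal is the
    derivative of the higher \<beta> times the lower \<beta>. It cancels one half of the product
    rule for two consecutive \<beta>, so only the term with the higher \<beta> undifferentiated
    remains.\<close>
  have D: "D0 - ?L2 * (B2' * ?B t + ?B2 t * B') - Q' + ?L2 * (B2' * ?B t) = D0 - Q' - ?L2 * ?B2 t * B'"
  proof -
    have "?L2 * (B2' * ?B t + ?B2 t * B') = ?L2 * (B2' * ?B t) + ?L2 * (?B2 t * B')"
      by (rule mult_add_distrib_mat[of _ ?r ?r2 _ ?c]) (auto simp: dim dims adm)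
    moreover have "?L2 * ?B2 t * B' = ?L2 * (?B2 t * B')"
      by (rule mat_mult_assoc) (simp_all add: dim dims adm)
    ultimately show ?thesis
      by (simp only:) (rule eq_matI, auto simp: dim dim0 dimQ dims adm)
  qed
  have "has_tderiv a (\<lambda>t. tderiv b ?B t) t (D0 - Q' - ?L2 * ?B2 t * B')"
    unfolding D[symmetric]
  proof (rule has_tderiv_cong[OF main])
    fix s
    let ?t = "t(axis a 1 := s)"
    note admt = admissible_update[OF adm, of a s]
    have "tderiv b ?B ?t = - subdiagonal ?b ?t m m p"
      by (rule has_tderiv_imp(2)[OF has_tderiv_beta[OF admt]])
    also have "subdiagonal ?b ?t m m p = Q ?t - ?L2 * S ?t m (Suc (Suc p)) p - diagonal ?b ?t m m (Suc p) * ?B ?t"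
      unfolding subdiagonal_recurrence[OF admt] Q_def Lam_eq_Lam_dir ..
    also have "diagonal ?b ?t m m (Suc p) * ?B ?t = ?B ?t * ?L * ?B ?t - ?L2 * ?B2 ?t * ?B ?t"
      unfolding diagonal_def Lam_eq_Lam_dir
      by (simp del: One_nat_def, rule minus_mult_distrib_mat[of _ ?r ?r _ _ ?c]) (auto simp: dims admt simp del: One_nat_def)
    also have "?L2 * ?B2 ?t * ?B ?t = ?L2 * (?B2 ?t * ?B ?t)"
      by (rule mat_mult_assoc) (simp_all add: dims admt del: One_nat_def)
    also have "- (Q ?t - ?L2 * S ?t m (Suc (Suc p)) p - (?B ?t * ?L * ?B ?t - ?L2 * (?B2 ?t * ?B ?t))) =
        ?B ?t * ?L * ?B ?t - ?L2 * (?B2 ?t * ?B ?t) - Q ?t + ?L2 * S ?t m (Suc (Suc p)) p"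
      by (rule eq_matI) (auto simp: Q_def dims admt simp del: One_nat_def)
    finally show "tderiv b ?B ?t =
        ?B ?t * ?L * ?B ?t - ?L2 * (?B2 ?t * ?B ?t) - Q ?t + ?L2 * S ?t m (Suc (Suc p)) p" .
  qed
  then show "has_tderiv a (\<lambda>t. tderiv b ?B t) t
      (tderiv a (\<lambda>t. ?B t * ?L * ?B t) t
       - (if p = 0 then 0\<^sub>m ?r ?c else tderiv a ?B t * \<beta> t m p * Lam b (p - 1) p)
       - ?L2 * ?B2 t * tderiv a ?B t)"
    unfolding tB has_tderiv_imp(2)[OF d0] Q'_def .
qed

end

theorem theorem4p5p1:
  fixes \<mu> :: "'d::{finite,linorder} point measure"
    and N :: "'d coeffs" and q :: "'d point"
    and S :: "'d times \<Rightarrow> 'd ishift \<Rightarrow> nat \<Rightarrow> nat \<Rightarrow> real mat"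
    and H :: "'d times \<Rightarrow> 'd ishift \<Rightarrow> nat \<Rightarrow> real mat"
    and \<beta> :: "'d times \<Rightarrow> 'd ishift \<Rightarrow> nat \<Rightarrow> real mat"
    and a b :: 'd and t :: "'d times" and m :: "'d ishift"
  assumes N: "invertible N"
    and q: "\<And>c. q $ c \<noteq> 0"
    and borel: "sets \<mu> = sets borel"
    and moments: "\<And>\<gamma>. integrable \<mu> (monomial \<gamma>)"
    and support: "AE x in \<mu>. \<forall>c. \<bar>N $ c \<bullet> x\<bar> < \<bar>q $ c\<bar>"
    and factorization: "\<And>t m. admissible \<mu> N q t m \<Longrightarrow>
      block_factorization TYPE('d) (moment_matrix \<mu> N q t m) (S t m) (H t m)"
    and beta: "\<And>t m k. k \<ge> 1 \<Longrightarrow> \<beta> t m k = S t m k (k - 1)"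
    and tm: "admissible \<mu> N q t m"
  shows "(\<forall>k. tdifferentiable a (\<lambda>t. H t m k) t \<and>
       tdifferentiable b (\<lambda>t. tderiv a (\<lambda>t. H t m k) t * minv (H t m k)) t \<and>
       tdifferentiable a (\<lambda>t. Tshift b (\<lambda>m. H t m k) m) t \<and>
       tdifferentiable a (\<lambda>t. Tdiff b (\<lambda>m. H t m k) m * minv (H t m k)) t) \<and>
    (\<forall>k\<ge>1. tdifferentiable a (\<lambda>t. \<beta> t m k) t \<and>
       tdifferentiable b (\<lambda>t. \<beta> t m k) t \<and>
       tdifferentiable a (\<lambda>t. tderiv b (\<lambda>t. \<beta> t m k) t) t \<and>
       tdifferentiable a (\<lambda>t. \<beta> t m k * Lam b (k - 1) k * \<beta> t m k) t) \<and>
    (\<forall>k. tderiv b (\<lambda>t. tderiv a (\<lambda>t. H t m k) t * minv (H t m k)) t =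
       Lam a k (k + 1) * H t m (k + 1) * transpose_mat (Lam b k (k + 1)) * minv (H t m k)
       - (if k = 0 then 0\<^sub>m (bsize TYPE('d) k) (bsize TYPE('d) k)
          else H t m k * transpose_mat (Lam b (k - 1) k) * minv (H t m (k - 1)) * Lam a (k - 1) k)) \<and>
    (\<forall>k\<ge>1. tderiv a (\<lambda>t. tderiv b (\<lambda>t. \<beta> t m k) t) t =
       tderiv a (\<lambda>t. \<beta> t m k * Lam b (k - 1) k * \<beta> t m k) t
       - (if k = 1 then 0\<^sub>m (bsize TYPE('d) k) (bsize TYPE('d) (k - 1))
          else tderiv a (\<lambda>t. \<beta> t m k) t * \<beta> t m (k - 1) * Lam b (k - 2) (k - 1))
       - Lam b k (k + 1) * \<beta> t m (k + 1) * tderiv a (\<lambda>t. \<beta> t m k) t) \<and>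
    (\<forall>k. Tdiff b (\<lambda>m. tderiv a (\<lambda>t. H t m k) t * minv (H t m k)) m =
       Lam a k (k + 1) * H t m (k + 1) * transpose_mat (Lam_dir (N $ b) k (k + 1))
         * minv (Tshift b (\<lambda>m. H t m k) m)
       - (if k = 0 then 0\<^sub>m (bsize TYPE('d) k) (bsize TYPE('d) k)
          else H t m k * transpose_mat (Lam_dir (N $ b) (k - 1) k)
            * minv (Tshift b (\<lambda>m. H t m (k - 1)) m) * Lam a (k - 1) k)) \<and>
    (\<forall>k. tderiv a (\<lambda>t. Tdiff b (\<lambda>m. H t m k) m * minv (H t m k)) t =
       Lam_dir (N $ b) k (k + 1) * H t m (k + 1) * transpose_mat (Lam a k (k + 1))
         * minv (H t m k)
       - (if k = 0 then 0\<^sub>m (bsize TYPE('d) k) (bsize TYPE('d) k)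
          else Tshift b (\<lambda>m. H t m k) m * transpose_mat (Lam a (k - 1) k)
            * minv (Tshift b (\<lambda>m. H t m (k - 1)) m) * Lam_dir (N $ b) (k - 1) k))"
proof -
  interpret toda \<mu> N q S H \<beta>
    by unfold_locales (fact N borel support factorization beta)+
  note tm' = admissible_shift[OF tm, of b]
  show ?thesis
  proof (intro conjI allI impI)
    fix k
    show "tdifferentiable a (\<lambda>t. H t m k) t"
      by (rule has_tderiv_imp(1)[OF has_tderiv_H[OF tm]])
    show "tdifferentiable a (\<lambda>t. Tshift b (\<lambda>m. H t m k) m) t"
      unfolding Tshift_def by (rule has_tderiv_imp(1)[OF has_tderiv_H[OF tm']])
    show "tdifferentiable b (\<lambda>t. tderiv a (\<lambda>t. H t m k) t * minv (H t m k)) t"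
      by (rule has_tderiv_imp(1)[OF toda_H[OF tm]])
    show "tdifferentiable a (\<lambda>t. Tdiff b (\<lambda>m. H t m k) m * minv (H t m k)) t"
      by (rule has_tderiv_imp(1)[OF toda_H_shift[OF tm]])
  next
    fix k :: nat assume "1 \<le> k"
    then obtain p where k: "k = Suc p" by (cases k) auto
    obtain D where D: "has_tderiv a (\<lambda>t. \<beta> t m (Suc p) * Lam b p (Suc p) * \<beta> t m (Suc p)) t D"
      using toda_beta(1)[OF tm] by blast
    show "tdifferentiable a (\<lambda>t. \<beta> t m k) t" "tdifferentiable b (\<lambda>t. \<beta> t m k) t"
      unfolding k by (rule has_tderiv_imp(1)[OF has_tderiv_beta[OF tm]])+
    show "tdifferentiable a (\<lambda>t. tderiv b (\<lambda>t. \<beta> t m k) t) t"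
      unfolding k by (rule has_tderiv_imp(1)[OF toda_beta(2)[OF tm]])
    show "tdifferentiable a (\<lambda>t. \<beta> t m k * Lam b (k - 1) k * \<beta> t m k) t"
      using has_tderiv_imp(1)[OF D] by (simp add: k)
    show "tderiv a (\<lambda>t. tderiv b (\<lambda>t. \<beta> t m k) t) t =
       tderiv a (\<lambda>t. \<beta> t m k * Lam b (k - 1) k * \<beta> t m k) t
       - (if k = 1 then 0\<^sub>m (bsize TYPE('d) k) (bsize TYPE('d) (k - 1))
          else tderiv a (\<lambda>t. \<beta> t m k) t * \<beta> t m (k - 1) * Lam b (k - 2) (k - 1))
       - Lam b k (k + 1) * \<beta> t m (k + 1) * tderiv a (\<lambda>t. \<beta> t m k) t"
      using has_tderiv_imp(2)[OF toda_beta(2)[OF tm, of a b p]] by (cases p) (simp_all add: k)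
  next
    fix k
    show "tderiv b (\<lambda>t. tderiv a (\<lambda>t. H t m k) t * minv (H t m k)) t =
       Lam a k (k + 1) * H t m (k + 1) * transpose_mat (Lam b k (k + 1)) * minv (H t m k)
       - (if k = 0 then 0\<^sub>m (bsize TYPE('d) k) (bsize TYPE('d) k)
          else H t m k * transpose_mat (Lam b (k - 1) k) * minv (H t m (k - 1)) * Lam a (k - 1) k)"
      by (rule has_tderiv_imp(2)[OF toda_H[OF tm]])
    show "Tdiff b (\<lambda>m. tderiv a (\<lambda>t. H t m k) t * minv (H t m k)) m =
       Lam a k (k + 1) * H t m (k + 1) * transpose_mat (Lam_dir (N $ b) k (k + 1))
         * minv (Tshift b (\<lambda>m. H t m k) m)
       - (if k = 0 then 0\<^sub>m (bsize TYPE('d) k) (bsize TYPE('d) k)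
          else H t m k * transpose_mat (Lam_dir (N $ b) (k - 1) k)
            * minv (Tshift b (\<lambda>m. H t m (k - 1)) m) * Lam a (k - 1) k)"
      by (rule toda_H_difference[OF tm])
    show "tderiv a (\<lambda>t. Tdiff b (\<lambda>m. H t m k) m * minv (H t m k)) t =
       Lam_dir (N $ b) k (k + 1) * H t m (k + 1) * transpose_mat (Lam a k (k + 1))
         * minv (H t m k)
       - (if k = 0 then 0\<^sub>m (bsize TYPE('d) k) (bsize TYPE('d) k)
          else Tshift b (\<lambda>m. H t m k) m * transpose_mat (Lam a (k - 1) k)
            * minv (Tshift b (\<lambda>m. H t m (k - 1)) m) * Lam_dir (N $ b) (k - 1) k)"
      by (rule has_tderiv_imp(2)[OF toda_H_shift[OF tm]])
  qed
qed

end
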